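(* The operators $\widehat D_A,\widehat D_B:\mathbf R^3\to\mathbf R^3$ (defined in the context) define a projective representation of $SL(2,\mathbb Z)$; namely $$\widehat D_A\widehat D_B\widehat D_A\;\propto\;\widehat D_B\widehat D_A\widehat D_B,\qquad \left(\widehat D_A\widehat D_B\widehat D_A\right)^4\;\propto\;\mathrm{Id},$$ where $X\propto Y$ means $X=\lambda Y$ for some unit $\lambda\in\mathbf R^\times$ that is independent of $p$ and $s$ (i.e. represented by a function of $Q$ only).
   Context: **Ring $\mathbf R$.** Let $(Q,p,s)$ be coordinates on $(\mathbb C^\times)^3$, $\mathbb C^\times=\mathbb C\setminus\{0\}$. Consider holomorphic functions $f:U\to\mathbb C$ on open dense (not necessarily connected) subsets $U\subset(\mathbb C^\times)^3$; $f_1:U_1\to\mathbb C$ and $f_2:U_2\to\mathbb C$ are equivalent if they agree on some open dense subset of $U_1\cap U_2$. $\mathbf R$ is the commutative ring of equivalence classes, with addition and multiplication defined pointwise on $U_1\cap U_2$; $\mathbf R^\times$ is its group of units. **Plethystic exponent.** For $z\in\mathbb C$ and $0<|p_j|<1$ put $(z;p_1,\dots,p_n)=\prod_{i_1,\dots,i_n\ge 0}(1-zp_1^{i_1}\cdots p_n^{i_n})$. This is extended to all $p_j\in\mathbb C$ with $|p_j|\ne0,1$ as a meromorphic function by $(z;p_1,\dots,p_j^{-1},\dots,p_n)=1/(p_jz;p_1,\dots,p_j,\dots,p_n)$. Let $\mu=\sum_m c_m Q^{m_1}p^{m_2}s^{m_3}$ be a Laurent polynomial with integer coefficients having no terms of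 degree $0$ in $Q$, and let $(a_i,b_i)\in\mathbb Z^2\setminus\{(0,0)\}$, $1\le i\le n$, $n\geq 1$. Define $$\mathrm{pexp}\Big(\tfrac{\mu}{\prod_{i=1}^n(1-p^{a_i}s^{b_i})}\Big)=\prod_m\big(Q^{m_1}p^{m_2}s^{m_3};p^{a_1}s^{b_1},\dots,p^{a_n}s^{b_n}\big)^{c_m}\in\mathbf R^\times .$$ This depends only on the fraction as a rational function of $(Q,p,s)$. **Operators.** For $\begin{pmatrix}a&b\\c&d\end{pmatrix}\in SL(2,\mathbb Z)$ let $\widehat\delta_{(p,s)\mapsto(p^as^b,p^cs^d)}$ be the ring automorphism of $\mathbf R$ given by $f(Q,p,s)\mapsto f(Q,p^as^b,p^cs^d)$, acting entrywise on $\mathbf R^3$. Put $D_A=\mathrm{diag}(1,-\mathrm iQ,-1)$ and $$D_B=\begin{pmatrix}\alpha&\frac{2Q}{1-Q^4}\beta&\frac{2Q^4}{(1-Q^4)^2}\alpha\\[2pt]-\frac{1-Q^4}{Q^3}\gamma&0&\frac{2Q}{1-Q^4}\gamma\\[2pt]\frac{(1-Q^4)^2}{2Q^4}\alpha&-\frac{1-Q^4}{Q^3}\beta&\alpha\end{pmatrix},$$ $$\alpha=\mathrm{pexp}\Big(\tfrac{-(Q^8-Q^{-8})ps^{-1}(s^2+2ps+p)}{(1-s^2)(1-p^2/s^2)}\Big),\quad \beta=\mathrm{pexp}\Big(\tfrac{-(Q^8-Q^{-8})ps^{-1}(s+2ps+p)}{(1-s^2)(1-p^2/s^2)}\Big),\quad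 \gamma=\mathrm{pexp}\Big(\tfrac{-(Q^8-Q^{-8})p(s+2p+1)}{(1-s^2)(1-p^2/s^2)}\Big).$$ The operators on $\mathbf R^3$ are $\widehat D_A=D_A\circ\widehat\delta_{(p,s)\mapsto(ps,s)}$ and $\widehat D_B=D_B\circ\widehat\delta_{(p,s)\mapsto(p,s/p)}$. *)

theory Defs
  imports "HOL-Analysis.Analysis" "HOL-Library.Poly_Mapping"
begin

section \<open>The ring of generically defined holomorphic functions\<close>

text \<open>Points are triples \<open>(Q, p, s)\<close>.\<close>

type_synonym point = "complex \<times> complex \<times> complex"

definition torus :: "point set" where
  "torus = {(Q, p, s). Q \<noteq> 0 \<and> p \<noteq> 0 \<and> s \<noteq> 0}"

definition open_dense :: "point set \<Rightarrow> bool" where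
  "open_dense U \<longleftrightarrow> open U \<and> U \<subseteq> torus \<and> torus \<subseteq> closure U"

text \<open>Holomorphy in three variables: the real Frechet derivative exists and is complex-linear
  (additivity is part of \<^const>\<open>has_derivative\<close>).\<close>

definition holo_on :: "(point \<Rightarrow> complex) \<Rightarrow> point set \<Rightarrow> bool" where
  "holo_on f U \<longleftrightarrow> (\<forall>z\<in>U. \<exists>D. (f has_derivative D) (at z) \<and>
     (\<forall>c h k l. D (c * h, c * k, c * l) = c * D (h, k, l)))"

text \<open>A pair \<open>(U, f)\<close> stands for the function \<open>f\<close> restricted to \<open>U\<close>.\<close>

fun hrel :: "point set \<times> (point \<Rightarrow> complex) \<Rightarrow> point set \<times> (point \<Rightarrow> complex) \<Rightarrow> bool" where
  "hrel (U1, f1) (U2, f2) \<longleftrightarrow>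
     open_dense U1 \<and> holo_on f1 U1 \<and> open_dense U2 \<and> holo_on f2 U2 \<and>
     (\<exists>V. open_dense V \<and> V \<subseteq> U1 \<inter> U2 \<and> (\<forall>x\<in>V. f1 x = f2 x))"

lemma open_torus: "open torus"
proof -
  have eq: "torus = (- {0}) \<times> (- {0}) \<times> (- {0})"
    by (auto simp: torus_def)
  show ?thesis
    unfolding eq by (intro open_Times open_Compl closed_singleton)
qed

lemma open_dense_torus: "open_dense torus"
  using open_torus closure_subset by (auto simp: open_dense_def)

lemma open_dense_Int:
  assumes "open_dense U" "open_dense V"
  shows "open_dense (U \<inter> V)"
proof -
  have "x \<in> closure (U \<inter> V)" if x: "x \<in> torus" for x
    unfolding closure_iff_nhds_not_empty
  proof (intro allI impI)
    fix A S assume A: "S \<subseteq> A" "open S" "x \<in> S"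
    from x assms(1) have "x \<in> closure U" by (auto simp: open_dense_def)
    with A have "S \<inter> U \<noteq> {}" using open_Int_closure_eq_empty[of S U] by blast
    then obtain y where y: "y \<in> S \<inter> U" by blast
    have o: "open (S \<inter> U)" using A assms(1) by (auto simp: open_dense_def)
    have "y \<in> closure V" using y assms by (auto simp: open_dense_def)
    then have "(S \<inter> U) \<inter> V \<noteq> {}" using o y open_Int_closure_eq_empty[of "S \<inter> U" V] by blast
    with A show "(U \<inter> V) \<inter> A \<noteq> {}" by blast
  qed
  with assms show ?thesis by (auto simp: open_dense_def)
qed

lemma open_dense_nonempty: "open_dense U \<Longrightarrow> U \<noteq> {}"
  using closure_empty by (fastforce simp: open_dense_def torus_def)

lemma open_dense_mono:
  "open_dense U \<Longrightarrow> U \<subseteq> V \<Longrightarrow> open V \<Longrightarrow> V \<subseteq> torus \<Longrightarrow> open_dense V"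
  using closure_mono[of U V] by (auto simp: open_dense_def)

lemma holo_on_subset: "holo_on f U \<Longrightarrow> V \<subseteq> U \<Longrightarrow> holo_on f V"
  by (auto simp: holo_on_def)

lemma holo_on_const: "holo_on (\<lambda>_. c) U"
  unfolding holo_on_def by (intro ballI exI[of _ "\<lambda>_. 0"]) auto

lemma holo_on_add:
  assumes "holo_on f U" "holo_on g U" shows "holo_on (\<lambda>x. f x + g x) U"
  unfolding holo_on_def
proof
  fix z assume "z \<in> U"
  with assms obtain D E where
    "(f has_derivative D) (at z)" "\<And>c h k l. D (c * h, c * k, c * l) = c * D (h, k, l)"
    "(g has_derivative E) (at z)" "\<And>c h k l. E (c * h, c * k, c * l) = c * E (h, k, l)"
    by (fastforce simp: holo_on_def)
  then show "\<exists>D. ((\<lambda>x. f x + g x) has_derivative D) (at z) \<and>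
      (\<forall>c h k l. D (c * h, c * k, c * l) = c * D (h, k, l))"
    by (intro exI[of _ "\<lambda>h. D h + E h"]) (auto intro!: has_derivative_add simp: algebra_simps)
qed

lemma holo_on_mult:
  assumes "holo_on f U" "holo_on g U" shows "holo_on (\<lambda>x. f x * g x) U"
  unfolding holo_on_def
proof
  fix z assume "z \<in> U"
  with assms obtain D E where
    D: "(f has_derivative D) (at z)" "\<And>c h k l. D (c * h, c * k, c * l) = c * D (h, k, l)"
    and E: "(g has_derivative E) (at z)" "\<And>c h k l. E (c * h, c * k, c * l) = c * E (h, k, l)"
    by (fastforce simp: holo_on_def)
  then show "\<exists>D. ((\<lambda>x. f x * g x) has_derivative D) (at z) \<and>
      (\<forall>c h k l. D (c * h, c * k, c * l) = c * D (h, k, l))"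
    by (intro exI[of _ "\<lambda>h. f z * E h + D h * g z"] conjI has_derivative_mult D(1) E(1))
      (auto simp: D(2) E(2) algebra_simps)
qed

lemma holo_on_uminus: "holo_on f U \<Longrightarrow> holo_on (\<lambda>x. - f x) U"
  using holo_on_mult[OF holo_on_const[of "-1"]] by fastforce

lemma hrel_sym: "hrel x y \<Longrightarrow> hrel y x"
  by (cases x; cases y) (simp only: hrel.simps, metis Int_commute)

lemma hrel_trans: "hrel x y \<Longrightarrow> hrel y z \<Longrightarrow> hrel x z"
proof (cases x; cases y; cases z)
  fix U f V g W h
  assume *: "hrel x y" "hrel y z" "x = (U, f)" "y = (V, g)" "z = (W, h)"
  then obtain A B where
    "open_dense A" "A \<subseteq> U \<inter> V" "\<forall>x\<in>A. f x = g x"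
    "open_dense B" "B \<subseteq> V \<inter> W" "\<forall>x\<in>B. g x = h x" by auto
  then have "open_dense (A \<inter> B)" "A \<inter> B \<subseteq> U \<inter> W" "\<forall>x\<in>A \<inter> B. f x = h x"
    by (auto intro: open_dense_Int)
  with * show "hrel x z" by auto
qed

lemma hrel_refl_iff: "hrel (U, f) (U, f) \<longleftrightarrow> open_dense U \<and> holo_on f U"
  by auto

lemma hrel_subset:
  "open_dense U \<Longrightarrow> holo_on f V \<Longrightarrow> open_dense V \<Longrightarrow> U \<subseteq> V \<Longrightarrow> hrel (U, f) (V, f)"
  by (auto intro: holo_on_subset)

quotient_type hfun = "point set \<times> (point \<Rightarrow> complex)" / partial: hrel
  morphisms rep_hfun abs_hfun
proof (rule part_equivpI)
  show "\<exists>x. hrel x x"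
    using open_dense_torus holo_on_const hrel_refl_iff by blast
  show "symp hrel" by (rule sympI) (rule hrel_sym)
  show "transp hrel" by (rule transpI) (rule hrel_trans)
qed

lemma hrel_binop:
  assumes "hrel (U1, f1) (U2, f2)" "hrel (V1, g1) (V2, g2)"
    and "\<And>f g U. holo_on f U \<Longrightarrow> holo_on g U \<Longrightarrow> holo_on (\<lambda>x. F (f x) (g x)) U"
  shows "hrel (U1 \<inter> V1, \<lambda>x. F (f1 x) (g1 x)) (U2 \<inter> V2, \<lambda>x. F (f2 x) (g2 x))"
proof -
  from assms obtain A B where
    "open_dense A" "A \<subseteq> U1 \<inter> U2" "\<forall>x\<in>A. f1 x = f2 x"
    "open_dense B" "B \<subseteq> V1 \<inter> V2" "\<forall>x\<in>B. g1 x = g2 x" by auto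
  then have "open_dense (A \<inter> B)" "A \<inter> B \<subseteq> (U1 \<inter> V1) \<inter> (U2 \<inter> V2)"
    "\<forall>x\<in>A \<inter> B. F (f1 x) (g1 x) = F (f2 x) (g2 x)"
    by (auto intro: open_dense_Int)
  moreover have "holo_on (\<lambda>x. F (f1 x) (g1 x)) (U1 \<inter> V1)" "holo_on (\<lambda>x. F (f2 x) (g2 x)) (U2 \<inter> V2)"
    using assms by (auto intro!: assms(3) intro: holo_on_subset)
  ultimately show ?thesis
    using assms(1,2) by (auto intro!: open_dense_Int)
qed

instantiation hfun :: comm_ring_1
begin

lift_definition zero_hfun :: hfun is "(torus, \<lambda>_. 0)"
  by (simp only: hrel_refl_iff open_dense_torus holo_on_const simp_thms)

lift_definition one_hfun :: hfun is "(torus, \<lambda>_. 1)"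
  by (simp only: hrel_refl_iff open_dense_torus holo_on_const simp_thms)

lift_definition plus_hfun :: "hfun \<Rightarrow> hfun \<Rightarrow> hfun"
  is "\<lambda>(U, f) (V, g). (U \<inter> V, \<lambda>x. f x + g x)"
  by clarify (rule hrel_binop, auto intro: holo_on_add)

lift_definition times_hfun :: "hfun \<Rightarrow> hfun \<Rightarrow> hfun"
  is "\<lambda>(U, f) (V, g). (U \<inter> V, \<lambda>x. f x * g x)"
  by clarify (rule hrel_binop, auto intro: holo_on_mult)

lift_definition uminus_hfun :: "hfun \<Rightarrow> hfun"
  is "\<lambda>(U, f). (U, \<lambda>x. - f x)"
  by (auto intro: holo_on_uminus)

definition minus_hfun :: "hfun \<Rightarrow> hfun \<Rightarrow> hfun" where
  "minus_hfun x y = x + - y"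

lemma hrel_eqI:
  assumes "open_dense U" "open_dense V" "holo_on f U" "holo_on g V"
    "\<And>x. x \<in> U \<Longrightarrow> x \<in> V \<Longrightarrow> f x = g x"
  shows "hrel (U, f) (V, g)"
  using assms by (auto intro!: exI[of _ "U \<inter> V"] open_dense_Int)

instance
proof
  fix a b c :: hfun
  note rules = hrel_eqI open_dense_Int open_dense_torus holo_on_const holo_on_add holo_on_mult
    holo_on_uminus
  show "a + b + c = a + (b + c)"
    by transfer (auto intro!: rules intro: holo_on_subset simp del: hrel.simps simp: hrel_refl_iff)
  show "a + b = b + a"
    by transfer (auto intro!: rules intro: holo_on_subset simp del: hrel.simps simp: hrel_refl_iff)
  show "0 + a = a"
    by transfer (auto intro!: rules intro: holo_on_subset simp del: hrel.simps simp: hrel_refl_iff)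
  show "- a + a = 0"
    by transfer (auto intro!: rules intro: holo_on_subset simp del: hrel.simps simp: hrel_refl_iff)
  show "a - b = a + - b"
    by (rule minus_hfun_def)
  show "a * b * c = a * (b * c)"
    by transfer (auto intro!: rules intro: holo_on_subset simp del: hrel.simps simp: hrel_refl_iff)
  show "a * b = b * a"
    by transfer (auto intro!: rules intro: holo_on_subset simp del: hrel.simps simp: hrel_refl_iff)
  show "1 * a = a"
    by transfer (auto intro!: rules intro: holo_on_subset simp del: hrel.simps simp: hrel_refl_iff)
  show "(a + b) * c = a * c + b * c"
    by transfer
      (auto intro!: rules intro: holo_on_subset simp del: hrel.simps simp: hrel_refl_iff algebra_simps)
  show "(0 :: hfun) \<noteq> 1"
    by transfer (auto dest: open_dense_nonempty)
qed

end

text \<open>The class of a function that is holomorphic on some open dense set. Taking the largest open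
  set of holomorphy discards the points where a total function of the logic only has a conventional
  value, such as a pole.\<close>

definition holo_locus :: "(point \<Rightarrow> complex) \<Rightarrow> point set" where
  "holo_locus f = \<Union>{U. open U \<and> U \<subseteq> torus \<and> holo_on f U}"

definition germ :: "(point \<Rightarrow> complex) \<Rightarrow> hfun" where
  "germ f = abs_hfun (holo_locus f, f)"

lemma germ_eq:
  assumes "open_dense U" "holo_on f U"
  shows "germ f = abs_hfun (U, f)"
proof -
  have sub: "U \<subseteq> holo_locus f" "open (holo_locus f)" "holo_locus f \<subseteq> torus"
    "holo_on f (holo_locus f)"
    using assms by (auto simp: holo_locus_def open_dense_def holo_on_def)
  then have "hrel (U, f) (holo_locus f, f)"
    using assms by (intro hrel_subset open_dense_mono[OF assms(1)]) (auto simp: open_dense_def)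
  then show ?thesis
    unfolding germ_def by (rule Quotient3_rel_abs[OF Quotient3_hfun, symmetric])
qed

text \<open>Being represented by a function of \<open>Q\<close> alone.\<close>

definition depends_on_Q_only :: "hfun \<Rightarrow> bool" where
  "depends_on_Q_only x \<longleftrightarrow>
     (\<exists>U g. open_dense U \<and> holo_on (\<lambda>(Q, p, s). g Q) U \<and> x = abs_hfun (U, \<lambda>(Q, p, s). g Q))"

section \<open>Monomial substitutions\<close>

definition mono_map :: "int \<Rightarrow> int \<Rightarrow> int \<Rightarrow> int \<Rightarrow> point \<Rightarrow> point" where
  "mono_map a b c d = (\<lambda>(Q, p, s). (Q, p powi a * s powi b, p powi c * s powi d))"

lemma mono_map_torus: "x \<in> torus \<Longrightarrow> mono_map a b c d x \<in> torus"
  by (auto simp: torus_def mono_map_def)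

lemma mono_map_comp:
  "x \<in> torus \<Longrightarrow> mono_map a b c d (mono_map a' b' c' d' x) =
     mono_map (a * a' + b * c') (a * b' + b * d') (c * a' + d * c') (c * b' + d * d') x"
  by (auto simp: torus_def mono_map_def power_int_mult_distrib power_int_mult [symmetric]
      power_int_add mult_ac)

lemma mono_map_id: "mono_map 1 0 0 1 x = x"
  by (auto simp: mono_map_def)

lemma mono_map_inverse:
  assumes "x \<in> torus" "a * d - b * c = 1"
  shows "mono_map d (- b) (- c) a (mono_map a b c d x) = x"
    "mono_map a b c d (mono_map d (- b) (- c) a x) = x"
proof -
  have "d * a + - b * c = 1" "d * b + - b * d = 0" "- c * a + a * c = 0" "- c * b + a * d = 1"
    "a * d + b * - c = 1" "a * - b + b * a = 0" "c * d + d * - c = 0" "c * - b + d * a = 1"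
    using assms(2) by (simp_all add: algebra_simps)
  then show "mono_map d (- b) (- c) a (mono_map a b c d x) = x"
    "mono_map a b c d (mono_map d (- b) (- c) a x) = x"
    using assms(1) by (simp_all only: mono_map_comp mono_map_id)
qed

lemma mono_map_has_derivative:
  assumes "x \<in> torus"
  shows "\<exists>u v w z. (mono_map a b c d has_derivative
    (\<lambda>(h, k, l). (h, u * k + v * l, w * k + z * l))) (at x)"
proof -
  obtain Q p s where x: "x = (Q, p, s)" by (cases x)
  with assms have nz: "p \<noteq> 0" "s \<noteq> 0" by (auto simp: torus_def)
  have D: "((\<lambda>y. fst (snd y) powi m * snd (snd y) powi n) has_derivative
      (\<lambda>y. (of_int m * p powi (m - 1) * s powi n) * fst (snd y) +
            (p powi m * (of_int n * s powi (n - 1))) * snd (snd y))) (at x)" for m n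
  proof -
    have pi: "((\<lambda>t::complex. t powi m) has_field_derivative of_int m * q powi (m - 1)) (at q)"
      if "q \<noteq> 0" for q m
      using DERIV_power_int[OF DERIV_ident, of m q UNIV] that by simp
    have 1: "((\<lambda>y::point. fst (snd y)) has_derivative (\<lambda>y. fst (snd y))) (at x)"
      by (auto intro!: derivative_eq_intros)
    have 2: "((\<lambda>y::point. snd (snd y)) has_derivative (\<lambda>y. snd (snd y))) (at x)"
      by (auto intro!: derivative_eq_intros)
    have 3: "((\<lambda>y::point. fst (snd y) powi m) has_derivative
        (\<lambda>y. of_int m * p powi (m - 1) * fst (snd y))) (at x)"
      using has_derivative_compose[OF 1, of "\<lambda>t. t powi m" "\<lambda>h. of_int m * p powi (m - 1) * h"]
        pi[OF nz(1), of m] by (simp add: x has_field_derivative_def)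
    have 4: "((\<lambda>y::point. snd (snd y) powi n) has_derivative
        (\<lambda>y. of_int n * s powi (n - 1) * snd (snd y))) (at x)"
      using has_derivative_compose[OF 2, of "\<lambda>t. t powi n" "\<lambda>h. of_int n * s powi (n - 1) * h"]
        pi[OF nz(2), of n] by (simp add: x has_field_derivative_def)
    show ?thesis
      using has_derivative_mult[OF 3 4] by (simp add: x algebra_simps)
  qed
  have "(fst has_derivative fst) (at x)" by (auto intro!: derivative_eq_intros)
  from has_derivative_Pair[OF this has_derivative_Pair[OF D[of a b] D[of c d]]]
  show ?thesis
    unfolding mono_map_def case_prod_unfold by (intro exI)
qed

lemma continuous_mono_map: "continuous_on torus (mono_map a b c d)"
proof (intro continuous_at_imp_continuous_on ballI)
  fix x assume "x \<in> torus"
  then obtain D where "(mono_map a b c d has_derivative D) (at x)"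
    using mono_map_has_derivative by blast
  then show "isCont (mono_map a b c d) x"
    by (rule has_derivative_continuous)
qed

lemma open_dense_mono_map:
  assumes "open_dense U" "a * d - b * c = 1"
  shows "open_dense (mono_map a b c d -` U \<inter> torus)" (is "open_dense ?P")
proof -
  have pre: "open (mono_map a b c d -` S \<inter> torus)" if "open S" for a b c d S
    using continuous_open_preimage[OF continuous_mono_map open_torus that] by (simp add: Int_commute)
  have "x \<in> closure ?P" if x: "x \<in> torus" for x
    unfolding closure_iff_nhds_not_empty
  proof (intro allI impI)
    fix A S assume A: "S \<subseteq> A" "open S" "x \<in> S"
    define T where "T = mono_map d (- b) (- c) a -` (S \<inter> torus) \<inter> torus"
    have "open T" unfolding T_def using A open_torus by (intro pre) auto
    moreover have "mono_map a b c d x \<in> T"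
      using A x mono_map_inverse(1)[OF x assms(2)] by (auto simp: T_def mono_map_torus)
    moreover have "mono_map a b c d x \<in> closure U"
      using assms(1) mono_map_torus[OF x] by (auto simp: open_dense_def)
    ultimately obtain y where y: "y \<in> T" "y \<in> U"
      using open_Int_closure_eq_empty[of T U] by blast
    then have "mono_map d (- b) (- c) a y \<in> S \<inter> ?P"
      using mono_map_inverse(2)[OF _ assms(2), of y] by (auto simp: T_def)
    with A show "?P \<inter> A \<noteq> {}" by blast
  qed
  moreover have "open ?P" using assms(1) by (intro pre) (auto simp: open_dense_def)
  ultimately show ?thesis by (auto simp: open_dense_def)
qed

lemma holo_on_mono_map:
  assumes "holo_on f U"
  shows "holo_on (\<lambda>x. f (mono_map a b c d x)) (mono_map a b c d -` U \<inter> torus)"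
  unfolding holo_on_def
proof
  fix x assume x: "x \<in> mono_map a b c d -` U \<inter> torus"
  then obtain u v w z where 1: "(mono_map a b c d has_derivative
    (\<lambda>(h, k, l). (h, u * k + v * l, w * k + z * l))) (at x)"
    using mono_map_has_derivative by blast
  from x assms obtain D where D: "(f has_derivative D) (at (mono_map a b c d x))"
    "\<And>c h k l. D (c * h, c * k, c * l) = c * D (h, k, l)"
    by (fastforce simp: holo_on_def)
  have "((\<lambda>x. f (mono_map a b c d x)) has_derivative
      (\<lambda>y. D (case y of (h, k, l) \<Rightarrow> (h, u * k + v * l, w * k + z * l)))) (at x)"
    by (rule has_derivative_compose[OF 1 D(1)])
  moreover have "D (t * h, u * (t * k) + v * (t * l), w * (t * k) + z * (t * l)) =
      t * D (h, u * k + v * l, w * k + z * l)" for t h k l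
    using D(2)[of t h "u * k + v * l" "w * k + z * l"] by (simp add: algebra_simps)
  ultimately show "\<exists>D. ((\<lambda>x. f (mono_map a b c d x)) has_derivative D) (at x) \<and>
      (\<forall>c h k l. D (c * h, c * k, c * l) = c * D (h, k, l))"
    by (intro exI conjI) (assumption, simp)
qed

text \<open>The substitution \<open>(p, s) \<mapsto> (p\<^sup>a s\<^sup>b, p\<^sup>c s\<^sup>d)\<close> for \<open>ad - bc = 1\<close>. The \<open>else\<close>
  branch only makes the operation total.\<close>

lift_definition delta_hat :: "int \<Rightarrow> int \<Rightarrow> int \<Rightarrow> int \<Rightarrow> hfun \<Rightarrow> hfun"
  is "\<lambda>a b c d (U, f). if a * d - b * c = 1
        then (mono_map a b c d -` U \<inter> torus, \<lambda>x. f (mono_map a b c d x))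
        else (U, f)"
proof (clarify, goal_cases)
  case (1 a b c d U f V g)
  show ?case
  proof (cases "a * d - b * c = 1")
    case True
    from 1 obtain W where "open_dense W" "W \<subseteq> U \<inter> V" "\<forall>x\<in>W. f x = g x" by auto
    then have "open_dense (mono_map a b c d -` W \<inter> torus)"
      "mono_map a b c d -` W \<inter> torus \<subseteq> (mono_map a b c d -` U \<inter> torus) \<inter> (mono_map a b c d -` V \<inter> torus)"
      "\<forall>x\<in>mono_map a b c d -` W \<inter> torus. f (mono_map a b c d x) = g (mono_map a b c d x)"
      using True by (auto intro: open_dense_mono_map)
    moreover have "open_dense (mono_map a b c d -` U \<inter> torus)"
      "open_dense (mono_map a b c d -` V \<inter> torus)"
      "holo_on (\<lambda>x. f (mono_map a b c d x)) (mono_map a b c d -` U \<inter> torus)"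
      "holo_on (\<lambda>x. g (mono_map a b c d x)) (mono_map a b c d -` V \<inter> torus)"
      using 1 True by (auto intro: open_dense_mono_map holo_on_mono_map)
    ultimately show ?thesis using True by auto
  qed (use 1 in auto)
qed

lemma delta_hat_ring_hom:
  "delta_hat a b c d (x + y) = delta_hat a b c d x + delta_hat a b c d y"
  "delta_hat a b c d (x * y) = delta_hat a b c d x * delta_hat a b c d y"
  "delta_hat a b c d 1 = 1"
proof -
  define m where "m = mono_map a b c d"
  have pull: "hrel (m -` (U \<inter> V) \<inter> torus, \<lambda>x. F (f (m x)) (g (m x)))
      ((m -` U \<inter> torus) \<inter> (m -` V \<inter> torus), \<lambda>x. F (f (m x)) (g (m x)))"
    if "a * d - b * c = 1" "open_dense U" "open_dense V" "holo_on (\<lambda>x. F (f x) (g x)) (U \<inter> V)"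
    for U V f g and F :: "complex \<Rightarrow> complex \<Rightarrow> complex"
  proof -
    have "(m -` U \<inter> torus) \<inter> (m -` V \<inter> torus) = m -` (U \<inter> V) \<inter> torus"
      by blast
    moreover have "open_dense (m -` (U \<inter> V) \<inter> torus)"
      unfolding m_def by (intro open_dense_mono_map open_dense_Int that)
    moreover have "holo_on (\<lambda>x. F (f (m x)) (g (m x))) (m -` (U \<inter> V) \<inter> torus)"
      unfolding m_def by (rule holo_on_mono_map[OF that(4)])
    ultimately show ?thesis
      by (simp only: hrel_refl_iff simp_thms)
  qed
  have holo: "holo_on (\<lambda>x. f x + g x) (U \<inter> V)" "holo_on (\<lambda>x. f x * g x) (U \<inter> V)"
    if "holo_on f U" "holo_on g V" for f g U V
    by (rule holo_on_add holo_on_mult;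
        rule holo_on_subset[OF that(1) Int_lower1] holo_on_subset[OF that(2) Int_lower2])+
  obtain U f where x: "x = abs_hfun (U, f)" "hrel (U, f) (U, f)"
    using Quotient_abs_rep[OF Quotient_hfun, of x] Quotient_rep_reflp[OF Quotient_hfun, of x]
    by (metis surj_pair)
  obtain V g where y: "y = abs_hfun (V, g)" "hrel (V, g) (V, g)"
    using Quotient_abs_rep[OF Quotient_hfun, of y] Quotient_rep_reflp[OF Quotient_hfun, of y]
    by (metis surj_pair)
  have xy: "open_dense U" "open_dense V" "holo_on f U" "holo_on g V"
    using x(2) y(2) by (simp_all only: hrel_refl_iff)
  have pulled: "hrel (m -` U \<inter> torus, \<lambda>x. f (m x)) (m -` U \<inter> torus, \<lambda>x. f (m x))"
    "hrel (m -` V \<inter> torus, \<lambda>x. g (m x)) (m -` V \<inter> torus, \<lambda>x. g (m x))"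
    if "a * d - b * c = 1"
    using xy that unfolding m_def hrel_refl_iff
    by (simp_all only: open_dense_mono_map holo_on_mono_map simp_thms)
  have sum: "hrel (U \<inter> V, \<lambda>x. f x + g x) (U \<inter> V, \<lambda>x. f x + g x)"
    and prod: "hrel (U \<inter> V, \<lambda>x. f x * g x) (U \<inter> V, \<lambda>x. f x * g x)"
    using xy by (simp_all only: hrel_refl_iff open_dense_Int holo simp_thms)
  note eq = delta_hat.abs_eq[OF x(2), of a b c d] delta_hat.abs_eq[OF y(2), of a b c d]
    delta_hat.abs_eq[OF sum, of a b c d] delta_hat.abs_eq[OF prod, of a b c d]
  note eq' = plus_hfun.abs_eq[OF x(2) y(2)] times_hfun.abs_eq[OF x(2) y(2)]
  show "delta_hat a b c d (x + y) = delta_hat a b c d x + delta_hat a b c d y"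
  proof (cases "a * d - b * c = 1")
    case True
    with Quotient3_rel_abs[OF Quotient3_hfun pull[where F = "(+)", OF True xy(1,2) holo(1)[OF xy(3,4)]]]
    show ?thesis
      unfolding x(1) y(1) using eq eq' plus_hfun.abs_eq[OF pulled[OF True]] by (simp add: m_def)
  next
    case False
    then show ?thesis
      unfolding x(1) y(1) using eq eq' by simp
  qed
  show "delta_hat a b c d (x * y) = delta_hat a b c d x * delta_hat a b c d y"
  proof (cases "a * d - b * c = 1")
    case True
    with Quotient3_rel_abs[OF Quotient3_hfun pull[where F = "(*)", OF True xy(1,2) holo(2)[OF xy(3,4)]]]
    show ?thesis
      unfolding x(1) y(1) using eq eq' times_hfun.abs_eq[OF pulled[OF True]] by (simp add: m_def)
  next
    case False
    then show ?thesis
      unfolding x(1) y(1) using eq eq' by simp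
  qed
  have "torus \<subseteq> m -` torus" by (auto simp: m_def mono_map_torus)
  then have "m -` torus \<inter> torus = torus" by blast
  then show "delta_hat a b c d 1 = 1"
    unfolding m_def
    by transfer (simp only: hrel_refl_iff open_dense_torus holo_on_const simp_thms if_cancel
        prod.case cong: if_cong)
qed

section \<open>Plethystic exponents\<close>

text \<open>The infinite product is the unordered one: the limit over finite sets of multi-indices.\<close>

definition mpoch0 :: "complex \<Rightarrow> complex list \<Rightarrow> complex" where
  "mpoch0 z ps = Lim (finite_subsets_at_top {is. length is = length ps})
     (\<lambda>F. \<Prod>is\<in>F. 1 - z * prod_list (map2 (^) ps is))"

text \<open>The extension to moduli different from \<open>0\<close> and \<open>1\<close>: every parameter outside the unit disc is
  inverted; each inversion divides the argument by that parameter and inverts the value. The lemma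
  \<open>mpoch_inverse\<close> is the defining functional equation.\<close>

definition mpoch :: "complex \<Rightarrow> complex list \<Rightarrow> complex" where
  "mpoch z ps = (let bs = filter (\<lambda>p. norm p > 1) ps in
     mpoch0 (z / prod_list bs) (map (\<lambda>p. if norm p > 1 then inverse p else p) ps)
       powi ((- 1) ^ length bs))"

lemma mpoch_eq_mpoch0:
  assumes "\<And>p. p \<in> set ps \<Longrightarrow> norm p < 1"
  shows "mpoch z ps = mpoch0 z ps"
proof -
  have "filter (\<lambda>p. norm p > 1) ps = []" using assms by (fastforce simp: filter_empty_conv)
  moreover have "map (\<lambda>p. if norm p > 1 then inverse p else p) ps = ps"
    using assms by (fastforce intro: map_idI)
  ultimately show ?thesis by (simp add: mpoch_def)
qed

lemma mpoch_inverse: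
  assumes "p \<noteq> 0" "norm p \<noteq> 1"
  shows "mpoch z (ps @ inverse p # qs) = 1 / mpoch (p * z) (ps @ p # qs)"
proof (cases "norm p > 1")
  case True
  then have "norm (inverse p) \<le> 1"
    unfolding norm_inverse by (intro inverse_le_1_iff[THEN iffD2]) simp
  with True assms show ?thesis
    by (simp add: mpoch_def Let_def power_int_minus divide_simps mult_ac)
next
  case False
  then have "norm (inverse p) > 1"
    unfolding norm_inverse using assms by (intro one_less_inverse) auto
  with False assms show ?thesis
    by (simp add: mpoch_def Let_def power_int_minus divide_simps mult_ac)
qed

text \<open>Laurent polynomials in \<open>Q, p, s\<close> over the integers form the group ring of \<open>\<int>\<^sup>3\<close>.\<close>

type_synonym laurent = "(int \<times> int \<times> int) \<Rightarrow>\<^sub>0 int"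

definition monom3 :: "int \<Rightarrow> int \<Rightarrow> int \<Rightarrow> laurent" where
  "monom3 i j k = Poly_Mapping.single (i, j, k) 1"

text \<open>\<open>pexp \<mu> ab\<close> is the plethystic exponent of \<open>\<mu>\<close> divided by the product of the factors
  \<open>1 - p\<^sup>a s\<^sup>b\<close> over the pairs \<open>(a, b)\<close> in \<open>ab\<close>. It is meaningful for a nonempty list of nonzero pairs
  and \<open>\<mu>\<close> without terms of degree \<open>0\<close> in \<open>Q\<close>.\<close>

definition pexp :: "laurent \<Rightarrow> (int \<times> int) list \<Rightarrow> hfun" where
  "pexp \<mu> ab = germ (\<lambda>(Q, p, s). \<Prod>(m1, m2, m3)\<in>Poly_Mapping.keys \<mu>.
     mpoch (Q powi m1 * p powi m2 * s powi m3) (map (\<lambda>(a, b). p powi a * s powi b) ab)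
       powi (Poly_Mapping.lookup \<mu> (m1, m2, m3)))"

section \<open>The operators\<close>

definition alpha :: hfun where
  "alpha = pexp (- (monom3 8 0 0 - monom3 (- 8) 0 0) * monom3 0 1 (- 1) *
     (monom3 0 0 2 + 2 * monom3 0 1 1 + monom3 0 1 0)) [(0, 2), (2, - 2)]"

definition beta :: hfun where
  "beta = pexp (- (monom3 8 0 0 - monom3 (- 8) 0 0) * monom3 0 1 (- 1) *
     (monom3 0 0 1 + 2 * monom3 0 1 1 + monom3 0 1 0)) [(0, 2), (2, - 2)]"

definition gamma :: hfun where
  "gamma = pexp (- (monom3 8 0 0 - monom3 (- 8) 0 0) * monom3 0 1 0 *
     (monom3 0 0 1 + 2 * monom3 0 1 0 + 1)) [(0, 2), (2, - 2)]"

definition fun_of_Q :: "(complex \<Rightarrow> complex) \<Rightarrow> hfun" where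
  "fun_of_Q g = germ (\<lambda>(Q, p, s). g Q)"

definition D_A :: "hfun ^ 3 ^ 3" where
  "D_A = vector
     [vector [1, 0, 0],
      vector [0, fun_of_Q (\<lambda>Q. - \<i> * Q), 0],
      vector [0, 0, - 1]]"

definition D_B :: "hfun ^ 3 ^ 3" where
  "D_B = vector
     [vector [alpha,
              fun_of_Q (\<lambda>Q. 2 * Q / (1 - Q ^ 4)) * beta,
              fun_of_Q (\<lambda>Q. 2 * Q ^ 4 / (1 - Q ^ 4)\<^sup>2) * alpha],
      vector [fun_of_Q (\<lambda>Q. - ((1 - Q ^ 4) / Q ^ 3)) * gamma,
              0,
              fun_of_Q (\<lambda>Q. 2 * Q / (1 - Q ^ 4)) * gamma],
      vector [fun_of_Q (\<lambda>Q. (1 - Q ^ 4)\<^sup>2 / (2 * Q ^ 4)) * alpha,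
              fun_of_Q (\<lambda>Q. - ((1 - Q ^ 4) / Q ^ 3)) * beta,
              alpha]]"

definition D_A_hat :: "hfun ^ 3 \<Rightarrow> hfun ^ 3" where
  "D_A_hat v = D_A *v (\<chi> i. delta_hat 1 1 0 1 (v $ i))"

definition D_B_hat :: "hfun ^ 3 \<Rightarrow> hfun ^ 3" where
  "D_B_hat v = D_B *v (\<chi> i. delta_hat 1 0 (- 1) 1 (v $ i))"

text \<open>The units of the ring are the divisors of \<open>1\<close>.\<close>

definition proportional :: "(hfun ^ 3 \<Rightarrow> hfun ^ 3) \<Rightarrow> (hfun ^ 3 \<Rightarrow> hfun ^ 3) \<Rightarrow> bool"
    (infix \<open>\<propto>\<close> 50) where
  "X \<propto> Y \<longleftrightarrow> (\<exists>c. c dvd 1 \<and> depends_on_Q_only c \<and> (\<forall>v. X v = c *s Y v))"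

end

theory Submission
  imports Defs "HOL-Complex_Analysis.Cauchy_Integral_Formula"
begin

text \<open>
  Put \<open>a = s\<^sup>2\<close>, \<open>b = p\<^sup>2/s\<^sup>2\<close>. All plethystic exponents that occur are products of the quotients
  \<open>K(m; a, b) = (Q\<^bsup>-8\<^esup>m; a, b)/(Q\<^sup>8m; a, b)\<close> for monomials \<open>m\<close> in \<open>p, s\<close>. Splitting the double product
  along the diagonal gives \<open>(z; a, b) = (z; b, ab) (az; a, ab)\<close>, first in the unit polydisc and by inversion
  in every chamber of moduli. Writing \<open>\<alpha>'\<close> for \<open>\<alpha>(ps, s)\<close> and \<open>\<alpha>''\<close> for \<open>\<alpha>(s, s/p)\<close>, this yields
  \<open>\<alpha>' = \<beta>\<gamma>''\<close>, \<open>\<beta>' = \<alpha>\<beta>''\<close>, \<open>\<gamma>' = \<gamma>\<alpha>''\<close>, which reduces the braid relation to one between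
  matrices of functions of \<open>Q\<close>, with factor \<open>-\<i>Q/2\<close>. The square of \<open>ABA\<close> turns out to be diagonal, because
  the factors with denominator \<open>1 - p\<^sup>2\<close> telescope: what remains are factors \<open>K(s\<^sup>n; s\<^sup>2)\<close>, which cancel under
  \<open>s \<mapsto> 1/s\<close> up to a function of \<open>Q\<close>. Hence the fourth power is the scalar \<open>16/Q\<^bsup>16\<^esup>\<close>.

  All identities are checked at points where no nontrivial monomial has modulus 1. These points are
  dense and stable under the substitutions, and no factor vanishes there.
\<close>

section \<open>Holomorphic functions of three variables\<close>

text \<open>The combinatorics is additive: \<open>pexp\<close> turns sums of fractions into
  products, and the diagonal splitting mirrors 1/((1-a)(1-b)) = 1/((1-b)(1-ab)) + a/((1-a)(1-ab)).
  The substitution (ps, s) turns the denominators (a, b) into (a, ab), while (s, s/p) turns them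
  into (1/b, ab). Up to inverting b these are the two pieces of the splitting, so splitting and
  inversion suffice for the scalar part of the braid relation. The fraction identities cannot simply
  be quoted, because the infinite products change shape when a parameter crosses the unit circle.
  Moreover a total function has the conventional value 0 at a pole, so dividing is sound only where
  no symbol vanishes. The points used for checking do not form an open set, whereas the ring
  consists of classes over open dense sets; hence the functions are kept holomorphic on open sets
  containing all these points. The factor -iQ/2 is the inverse of a corner coefficient of the
  product BAB. In 16/Q^16, each squaring of ABA contributes 4, and (1 - Q^-8)/(1 - Q^8) = -Q^-8
  survives twice.\<close>

text \<open>The type of points carries only real scaling. Complex scaling is needed to express
  complex-linearity of a derivative and to restrict functions to complex lines.\<close>

definition cscale :: "complex \<Rightarrow> point \<Rightarrow> point" where
  "cscale c v = (c * fst v, c * fst (snd v), c * snd (snd v))"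

lemma norm_cscale: "norm (cscale c v) = norm c * norm v"
proof -
  have "norm (cscale c v) = sqrt ((norm c)\<^sup>2 * (norm v)\<^sup>2)"
    by (simp add: cscale_def norm_prod_def norm_mult power_mult_distrib algebra_simps)
  then show ?thesis by (simp add: real_sqrt_mult)
qed

lemma has_derivative_cscale: "((\<lambda>c. cscale c v) has_derivative (\<lambda>c. cscale c v)) (at x)"
  unfolding cscale_def by (auto intro!: derivative_eq_intros)

lemma holo_on_iff:
  "holo_on f U \<longleftrightarrow> (\<forall>z\<in>U. \<exists>D. (f has_derivative D) (at z) \<and> (\<forall>c v. D (cscale c v) = c * D v))"
  unfolding holo_on_def cscale_def by (simp add: split_paired_all)

lemma holo_on_imp_continuous_on:
  assumes "holo_on f U" shows "continuous_on U f"
  using assms unfolding holo_on_def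
  by (meson continuous_at_imp_continuous_on has_derivative_continuous)

lemma holo_on_local:
  assumes "\<And>z. z \<in> U \<Longrightarrow> \<exists>V g. open V \<and> z \<in> V \<and> holo_on g V \<and> (\<forall>x\<in>V. f x = g x)"
  shows "holo_on f U"
  unfolding holo_on_def
proof
  fix z assume "z \<in> U"
  then obtain V g where V: "open V" "z \<in> V" "holo_on g V" "\<And>x. x \<in> V \<Longrightarrow> f x = g x"
    using assms by metis
  then obtain D where D: "(g has_derivative D) (at z)"
    "\<forall>c h k l. D (c * h, c * k, c * l) = c * D (h, k, l)"
    by (auto simp: holo_on_def)
  have "(f has_derivative D) (at z)"
    by (rule has_derivative_transform_within_open[OF D(1) V(1,2)]) (use V(4) in auto)
  with D(2) show "\<exists>D. (f has_derivative D) (at z) \<and>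
      (\<forall>c h k l. D (c * h, c * k, c * l) = c * D (h, k, l))" by blast
qed

lemma holo_on_cong: "open U \<Longrightarrow> (\<And>x. x \<in> U \<Longrightarrow> f x = g x) \<Longrightarrow> holo_on g U \<Longrightarrow> holo_on f U"
  by (rule holo_on_local) blast

lemma holo_on_compose:
  assumes "holo_on f U" "\<And>x. x \<in> U \<Longrightarrow> \<exists>d. (\<phi> has_field_derivative d) (at (f x))"
  shows "holo_on (\<lambda>x. \<phi> (f x)) U"
  unfolding holo_on_iff
proof
  fix z assume z: "z \<in> U"
  with assms(1) obtain D where D: "(f has_derivative D) (at z)" "\<And>c v. D (cscale c v) = c * D v"
    unfolding holo_on_iff by blast
  from assms(2)[OF z] obtain d where "(\<phi> has_derivative (*) d) (at (f z))"
    by (auto simp: has_field_derivative_def)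
  from has_derivative_compose[OF D(1) this]
  have "((\<lambda>x. \<phi> (f x)) has_derivative (\<lambda>v. d * D v)) (at z)" .
  then show "\<exists>D. ((\<lambda>x. \<phi> (f x)) has_derivative D) (at z) \<and> (\<forall>c v. D (cscale c v) = c * D v)"
    using D(2) by (intro exI[of _ "\<lambda>v. d * D v"]) auto
qed

lemma holo_on_sum: "(\<And>i. i \<in> A \<Longrightarrow> holo_on (f i) U) \<Longrightarrow> holo_on (\<lambda>x. \<Sum>i\<in>A. f i x) U"
  by (induction A rule: infinite_finite_induct) (auto intro: holo_on_const holo_on_add)

lemma holo_on_prod: "(\<And>i. i \<in> A \<Longrightarrow> holo_on (f i) U) \<Longrightarrow> holo_on (\<lambda>x. \<Prod>i\<in>A. f i x) U"
  by (induction A rule: infinite_finite_induct) (auto intro: holo_on_const holo_on_mult)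

lemma holo_on_power: "holo_on f U \<Longrightarrow> holo_on (\<lambda>x. f x ^ n) U"
  by (induction n) (auto intro: holo_on_const holo_on_mult)

lemma holo_on_inverse:
  assumes "holo_on f U" "\<And>x. x \<in> U \<Longrightarrow> f x \<noteq> 0"
  shows "holo_on (\<lambda>x. inverse (f x)) U"
  using assms by (intro holo_on_compose[where \<phi> = inverse]) (auto intro!: exI DERIV_inverse)

lemma holo_on_powi:
  assumes "holo_on f U" "\<And>x. x \<in> U \<Longrightarrow> f x \<noteq> 0"
  shows "holo_on (\<lambda>x. f x powi n) U"
  by (cases "n \<ge> 0") (auto simp: power_int_def intro!: holo_on_power holo_on_inverse assms)

lemma holo_on_diff: "holo_on f U \<Longrightarrow> holo_on g U \<Longrightarrow> holo_on (\<lambda>x. f x - g x) U"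
  using holo_on_add[of f U "\<lambda>x. - g x"] by (simp add: holo_on_uminus)

text \<open>On the complex line through \<open>z\<close> in direction \<open>v\<close> the function
  becomes holomorphic in one variable with derivative \<open>D v\<close> at 0, and the one-variable
  Cauchy inequality applies.\<close>

lemma holo_on_deriv_bound:
  assumes f: "holo_on f U" and sub: "ball z (2 * r) \<subseteq> U" and r: "r > 0"
    and B: "\<And>x. x \<in> U \<Longrightarrow> norm (f x) \<le> B"
    and D: "(f has_derivative D) (at z)" "\<And>c v. D (cscale c v) = c * D v"
  shows "norm (D v) \<le> B / r * norm v"
proof (cases "v = 0")
  case True
  have "D 0 = 0" using D(1) has_derivative_bounded_linear bounded_linear.linear linear_0 by blast
  with True show ?thesis by simp
next
  case False
  define \<phi> where "\<phi> t = f (z + cscale t v)" for t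
  \<comment> \<open>For parameters of modulus at most this radius the line moves by at most
    \<open>r\<close>, so the closed disc stays well inside the ball of radius
    \<open>2 * r\<close>.\<close>
  define \<rho> where "\<rho> = r / norm v"
  have \<rho>: "\<rho> > 0" using False r by (simp add: \<rho>_def)
  have inU: "z + cscale t v \<in> U" if "norm t \<le> \<rho>" for t
  proof -
    have "norm t * norm v \<le> r" using that False by (simp add: \<rho>_def field_simps)
    then have "z + cscale t v \<in> ball z (2 * r)" using r by (simp add: dist_norm norm_cscale)
    with sub show ?thesis by blast
  qed
  have comp: "(\<phi> has_derivative (\<lambda>c. E (cscale c v))) (at t)"
    if "(f has_derivative E) (at (z + cscale t v))" for E t
    unfolding \<phi>_def
    by (rule has_derivative_compose[where f = "\<lambda>t. z + cscale t v", OF _ that])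
      (auto intro!: derivative_eq_intros has_derivative_cscale)
  have \<phi>: "\<phi> field_differentiable (at t)" if t: "norm t \<le> \<rho>" for t
  proof -
    from f inU[OF t] obtain E where E: "(f has_derivative E) (at (z + cscale t v))"
      "\<And>c v. E (cscale c v) = c * E v" unfolding holo_on_iff by blast
    have "(\<phi> has_field_derivative E v) (at t)"
      using comp[OF E(1)] by (simp add: has_field_derivative_def E(2) mult_commute_abs)
    then show ?thesis by (auto simp: field_differentiable_def)
  qed
  have "\<phi> holomorphic_on cball 0 \<rho>"
    unfolding holomorphic_on_def using \<phi> by (auto intro: field_differentiable_at_within)
  then have "norm ((deriv ^^ 1) \<phi> 0) \<le> fact 1 * B / \<rho> ^ 1"
    by (intro Cauchy_inequality holomorphic_on_imp_continuous_on \<rho>)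
      (auto intro: holomorphic_on_subset B inU simp: \<phi>_def norm_minus_commute)
  moreover have "z + cscale 0 v = z" by (simp add: cscale_def zero_prod_def[symmetric])
  then have "(\<phi> has_field_derivative D v) (at 0)"
    using comp[of D 0] D by (simp add: has_field_derivative_def D(2) mult_commute_abs)
  then have "deriv \<phi> 0 = D v" by (rule DERIV_imp_deriv)
  ultimately show ?thesis using False r by (simp add: \<rho>_def field_simps)
qed

text \<open>By Cauchy's estimate the derivatives of the approximants also converge uniformly on balls.\<close>

lemma holo_on_uniform_approx:
  assumes U: "open U" and approx: "\<And>e. e > 0 \<Longrightarrow> \<exists>f. holo_on f U \<and> (\<forall>x\<in>U. norm (f x - g x) \<le> e)"
  shows "holo_on g U"
  unfolding holo_on_iff
proof
  fix z assume "z \<in> U"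
  with U obtain R where R: "R > 0" "ball z R \<subseteq> U" by (meson openE)
  \<comment> \<open>A ball of radius \<open>2 * r\<close> about any point of \<open>ball z r\<close>
    then still lies in \<open>ball z R\<close>, as the derivative bound requires.\<close>
  define r where "r = R / 3"
  have r: "r > 0" using R by (simp add: r_def)
  have sub: "ball x (2 * r) \<subseteq> U" if "x \<in> ball z r" for x
  proof -
    have "ball x (2 * r) \<subseteq> ball z R"
      using that by (subst ball_subset_ball_iff) (auto simp: r_def dist_commute)
    with R show ?thesis by blast
  qed
  have xU: "x \<in> U" if "x \<in> ball z r" for x
    using sub[OF that] r by auto
  have "\<exists>f. holo_on f U \<and> (\<forall>x\<in>U. norm (f x - g x) \<le> inverse (Suc n))" for n
    by (rule approx) simp
  then obtain f where f: "\<And>n. holo_on (f n) U"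
    "\<And>n x. x \<in> U \<Longrightarrow> norm (f n x - g x) \<le> inverse (Suc n)"
    by metis
  from f(1) have "\<forall>n. \<forall>x\<in>U. \<exists>D. (f n has_derivative D) (at x) \<and> (\<forall>c v. D (cscale c v) = c * D v)"
    by (simp add: holo_on_iff)
  then obtain D where D: "\<And>n x. x \<in> U \<Longrightarrow> (f n has_derivative D n x) (at x)"
    "\<And>n x c v. x \<in> U \<Longrightarrow> D n x (cscale c v) = c * D n x v"
    by metis
  \<comment> \<open>This is the Cauchy bound for the derivative of \<open>f n - f m\<close>, uniform
    over \<open>ball z r\<close>; it makes the derivatives a uniform Cauchy sequence.\<close>
  define \<epsilon> where "\<epsilon> n m = (inverse (Suc n) + inverse (Suc m)) / r" for n m :: nat
  have diff: "norm (D n x v - D m x v) \<le> \<epsilon> n m * norm v" if x: "x \<in> ball z r" for n m x v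
    unfolding \<epsilon>_def
  proof (rule holo_on_deriv_bound[OF holo_on_diff[OF f(1) f(1)] sub[OF x] r])
    fix y assume "y \<in> U"
    then show "norm (f n y - f m y) \<le> inverse (Suc n) + inverse (Suc m)"
      using f(2)[of y n] f(2)[of y m] norm_triangle_ineq4[of "f n y - g y" "f m y - g y"] by simp
  next
    show "((\<lambda>x. f n x - f m x) has_derivative (\<lambda>v. D n x v - D m x v)) (at x)"
      using xU[OF x] by (intro has_derivative_diff D)
  qed (use xU[OF x] in \<open>simp add: D(2) algebra_simps\<close>)
  have \<epsilon>0: "\<epsilon> n n' \<le> \<epsilon> m m" if "n \<ge> m" "n' \<ge> m" for n n' m
  proof -
    have "inverse (real (Suc n)) \<le> inverse (Suc m)" "inverse (real (Suc n')) \<le> inverse (Suc m)"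
      using that by (auto intro!: le_imp_inverse_le)
    then show ?thesis unfolding \<epsilon>_def using r by (intro divide_right_mono add_mono) auto
  qed
  have lim0: "(\<lambda>m. \<epsilon> m m) \<longlonglongrightarrow> 0"
  proof -
    have "(\<lambda>m. (inverse (real (Suc m)) + inverse (real (Suc m))) / r) \<longlonglongrightarrow> (0 + 0) / r"
      using r by (intro tendsto_intros LIMSEQ_inverse_real_of_nat) auto
    then show ?thesis by (simp add: \<epsilon>_def)
  qed
  have small: "\<exists>M. \<forall>n\<ge>M. \<forall>m\<ge>M. \<epsilon> n m < e" if "e > 0" for e
  proof -
    from order_tendstoD(2)[OF lim0 that] obtain M where "\<epsilon> M M < e"
      by (auto simp: eventually_sequentially)
    then show ?thesis using \<epsilon>0 by (meson le_less_trans)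
  qed
  have conv: "convergent (\<lambda>n. D n x v)" if x: "x \<in> ball z r" for x v
  proof (rule Cauchy_convergent, rule metric_CauchyI)
    fix e :: real assume e: "e > 0"
    then obtain M where M: "\<And>n m. n \<ge> M \<Longrightarrow> m \<ge> M \<Longrightarrow> \<epsilon> n m < e / (norm v + 1)"
      using small[of "e / (norm v + 1)"] by (auto simp: add_nonneg_pos)
    have "dist (D n x v) (D m x v) < e" if "n \<ge> M" "m \<ge> M" for n m
    proof -
      have "\<epsilon> n m * norm v \<le> \<epsilon> n m * (norm v + 1)"
        using r by (intro mult_left_mono) (auto simp: \<epsilon>_def)
      also have "\<dots> < e" using M[OF that] by (simp add: pos_less_divide_eq add_nonneg_pos)
      finally show ?thesis using diff[OF x, of n v m] by (simp add: dist_norm)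
    qed
    then show "\<exists>M. \<forall>m\<ge>M. \<forall>n\<ge>M. dist (D m x v) (D n x v) < e" by blast
  qed
  define G where "G x v = lim (\<lambda>n. D n x v)" for x v
  have G: "(\<lambda>n. D n x v) \<longlonglongrightarrow> G x v" if "x \<in> ball z r" for x v
    using conv[OF that] by (simp add: G_def convergent_LIMSEQ_iff)
  have near: "norm (D n x v - G x v) \<le> \<epsilon> n n * norm v" if x: "x \<in> ball z r" for n x v
  proof (rule tendsto_upperbound)
    show "((\<lambda>m. norm (D n x v - D m x v)) \<longlongrightarrow> norm (D n x v - G x v)) sequentially"
      by (intro tendsto_intros G x)
    show "\<forall>\<^sub>F m in sequentially. norm (D n x v - D m x v) \<le> \<epsilon> n n * norm v"
      using eventually_ge_at_top[of n]
    proof eventually_elim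
      case (elim m)
      then have "\<epsilon> n m * norm v \<le> \<epsilon> n n * norm v" by (intro mult_right_mono \<epsilon>0) auto
      with diff[OF x, of n v m] show ?case by linarith
    qed
  qed auto
  have limf: "(\<lambda>n. f n x) \<longlonglongrightarrow> g x" if "x \<in> U" for x
  proof (rule LIM_zero_cancel, rule Lim_null_comparison)
    show "(\<lambda>n. inverse (real (Suc n))) \<longlonglongrightarrow> 0" by (rule LIMSEQ_inverse_real_of_nat)
    show "\<forall>\<^sub>F n in sequentially. norm (f n x - g x) \<le> inverse (real (Suc n))"
      using f(2)[OF that] by simp
  qed
  have zin: "z \<in> ball z r" using r by simp
  have "\<exists>h. \<forall>x\<in>ball z r. (\<lambda>n. f n x) \<longlonglongrightarrow> h x \<and> (h has_derivative G x) (at x within ball z r)"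
  proof (rule has_derivative_sequence[where f = f and f' = D and ?x0.0 = z and l = "g z"])
    show "(f n has_derivative D n x) (at x within ball z r)" if "x \<in> ball z r" for n x
      using D(1)[OF xU[OF that]] by (rule has_derivative_at_withinI)
    fix e :: real assume e: "e > 0"
    then obtain M where M: "\<And>n m. n \<ge> M \<Longrightarrow> m \<ge> M \<Longrightarrow> \<epsilon> n m < e"
      using small by blast
    show "\<forall>\<^sub>F n in sequentially. \<forall>x\<in>ball z r. \<forall>h. norm (D n x h - G x h) \<le> e * norm h"
      using eventually_ge_at_top[of M]
    proof eventually_elim
      case (elim n)
      show ?case
      proof (intro ballI allI)
        fix x h assume "x \<in> ball z r"
        from near[OF this, of n h] M[OF elim elim]
        show "norm (D n x h - G x h) \<le> e * norm h"
          using mult_right_mono[OF less_imp_le norm_ge_zero, of "\<epsilon> n n" e h] by linarith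
      qed
    qed
  qed (fact convex_ball, fact zin, rule limf, rule xU, fact zin)
  then obtain h where h: "\<And>x. x \<in> ball z r \<Longrightarrow> (\<lambda>n. f n x) \<longlonglongrightarrow> h x"
    "\<And>x. x \<in> ball z r \<Longrightarrow> (h has_derivative G x) (at x within ball z r)" by blast
  have hg: "h x = g x" if "x \<in> ball z r" for x
    using LIMSEQ_unique[OF h(1)[OF that] limf[OF xU[OF that]]] .
  have "(h has_derivative G z) (at z)"
    using h(2)[OF zin] unfolding at_within_open[OF zin open_ball] .
  then have "(g has_derivative G z) (at z)"
    by (rule has_derivative_transform_within_open[OF _ open_ball zin]) (rule hg)
  moreover have "G z (cscale c v) = c * G z v" for c v
  proof (rule LIMSEQ_unique[OF G[OF zin]])
    show "(\<lambda>n. D n z (cscale c v)) \<longlonglongrightarrow> c * G z v"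
      using xU[OF zin] by (simp add: D(2)) (intro tendsto_intros G zin)
  qed
  ultimately show "\<exists>D. (g has_derivative D) (at z) \<and> (\<forall>c v. D (cscale c v) = c * D v)" by blast
qed

text \<open>The M-test gives uniform convergence along the net of finite partial sums, so single
  finite sums serve as the approximants and the index set need not be enumerated.\<close>

lemma holo_on_infsum:
  assumes "open U" "\<And>i. i \<in> A \<Longrightarrow> holo_on (f i) U"
    and "\<And>i x. i \<in> A \<Longrightarrow> x \<in> U \<Longrightarrow> norm (f i x) \<le> c i" "c summable_on A"
  shows "holo_on (\<lambda>x. \<Sum>\<^sub>\<infinity>i\<in>A. f i x) U"
proof (rule holo_on_uniform_approx[OF assms(1)])
  fix e :: real assume e: "e > 0"
  have "uniform_limit U (\<lambda>F x. \<Sum>i\<in>F. f i x) (\<lambda>x. \<Sum>\<^sub>\<infinity>i\<in>A. f i x) (finite_subsets_at_top A)"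
    using assms(3,4) by (rule Weierstrass_m_test_general)
  then have "\<forall>\<^sub>F F in finite_subsets_at_top A. \<forall>x\<in>U. dist (\<Sum>i\<in>F. f i x) (\<Sum>\<^sub>\<infinity>i\<in>A. f i x) < e"
    using e by (rule uniform_limitD)
  then obtain F where "F \<subseteq> A" "\<forall>x\<in>U. dist (\<Sum>i\<in>F. f i x) (\<Sum>\<^sub>\<infinity>i\<in>A. f i x) < e"
    by (auto simp: eventually_finite_subsets_at_top)
  then show "\<exists>f'. holo_on f' U \<and> (\<forall>x\<in>U. norm (f' x - (\<Sum>\<^sub>\<infinity>i\<in>A. f i x)) \<le> e)"
    using assms(2) by (intro exI[of _ "\<lambda>x. \<Sum>i\<in>F. f i x"])
      (auto intro!: holo_on_sum simp: dist_norm less_imp_le)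
qed

section \<open>Unordered infinite products\<close>

text \<open>The index set is arbitrary so that sets of multi-indices can be reindexed and cut into
  pieces; the functional equations of the symbols arise in this way.\<close>

definition uprod :: "('i \<Rightarrow> complex) \<Rightarrow> 'i set \<Rightarrow> complex" where
  "uprod x A = Lim (finite_subsets_at_top A) (\<lambda>F. \<Prod>i\<in>F. 1 - x i)"

lemma filterlim_Diff_finite_subsets_at_top:
  assumes "finite E" "E \<subseteq> A"
  shows "filterlim (\<lambda>F. F - E) (finite_subsets_at_top (A - E)) (finite_subsets_at_top A)"
  unfolding filterlim_iff
proof safe
  fix P assume "eventually P (finite_subsets_at_top (A - E))"
  then obtain X where X: "finite X" "X \<subseteq> A - E"
    "\<forall>Y. finite Y \<and> X \<subseteq> Y \<and> Y \<subseteq> A - E \<longrightarrow> P Y"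
    unfolding eventually_finite_subsets_at_top by blast
  show "\<forall>\<^sub>F F in finite_subsets_at_top A. P (F - E)"
    unfolding eventually_finite_subsets_at_top
  proof (intro exI[of _ X] conjI allI impI X(3)[rule_format])
  qed (use X in auto)
qed

text \<open>Markov's inequality for counting: \<open>n\<close> terms of size at least
  \<open>e\<close> already contribute \<open>n * e\<close> to the sum.\<close>

lemma finite_large_terms:
  fixes c :: "'i \<Rightarrow> real"
  assumes "c summable_on A" "e > 0" "\<And>i. i \<in> A \<Longrightarrow> c i \<ge> 0"
  shows "finite {i \<in> A. c i \<ge> e}"
proof -
  obtain n where n: "infsum c A < of_nat n * e"
    using reals_Archimedean3[OF assms(2)] by blast
  have "card F \<le> n" if F: "F \<subseteq> {i \<in> A. c i \<ge> e}" "finite F" for F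
  proof (rule ccontr)
    assume "\<not> card F \<le> n"
    then have "of_nat n * e \<le> of_nat (card F) * e" using assms(2) by simp
    also have "\<dots> = (\<Sum>i\<in>F. e)" by simp
    also have "\<dots> \<le> (\<Sum>i\<in>F. c i)" using F by (intro sum_mono) auto
    also have "\<dots> \<le> infsum c A"
      using F assms by (intro finite_sum_le_infsum) auto
    finally show False using n by simp
  qed
  then show ?thesis using finite_if_finite_subsets_card_bdd by metis
qed

lemma norm_Ln_one_minus_le: "norm (z::complex) < 1 / 2 \<Longrightarrow> norm (Ln (1 - z)) \<le> 2 * norm z"
  using norm_Ln_le[of "- z"] by simp

lemma one_minus_neq_0: "norm (z::complex) < 1 / 2 \<Longrightarrow> 1 - z \<noteq> 0"
  by auto

text \<open>Splitting off finitely many factors turns the rest into the exponential of a convergent sum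
  of logarithms.\<close>

lemma uprod_tendsto_exp:
  assumes x: "(\<lambda>i. norm (x i)) summable_on A"
    and E: "finite E" "E \<subseteq> A" "\<And>i. i \<in> A - E \<Longrightarrow> norm (x i) < 1 / 2"
  shows "((\<lambda>F. \<Prod>i\<in>F. 1 - x i) \<longlongrightarrow> (\<Prod>i\<in>E. 1 - x i) * exp (\<Sum>\<^sub>\<infinity>i\<in>A - E. Ln (1 - x i)))
    (finite_subsets_at_top A)"
proof -
  have "(\<lambda>i. 2 * norm (x i)) summable_on A - E"
    using x by (intro summable_on_cmult_right) (rule summable_on_subset, auto)
  then have "(\<lambda>i. norm (Ln (1 - x i))) summable_on A - E"
    by (rule summable_on_comparison_test) (auto intro!: norm_Ln_one_minus_le E(3))
  then have "(\<lambda>i. Ln (1 - x i)) summable_on A - E"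
    by (rule abs_summable_summable)
  then have "((\<lambda>F. \<Sum>i\<in>F. Ln (1 - x i)) \<longlongrightarrow> (\<Sum>\<^sub>\<infinity>i\<in>A - E. Ln (1 - x i))) (finite_subsets_at_top (A - E))"
    by (rule infsum_tendsto)
  from filterlim_compose[OF this filterlim_Diff_finite_subsets_at_top[OF E(1,2)]]
  have "((\<lambda>F. (\<Prod>i\<in>E. 1 - x i) * exp (\<Sum>i\<in>F - E. Ln (1 - x i))) \<longlongrightarrow>
      (\<Prod>i\<in>E. 1 - x i) * exp (\<Sum>\<^sub>\<infinity>i\<in>A - E. Ln (1 - x i))) (finite_subsets_at_top A)"
    by (intro tendsto_intros)
  moreover have "\<forall>\<^sub>F F in finite_subsets_at_top A.
      (\<Prod>i\<in>E. 1 - x i) * exp (\<Sum>i\<in>F - E. Ln (1 - x i)) = (\<Prod>i\<in>F. 1 - x i)"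
    unfolding eventually_finite_subsets_at_top
  proof (intro exI[of _ E] conjI allI impI E)
    fix F assume F: "finite F \<and> E \<subseteq> F \<and> F \<subseteq> A"
    have "exp (\<Sum>i\<in>F - E. Ln (1 - x i)) = (\<Prod>i\<in>F - E. 1 - x i)"
      using F by (subst exp_sum) (auto intro!: prod.cong exp_Ln one_minus_neq_0 E(3))
    then show "(\<Prod>i\<in>E. 1 - x i) * exp (\<Sum>i\<in>F - E. Ln (1 - x i)) = (\<Prod>i\<in>F. 1 - x i)"
      using F E(1) by (simp add: prod.subset_diff[of E F] mult.commute)
  qed
  ultimately show ?thesis by (rule Lim_transform_eventually)
qed

lemma uprod_eq_exp:
  assumes "(\<lambda>i. norm (x i)) summable_on A"
    and "finite E" "E \<subseteq> A" "\<And>i. i \<in> A - E \<Longrightarrow> norm (x i) < 1 / 2"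
  shows "uprod x A = (\<Prod>i\<in>E. 1 - x i) * exp (\<Sum>\<^sub>\<infinity>i\<in>A - E. Ln (1 - x i))"
  unfolding uprod_def using uprod_tendsto_exp[OF assms] by (intro tendsto_Lim) auto

lemma uprod_exceptional_set:
  assumes "(\<lambda>i. norm (x i)) summable_on A"
  obtains E where "finite E" "E \<subseteq> A" "\<And>i. i \<in> A - E \<Longrightarrow> norm (x i) < 1 / 2"
  using that[of "{i \<in> A. norm (x i) \<ge> 1 / 2}"] finite_large_terms[OF assms, of "1 / 2"] by fastforce

lemma uprod_tendsto:
  assumes "(\<lambda>i. norm (x i)) summable_on A"
  shows "((\<lambda>F. \<Prod>i\<in>F. 1 - x i) \<longlongrightarrow> uprod x A) (finite_subsets_at_top A)"
  using uprod_exceptional_set[OF assms] uprod_tendsto_exp[OF assms] uprod_eq_exp[OF assms] by metis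

text \<open>The exponential of the sum of logarithms never vanishes, so only the finitely many
  split-off factors could produce a zero.\<close>

lemma uprod_nonzero:
  assumes "(\<lambda>i. norm (x i)) summable_on A" "\<And>i. i \<in> A \<Longrightarrow> x i \<noteq> 1"
  shows "uprod x A \<noteq> 0"
proof -
  obtain E where E: "finite E" "E \<subseteq> A" "\<And>i. i \<in> A - E \<Longrightarrow> norm (x i) < 1 / 2"
    using uprod_exceptional_set[OF assms(1)] by blast
  show ?thesis
    using uprod_eq_exp[OF assms(1) E] E(1,2) assms(2) by (auto simp: prod_zero_iff)
qed

text \<open>Both sides are limits of literally the same filter of values, so convergence does not
  enter.\<close>

lemma uprod_reindex:
  assumes "inj_on h B"
  shows "uprod x (h ` B) = uprod (\<lambda>i. x (h i)) B"
proof -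
  have "filtermap (\<lambda>F. \<Prod>i\<in>F. 1 - x i) (finite_subsets_at_top (h ` B)) =
      filtermap (\<lambda>F. \<Prod>i\<in>h ` F. 1 - x i) (finite_subsets_at_top B)"
    unfolding filtermap_image_finite_subsets_at_top[OF assms, symmetric] filtermap_filtermap ..
  also have "\<dots> = filtermap (\<lambda>F. \<Prod>i\<in>F. 1 - x (h i)) (finite_subsets_at_top B)"
  proof -
    have "\<forall>\<^sub>F F in finite_subsets_at_top B. (\<Prod>i\<in>h ` F. 1 - x i) = (\<Prod>i\<in>F. 1 - x (h i))"
      by (rule eventually_finite_subsets_at_top_weakI)
        (use assms in \<open>auto simp: prod.reindex inj_on_subset\<close>)
    then have "(\<forall>\<^sub>F F in finite_subsets_at_top B. P (\<Prod>i\<in>h ` F. 1 - x i)) \<longleftrightarrow>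
        (\<forall>\<^sub>F F in finite_subsets_at_top B. P (\<Prod>i\<in>F. 1 - x (h i)))" for P
      by (intro eventually_subst) (auto elim: eventually_mono)
    then show ?thesis by (simp add: filter_eq_iff eventually_filtermap)
  qed
  finally show ?thesis
    unfolding uprod_def t2_space_class.Lim_def filterlim_def by simp
qed

text \<open>Intersection with each part maps the net of finite subsets of the union to the net of
  that part, so both limits can be taken along one common net.\<close>

lemma uprod_Un_disjoint:
  assumes x: "(\<lambda>i. norm (x i)) summable_on (A \<union> B)" and "A \<inter> B = {}"
  shows "uprod x (A \<union> B) = uprod x A * uprod x B"
proof -
  have xA: "(\<lambda>i. norm (x i)) summable_on A" "(\<lambda>i. norm (x i)) summable_on B"
    using x by (auto intro: summable_on_subset)
  have restrict: "filterlim (\<lambda>F. F \<inter> S) (finite_subsets_at_top S) (finite_subsets_at_top (A \<union> B))"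
    if "S \<subseteq> A \<union> B" for S
    unfolding filterlim_iff
  proof safe
    fix P assume "eventually P (finite_subsets_at_top S)"
    then obtain X where X: "finite X" "X \<subseteq> S" "\<forall>Y. finite Y \<and> X \<subseteq> Y \<and> Y \<subseteq> S \<longrightarrow> P Y"
      unfolding eventually_finite_subsets_at_top by blast
    show "\<forall>\<^sub>F F in finite_subsets_at_top (A \<union> B). P (F \<inter> S)"
      unfolding eventually_finite_subsets_at_top
    proof (intro exI[of _ X] conjI allI impI X(3)[rule_format])
    qed (use X that in auto)
  qed
  have "((\<lambda>F. (\<Prod>i\<in>F \<inter> A. 1 - x i) * (\<Prod>i\<in>F \<inter> B. 1 - x i)) \<longlongrightarrow> uprod x A * uprod x B)
      (finite_subsets_at_top (A \<union> B))"
    by (intro tendsto_mult filterlim_compose[OF uprod_tendsto restrict] xA) auto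
  moreover have "\<forall>\<^sub>F F in finite_subsets_at_top (A \<union> B).
      (\<Prod>i\<in>F \<inter> A. 1 - x i) * (\<Prod>i\<in>F \<inter> B. 1 - x i) = (\<Prod>i\<in>F. 1 - x i)"
  proof (rule eventually_finite_subsets_at_top_weakI)
    fix F assume F: "finite F" "F \<subseteq> A \<union> B"
    then have "F = (F \<inter> A) \<union> (F \<inter> B)" by blast
    then show "(\<Prod>i\<in>F \<inter> A. 1 - x i) * (\<Prod>i\<in>F \<inter> B. 1 - x i) = (\<Prod>i\<in>F. 1 - x i)"
      using F assms(2) prod.union_disjoint[of "F \<inter> A" "F \<inter> B" "\<lambda>i. 1 - x i"]
      by (metis finite_Int inf_left_commute inf_bot_right inf_assoc)
  qed
  ultimately have "((\<lambda>F. \<Prod>i\<in>F. 1 - x i) \<longlongrightarrow> uprod x A * uprod x B) (finite_subsets_at_top (A \<union> B))"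
    by (rule Lim_transform_eventually)
  with uprod_tendsto[OF x] show ?thesis
    by (rule tendsto_unique[rotated 1]) simp
qed

lemma holo_on_uprod:
  assumes U: "open U" and x: "\<And>i. i \<in> A \<Longrightarrow> holo_on (x i) U"
    and c: "\<And>i t. i \<in> A \<Longrightarrow> t \<in> U \<Longrightarrow> norm (x i t) \<le> c i" "c summable_on A"
  shows "holo_on (\<lambda>t. uprod (\<lambda>i. x i t) A) U"
proof (cases "U = {}")
  case True then show ?thesis by (simp add: holo_on_def)
next
  case False
  then obtain t0 where "t0 \<in> U" by blast
  then have c0: "c i \<ge> 0" if "i \<in> A" for i using c(1)[OF that] norm_ge_zero order_trans by blast
  \<comment> \<open>The exceptional set is read off from the majorant instead of the values, so one
    finite set serves all points of \<open>U\<close>.\<close>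
  define E where "E = {i \<in> A. c i \<ge> 1 / 2}"
  have E: "finite E" "E \<subseteq> A"
    using finite_large_terms[OF c(2), of "1 / 2"] c0 by (auto simp: E_def)
  have small: "norm (x i t) < 1 / 2" if "i \<in> A - E" "t \<in> U" for i t
    using c(1)[of i t] that by (auto simp: E_def)
  have eq: "uprod (\<lambda>i. x i t) A = (\<Prod>i\<in>E. 1 - x i t) * exp (\<Sum>\<^sub>\<infinity>i\<in>A - E. Ln (1 - x i t))"
    if t: "t \<in> U" for t
  proof (rule uprod_eq_exp[OF _ E])
    show "(\<lambda>i. norm (x i t)) summable_on A"
      using c(2) by (rule summable_on_comparison_test) (use c(1) t in auto)
  qed (use small t in auto)
  have Ln: "holo_on (\<lambda>t. Ln (1 - x i t)) U" if i: "i \<in> A - E" for i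
  proof (rule holo_on_compose[where \<phi> = Ln])
    show "holo_on (\<lambda>t. 1 - x i t) U" using i by (intro holo_on_diff holo_on_const x) auto
    fix t assume "t \<in> U"
    \<comment> \<open>Off the exceptional set \<open>1 - x i t\<close> has positive real part and
      thus avoids the branch cut of \<open>Ln\<close>.\<close>
    then have "\<bar>Re (x i t)\<bar> < 1 / 2" using small[OF i, of t] abs_Re_le_cmod[of "x i t"] by simp
    then have "1 - x i t \<notin> \<real>\<^sub>\<le>\<^sub>0" by (auto simp: complex_nonpos_Reals_iff)
    then show "\<exists>d. (Ln has_field_derivative d) (at (1 - x i t))" using has_field_derivative_Ln by blast
  qed
  have bound: "norm (Ln (1 - x i t)) \<le> 2 * c i" if "i \<in> A - E" "t \<in> U" for i t
  proof -
    have "norm (Ln (1 - x i t)) \<le> 2 * norm (x i t)"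
      by (rule norm_Ln_one_minus_le[OF small[OF that]])
    also have "\<dots> \<le> 2 * c i" using c(1) that by auto
    finally show ?thesis .
  qed
  have summ: "(\<lambda>i. 2 * c i) summable_on (A - E)"
    using c(2) by (intro summable_on_cmult_right) (rule summable_on_subset, auto)
  have "holo_on (\<lambda>t. \<Sum>\<^sub>\<infinity>i\<in>A - E. Ln (1 - x i t)) U"
    by (rule holo_on_infsum[OF U Ln bound summ])
  then have "holo_on (\<lambda>t. exp (\<Sum>\<^sub>\<infinity>i\<in>A - E. Ln (1 - x i t))) U"
    by (rule holo_on_compose) (auto intro!: exI DERIV_exp)
  then have "holo_on (\<lambda>t. (\<Prod>i\<in>E. 1 - x i t) * exp (\<Sum>\<^sub>\<infinity>i\<in>A - E. Ln (1 - x i t))) U"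
    using E(2) by (intro holo_on_mult holo_on_prod holo_on_diff holo_on_const x) auto
  then show ?thesis
    by (rule holo_on_cong[OF U eq, rotated])
qed

section \<open>Multiple q-Pochhammer symbols\<close>

abbreviation mpterm :: "complex \<Rightarrow> complex list \<Rightarrow> nat list \<Rightarrow> complex" where
  "mpterm z ps is \<equiv> z * prod_list (map2 (^) ps is)"

abbreviation lists_of :: "nat \<Rightarrow> 'a list set" where
  "lists_of n \<equiv> {is. length is = n}"

lemma mpoch0_eq_uprod: "mpoch0 z ps = uprod (mpterm z ps) (lists_of (length ps))"
  by (simp add: mpoch0_def uprod_def)

lemma lists_of_Suc: "lists_of (Suc n) = (\<lambda>(i, is). i # is) ` (UNIV \<times> lists_of n)"
  by (force simp: image_iff length_Suc_conv)

text \<open>An iterated geometric series: the sum over lists factors into the sum over the head and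
  the sum over the tail.\<close>

lemma summable_on_power_product:
  fixes r :: real
  assumes "0 \<le> r" "r < 1"
  shows "(\<lambda>is. r ^ sum_list is) summable_on lists_of n"
proof (induction n)
  case 0
  have "lists_of 0 = {[] :: nat list}" by auto
  then show ?case by simp
next
  case (Suc n)
  have geo: "(\<lambda>i. r ^ i) summable_on UNIV"
    using assms by (intro norm_summable_imp_summable_on) (simp add: summable_geometric)
  define g where "g = (\<lambda>(i, is). r ^ i * r ^ sum_list is)"
  have norm_g: "norm (g (i, is)) = r ^ i * r ^ sum_list is" for i "is"
    using assms by (simp add: g_def)
  have "(\<lambda>x. norm (g x)) summable_on UNIV \<times> lists_of n"
    unfolding Infinite_Sum.abs_summable_on_Sigma_iff norm_g
  proof (intro conjI ballI)
    show "(\<lambda>is. r ^ i * r ^ sum_list is) summable_on lists_of n" for i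
      using Suc by (rule summable_on_cmult_right)
    show "(\<lambda>i. norm (\<Sum>\<^sub>\<infinity>is\<in>lists_of n. r ^ i * r ^ sum_list is)) summable_on UNIV"
      using summable_on_cmult_left[OF geo] assms
      by (simp add: infsum_cmult_right' infsum_nonneg)
  qed
  then have "g summable_on UNIV \<times> lists_of n"
    by (rule abs_summable_summable)
  moreover have "inj_on (\<lambda>(i, is). i # is) (UNIV \<times> lists_of n)" by (auto simp: inj_on_def)
  ultimately show ?case
    unfolding lists_of_Suc by (subst summable_on_reindex) (auto simp: o_def g_def case_prod_unfold power_add)
qed

lemma norm_power_product_le:
  fixes ps :: "complex list"
  assumes "\<And>p. p \<in> set ps \<Longrightarrow> norm p \<le> r" "length is = length ps"
  shows "norm (prod_list (map2 (^) ps is)) \<le> r ^ sum_list is"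
  using assms(2,1)
proof (induction "is" ps rule: list_induct2)
  case (Cons i is' p ps)
  then have "norm p \<le> r" by simp
  then have "0 \<le> r" using norm_ge_zero[of p] by linarith
  with Cons have "norm p ^ i * norm (prod_list (map2 (^) ps is')) \<le> r ^ i * r ^ sum_list is'"
    by (intro mult_mono power_mono zero_le_power) auto
  then show ?case by (simp add: norm_mult norm_power power_add)
qed simp

lemma norm_list_bound:
  fixes ps :: "complex list"
  assumes "\<And>p. p \<in> set ps \<Longrightarrow> norm p < 1"
  obtains r where "0 \<le> r" "r < 1" "\<And>p. p \<in> set ps \<Longrightarrow> norm p < r"
proof -
  define M where "M = Max (insert 0 (norm ` set ps))"
  have M: "0 \<le> M" "M < 1" "\<And>p. p \<in> set ps \<Longrightarrow> norm p \<le> M"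
    using assms by (auto simp: M_def)
  \<comment> \<open>The midpoint between the maximum and 1 leaves strict room on both sides, so the
    bound persists in a neighbourhood when the parameters vary.\<close>
  then show ?thesis by (intro that[of "(M + 1) / 2"]) (auto dest!: M(3))
qed

lemma mpterm_summable:
  assumes "\<And>p. p \<in> set ps \<Longrightarrow> norm p < 1"
  shows "(\<lambda>is. norm (mpterm z ps is)) summable_on lists_of (length ps)"
proof -
  obtain r where r: "0 \<le> r" "r < 1" "\<And>p. p \<in> set ps \<Longrightarrow> norm p < r"
    by (rule norm_list_bound[OF assms]) blast+
  have "(\<lambda>is. norm z * r ^ sum_list is) summable_on lists_of (length ps)"
    using r by (intro summable_on_cmult_right summable_on_power_product)
  then show ?thesis
    by (rule summable_on_comparison_test)
      (auto simp: norm_mult intro!: mult_left_mono norm_power_product_le less_imp_le[OF r(3)])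
qed

lemma holo_on_prod_list:
  "(\<And>P. P \<in> set Ps \<Longrightarrow> holo_on P U) \<Longrightarrow> holo_on (\<lambda>x. prod_list (map (\<lambda>P. P x) Ps)) U"
  by (induction Ps) (auto intro: holo_on_const holo_on_mult)

lemma holo_on_mpterm:
  assumes "holo_on Z U" "\<And>P. P \<in> set Ps \<Longrightarrow> holo_on P U"
  shows "holo_on (\<lambda>x. mpterm (Z x) (map (\<lambda>P. P x) Ps) is) U"
proof (intro holo_on_mult assms(1))
  show "holo_on (\<lambda>x. prod_list (map2 (^) (map (\<lambda>P. P x) Ps) is)) U"
    using assms(2)
  proof (induction Ps arbitrary: "is")
    case (Cons P Ps)
    then show ?case
      by (cases "is") (auto intro!: holo_on_const holo_on_mult holo_on_power)
  qed (simp add: holo_on_const)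
qed

text \<open>Near each point the parameters stay below one common \<open>r < 1\<close> and
  \<open>Z\<close> stays bounded, so a geometric majorant makes the product locally uniform.\<close>

lemma holo_on_mpoch0:
  assumes U: "open U" and Z: "holo_on Z U" and Ps: "\<And>P. P \<in> set Ps \<Longrightarrow> holo_on P U"
    and small: "\<And>P x. P \<in> set Ps \<Longrightarrow> x \<in> U \<Longrightarrow> norm (P x) < 1"
  shows "holo_on (\<lambda>x. mpoch0 (Z x) (map (\<lambda>P. P x) Ps)) U"
proof (rule holo_on_local)
  fix x0 assume x0: "x0 \<in> U"
  have small0: "norm p < 1" if "p \<in> set (map (\<lambda>P. P x0) Ps)" for p
    using that small[OF _ x0] by auto
  obtain r where r: "0 \<le> r" "r < 1" "\<And>p. p \<in> set (map (\<lambda>P. P x0) Ps) \<Longrightarrow> norm p < r"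
    by (rule norm_list_bound[OF small0]) blast+
  define V where "V = {x \<in> U. norm (Z x) < norm (Z x0) + 1 \<and> (\<forall>P\<in>set Ps. norm (P x) < r)}"
  have openZ: "open (F -` ball 0 e \<inter> U)" if "holo_on F U" for F e
    using continuous_open_preimage[OF holo_on_imp_continuous_on[OF that] U open_ball, of 0 e]
    by (simp add: Int_commute)
  have "open ((Z -` ball 0 (norm (Z x0) + 1) \<inter> U) \<inter> (\<Inter>P\<in>set Ps. P -` ball 0 r \<inter> U))"
    by (intro open_Int open_INT openZ Z ballI Ps) auto
  moreover have "V = (Z -` ball 0 (norm (Z x0) + 1) \<inter> U) \<inter> (\<Inter>P\<in>set Ps. P -` ball 0 r \<inter> U)"
    by (auto simp: V_def)
  ultimately have V: "open V" by simp
  have VU: "V \<subseteq> U" by (auto simp: V_def)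
  have "holo_on (\<lambda>x. uprod (mpterm (Z x) (map (\<lambda>P. P x) Ps)) (lists_of (length Ps))) V"
  proof (rule holo_on_uprod[OF V])
    show "holo_on (\<lambda>x. mpterm (Z x) (map (\<lambda>P. P x) Ps) is) V" for "is"
      by (rule holo_on_subset[OF holo_on_mpterm VU]) (use Z Ps in auto)
    show "norm (mpterm (Z x) (map (\<lambda>P. P x) Ps) is) \<le> (norm (Z x0) + 1) * r ^ sum_list is"
      if "is \<in> lists_of (length Ps)" "x \<in> V" for "is" x
      unfolding norm_mult
      by (rule mult_mono[OF _ norm_power_product_le]) (use that in \<open>auto simp: V_def\<close>)
    show "(\<lambda>is. (norm (Z x0) + 1) * r ^ sum_list is) summable_on lists_of (length Ps)"
      using r by (intro summable_on_cmult_right summable_on_power_product)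
  qed
  moreover have "x0 \<in> V" using x0 r by (auto simp: V_def)
  ultimately show "\<exists>V g. open V \<and> x0 \<in> V \<and> holo_on g V \<and>
      (\<forall>x\<in>V. mpoch0 (Z x) (map (\<lambda>P. P x) Ps) = g x)"
    using V by (intro exI[of _ V] exI) (auto simp: mpoch0_eq_uprod)
qed

lemma uprod_cong: "(\<And>i. i \<in> A \<Longrightarrow> x i = y i) \<Longrightarrow> uprod x A = uprod y A"
  unfolding uprod_def
  by (intro Lim_cong eventually_finite_subsets_at_top_weakI prod.cong) auto

lemma uprod_finite: "finite A \<Longrightarrow> uprod x A = (\<Prod>i\<in>A. 1 - x i)"
  unfolding uprod_def finite_subsets_at_top_finite
  by (intro tendsto_Lim tendsto_principal_singleton) (simp add: principal_eq_bot_iff)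

lemma mpoch_Nil: "mpoch z [] = 1 - z"
proof -
  have "lists_of 0 = {[] :: nat list}" by auto
  then show ?thesis by (simp add: mpoch_def mpoch0_eq_uprod uprod_finite)
qed

lemma mpoch0_nonzero:
  assumes "\<And>p. p \<in> set ps \<Longrightarrow> norm p < 1" "\<And>is. length is = length ps \<Longrightarrow> mpterm z ps is \<noteq> 1"
  shows "mpoch0 z ps \<noteq> 0"
  unfolding mpoch0_eq_uprod by (intro uprod_nonzero mpterm_summable) (use assms in auto)

lemma mpoch0_swap: "mpoch0 z [a, b] = mpoch0 z [b, a]"
proof -
  have rev: "rev ` lists_of 2 = (lists_of 2 :: nat list set)"
    by (auto intro!: image_eqI[of _ rev, OF rev_rev_ident[symmetric]])
  have "mpoch0 z [a, b] = uprod (mpterm z [a, b]) (rev ` lists_of 2)"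
    unfolding rev by (simp add: mpoch0_eq_uprod numeral_2_eq_2)
  also have "\<dots> = uprod (\<lambda>i. mpterm z [a, b] (rev i)) (lists_of 2)"
    by (rule uprod_reindex) (auto simp: inj_on_def)
  also have "\<dots> = uprod (mpterm z [b, a]) (lists_of 2)"
    by (rule uprod_cong) (auto simp: numeral_2_eq_2 length_Suc_conv)
  finally show ?thesis by (simp add: mpoch0_eq_uprod numeral_2_eq_2)
qed

text \<open>The indices are separated by whether the exponent of \<open>p\<close> is zero; lowering
  a positive exponent by one absorbs a factor \<open>p\<close> into the argument. The additive
  shadow is 1/(1-p) = 1 + p/(1-p).\<close>

lemma mpoch0_Cons:
  assumes "norm p < 1" "\<And>q. q \<in> set ps \<Longrightarrow> norm q < 1"
  shows "mpoch0 z (p # ps) = mpoch0 z ps * mpoch0 (p * z) (p # ps)"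
proof -
  define n where "n = length ps"
  define h :: "nat list \<Rightarrow> nat list" where "h i = Suc (hd i) # tl i" for i
  have split: "lists_of (Suc n) = (#) 0 ` lists_of n \<union> h ` lists_of (Suc n)"
  proof (intro set_eqI iffI)
    fix i :: "nat list" assume i: "i \<in> lists_of (Suc n)"
    then obtain k j where kj: "i = k # j" "length j = n" by (auto simp: length_Suc_conv)
    show "i \<in> (#) 0 ` lists_of n \<union> h ` lists_of (Suc n)"
    proof (cases k)
      case (Suc l)
      then have "i = h (l # j)" by (simp add: h_def kj)
      then show ?thesis using kj by auto
    qed (use kj in auto)
  qed (auto simp: h_def)
  have "mpoch0 z (p # ps) = uprod (mpterm z (p # ps)) ((#) 0 ` lists_of n \<union> h ` lists_of (Suc n))"
    unfolding split[symmetric] by (simp add: mpoch0_eq_uprod n_def)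
  also have "\<dots> = uprod (mpterm z (p # ps)) ((#) 0 ` lists_of n)
      * uprod (mpterm z (p # ps)) (h ` lists_of (Suc n))"
  proof (rule uprod_Un_disjoint)
    show "(\<lambda>i. norm (mpterm z (p # ps) i)) summable_on (#) 0 ` lists_of n \<union> h ` lists_of (Suc n)"
    proof (subst split[symmetric])
      have "norm q < 1" if "q \<in> set (p # ps)" for q using that assms by auto
      from mpterm_summable[of "p # ps" z, OF this] show "(\<lambda>i. norm (mpterm z (p # ps) i)) summable_on lists_of (Suc n)"
        by (simp add: n_def)
    qed
  qed (auto simp: h_def)
  also have "uprod (mpterm z (p # ps)) ((#) 0 ` lists_of n) = mpoch0 z ps"
    by (subst uprod_reindex) (auto simp: inj_on_def mpoch0_eq_uprod n_def)
  also have "uprod (mpterm z (p # ps)) (h ` lists_of (Suc n)) =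
      uprod (\<lambda>i. mpterm z (p # ps) (h i)) (lists_of (Suc n))"
  proof (rule uprod_reindex, rule inj_onI)
    fix i j :: "nat list" assume "i \<in> lists_of (Suc n)" "j \<in> lists_of (Suc n)" "h i = h j"
    then show "i = j" by (cases i; cases j) (simp_all add: h_def)
  qed
  also have "\<dots> = uprod (mpterm (p * z) (p # ps)) (lists_of (Suc n))"
    by (rule uprod_cong) (auto simp: h_def length_Suc_conv)
  finally show ?thesis by (simp add: mpoch0_eq_uprod n_def)
qed

text \<open>The pairs of exponents are split according to which of the two is larger.\<close>

lemma mpoch0_diagonal_split:
  assumes "norm a < 1" "norm b < 1"
  shows "mpoch0 z [a, b] = mpoch0 z [b, a * b] * mpoch0 (a * z) [a, a * b]"
proof -
  \<comment> \<open>With i = [u, v], \<open>f\<close> gives the term a^v b^(u+v) = b^u (ab)^v, and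
    \<open>g\<close> gives a^(u+v+1) b^v = a * a^u (ab)^v. The successor in \<open>g\<close>
    excludes the diagonal there and accounts for the argument \<open>a * z\<close>.\<close>
  define f where "f i = [i ! 1, i ! 0 + i ! 1]" for i :: "nat list"
  define g where "g i = [Suc (i ! 0 + i ! 1), i ! 1]" for i :: "nat list"
  have split: "lists_of 2 = f ` lists_of 2 \<union> g ` lists_of 2"
  proof (intro set_eqI iffI)
    fix i :: "nat list" assume "i \<in> lists_of 2"
    then obtain k l where kl: "i = [k, l]" by (auto simp: numeral_2_eq_2 length_Suc_conv)
    show "i \<in> f ` lists_of 2 \<union> g ` lists_of 2"
    proof (cases "k \<le> l")
      case True
      then have "i = f [l - k, k]" by (simp add: f_def kl)
      then show ?thesis by auto
    next
      case False
      then have "i = g [k - l - 1, l]" by (simp add: g_def kl)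
      then show ?thesis by auto
    qed
  qed (auto simp: f_def g_def)
  have "mpoch0 z [a, b] = uprod (mpterm z [a, b]) (f ` lists_of 2 \<union> g ` lists_of 2)"
    unfolding split[symmetric] by (simp add: mpoch0_eq_uprod numeral_2_eq_2)
  also have "\<dots> = uprod (mpterm z [a, b]) (f ` lists_of 2) * uprod (mpterm z [a, b]) (g ` lists_of 2)"
  proof (rule uprod_Un_disjoint)
    show "(\<lambda>i. norm (mpterm z [a, b] i)) summable_on f ` lists_of 2 \<union> g ` lists_of 2"
      unfolding split[symmetric]
      using mpterm_summable[of "[a, b]" z] assms by (auto simp: numeral_2_eq_2)
  qed (auto simp: f_def g_def)
  also have "uprod (mpterm z [a, b]) (f ` lists_of 2) = uprod (\<lambda>i. mpterm z [a, b] (f i)) (lists_of 2)"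
    by (rule uprod_reindex) (auto simp: inj_on_def f_def numeral_2_eq_2 length_Suc_conv)
  also have "\<dots> = uprod (mpterm z [b, a * b]) (lists_of 2)"
    by (rule uprod_cong)
      (auto simp: f_def numeral_2_eq_2 length_Suc_conv power_add power_mult_distrib mult_ac)
  also have "uprod (mpterm z [a, b]) (g ` lists_of 2) = uprod (\<lambda>i. mpterm z [a, b] (g i)) (lists_of 2)"
    by (rule uprod_reindex) (auto simp: inj_on_def g_def numeral_2_eq_2 length_Suc_conv)
  also have "\<dots> = uprod (mpterm (a * z) [a, a * b]) (lists_of 2)"
    by (rule uprod_cong)
      (auto simp: g_def numeral_2_eq_2 length_Suc_conv power_add power_mult_distrib mult_ac)
  finally show ?thesis by (simp add: mpoch0_eq_uprod numeral_2_eq_2)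
qed

section \<open>Functional equations in all chambers of moduli\<close>

lemma mpoch_swap: "mpoch z [a, b] = mpoch z [b, a]"
  by (simp add: mpoch_def Let_def mpoch0_swap mult.commute)

lemma mpoch_inverse_Cons:
  "p \<noteq> 0 \<Longrightarrow> norm p \<noteq> 1 \<Longrightarrow> mpoch z (inverse p # ps) = 1 / mpoch (p * z) (p # ps)"
  using mpoch_inverse[of p z "[]" ps] by simp

lemma norm_inverse_less_1: "norm (p :: complex) > 1 \<Longrightarrow> norm (inverse p) < 1"
  by (auto simp: norm_inverse intro!: inverse_less_1_iff[THEN iffD2])

text \<open>For \<open>norm p < 1\<close> this is the relation inside the disc, the other parameters
  being inverted identically on both sides. For \<open>norm p > 1\<close> it is the relation for
  \<open>inverse p\<close> solved for the other symbol, which requires nonzero values.\<close>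

lemma mpoch_Cons:
  assumes p: "p \<noteq> 0" "norm p \<noteq> 1" and ps: "\<And>q. q \<in> set ps \<Longrightarrow> norm q \<noteq> 1"
    and nz: "mpoch z ps \<noteq> 0" "mpoch (p * z) (p # ps) \<noteq> 0"
  shows "mpoch z (p # ps) = mpoch z ps * mpoch (p * z) (p # ps)"
proof -
  have less: "mpoch z (q # ps) = mpoch z ps * mpoch (q * z) (q # ps)" if q: "norm q < 1" for q
  proof -
    have "\<not> norm q > 1" using q by simp
    moreover have "norm r < 1" if "r \<in> set (map (\<lambda>p. if norm p > 1 then inverse p else p) ps)" for r
      using that ps norm_inverse_less_1 by fastforce
    ultimately show ?thesis
      using mpoch0_Cons[OF q, of "map (\<lambda>p. if norm p > 1 then inverse p else p) ps"
          "z / prod_list (filter (\<lambda>p. norm p > 1) ps)"]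
      by (simp add: mpoch_def Let_def power_int_mult_distrib)
  qed
  show ?thesis
  proof (cases "norm p < 1")
    case True then show ?thesis by (rule less)
  next
    case False
    define q where "q = inverse p"
    have q: "q \<noteq> 0" "norm q < 1" "p = inverse q"
      using False p norm_inverse_less_1 by (auto simp: q_def)
    have "mpoch z (p # ps) = 1 / mpoch (q * z) (q # ps)" "mpoch (p * z) (p # ps) = 1 / mpoch z (q # ps)"
      using mpoch_inverse_Cons[of q z ps] mpoch_inverse_Cons[of q "p * z" ps] q by (simp_all add: mult.assoc[symmetric])
    then show ?thesis using less[OF q(2)] nz(1) by simp
  qed
qed

text \<open>Replace each of a, b, ab by its inverse if it lies outside the unit disc. In every
  chamber one of the three resulting numbers is the product of the other two, and after moving
  inverted symbols across the equation the claim is \<open>base\<close> for those two. The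
  nonvanishing assumptions justify the divisions.\<close>

lemma mpoch_diagonal_split:
  assumes nz: "a \<noteq> 0" "b \<noteq> 0" and norms: "norm a \<noteq> 1" "norm b \<noteq> 1" "norm (a * b) \<noteq> 1"
    and nz': "mpoch z [a, b] \<noteq> 0" "mpoch z [b, a * b] \<noteq> 0" "mpoch (a * z) [a, a * b] \<noteq> 0"
  shows "mpoch z [a, b] = mpoch z [b, a * b] * mpoch (a * z) [a, a * b]"
proof -
  have base: "mpoch y [c, d] = mpoch y [d, c * d] * mpoch (c * y) [c, c * d]"
    if "norm c < 1" "norm d < 1" for c d y
  proof -
    have "norm (c * d) < 1"
      using that mult_strict_mono[of "norm c" 1 "norm d" 1] by (simp add: norm_mult)
    then have "mpoch y [c, d] = mpoch0 y [c, d]" "mpoch y [d, c * d] = mpoch0 y [d, c * d]"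
      "mpoch (c * y) [c, c * d] = mpoch0 (c * y) [c, c * d]"
      using that by (auto intro!: mpoch_eq_mpoch0)
    then show ?thesis using mpoch0_diagonal_split[OF that] by simp
  qed
  define a' b' c where "a' = inverse a" and "b' = inverse b" and "c = inverse (a * b)"
  have inv_l: "mpoch y [q, d] = 1 / mpoch (inverse q * y) [inverse q, d]"
    if "q \<noteq> 0" "norm q \<noteq> 1" for q d y
    using mpoch_inverse_Cons[of "inverse q" y "[d]"] that by (simp add: norm_inverse)
  have inv_r: "mpoch y [d, q] = 1 / mpoch (inverse q * y) [d, inverse q]"
    if "q \<noteq> 0" "norm q \<noteq> 1" for q d y
    using inv_l[OF that] by (metis mpoch_swap)
  note ia = inv_l[OF nz(1) norms(1), folded a'_def] inv_r[OF nz(1) norms(1), folded a'_def]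
  note ib = inv_l[OF nz(2) norms(2), folded b'_def] inv_r[OF nz(2) norms(2), folded b'_def]
  have "a * b \<noteq> 0" using nz by simp
  note ic = inv_l[OF this norms(3), folded c_def] inv_r[OF this norms(3), folded c_def]
  have rel: "a' * a = 1" "b' * b = 1" "c = a' * b'"
    using nz by (simp_all add: a'_def b'_def c_def)
  have rel': "a' * (a * b) = b" "b' * (a * b) = a" "a * c = b'" "b * c = a'"
    "a' * (a * y) = y" "c * (a * y) = b' * y" "b * (c * y) = a' * y" "a * (c * y) = b' * y" for y
    using nz by (simp_all add: a'_def b'_def c_def)
  have less: "norm a > 1 \<Longrightarrow> norm a' < 1" "norm b > 1 \<Longrightarrow> norm b' < 1"
    "norm (a * b) > 1 \<Longrightarrow> norm c < 1"
    unfolding a'_def b'_def c_def by (rule norm_inverse_less_1, assumption)+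
  consider "norm a < 1" "norm b < 1" | "norm a > 1" "norm b > 1"
    | "norm a < 1" "norm b > 1" "norm (a * b) < 1" | "norm a < 1" "norm b > 1" "norm (a * b) > 1"
    | "norm a > 1" "norm b < 1" "norm (a * b) < 1" | "norm a > 1" "norm b < 1" "norm (a * b) > 1"
    using norms by linarith
  then show ?thesis
  proof cases
    case 1 then show ?thesis by (rule base)
  next
    case 2
    have "mpoch z [a, b] = mpoch (c * z) [b', a']"
      using ia(1)[of z b] ib(2)[of "a' * z" a'] by (simp add: rel mult_ac mpoch_swap)
    moreover have "mpoch z [b, a * b] = mpoch (b' * (c * z)) [b', b' * a']"
      using ib(1)[of z "a * b"] ic(2)[of "b' * z" b'] by (simp add: rel(3) mult_ac)
    moreover have "mpoch (a * z) [a, a * b] = mpoch (c * z) [a', b' * a']"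
      using ia(1)[of "a * z" "a * b", unfolded rel'(5)] ic(2)[of z a'] by (simp add: rel(3) mult_ac)
    ultimately show ?thesis using base[OF less(2,1), of "c * z"] 2 by simp
  next
    case 3
    have "mpoch z [a, b] = 1 / mpoch (b' * z) [b', a]"
      using ib(2)[of z a] by (simp add: mpoch_swap)
    moreover have "mpoch z [b, a * b] = 1 / mpoch (b' * z) [b', a * b]"
      using ib(1) .
    moreover have "mpoch (b' * z) [b', a * b] = mpoch (b' * z) [b', a] * mpoch (a * z) [a, a * b]"
    proof -
      have e: "a * b * b' = a" "a * b * (b' * z) = a * z" using nz by (simp_all add: b'_def)
      show ?thesis
        using base[OF 3(3) less(2), of "b' * z"] 3(2)
        unfolding e by (simp only: mpoch_swap[of _ "a * b"])
    qed
    ultimately show ?thesis using nz'(3) by simp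
  next
    case 4
    have "mpoch z [a, b] = 1 / mpoch (b' * z) [a, b']"
      using ib(2) .
    moreover have "mpoch z [b, a * b] = mpoch (c * (b' * z)) [c, b']"
      using ib(1)[of z "a * b"] ic(2)[of "b' * z" b'] by (simp add: mpoch_swap)
    moreover have "mpoch (a * z) [a, a * b] = 1 / mpoch (b' * z) [a, c]"
      using ic(2)[of "a * z" a] by (simp add: rel')
    moreover have "mpoch (b' * z) [a, c] = mpoch (c * (b' * z)) [c, b'] * mpoch (b' * z) [a, b']"
    proof -
      have e: "c * a = b'" using rel'(3) by (simp add: mult.commute)
      show ?thesis
        using base[OF less(3) 4(1), of "b' * z"] 4(3)
        unfolding e by (simp only: mpoch_swap[of _ a c] mult.commute)
    qed
    ultimately show ?thesis using nz'(2) by simp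
  next
    case 5
    have "mpoch z [a, b] = 1 / mpoch (a' * z) [a', b]"
      using ia(1) .
    moreover have "mpoch (a * z) [a, a * b] = 1 / mpoch z [a', a * b]"
      using ia(1)[of "a * z"] by (simp add: rel')
    moreover have "mpoch z [a', a * b] = mpoch z [b, a * b] * mpoch (a' * z) [a', b]"
      using base[OF less(1) 5(3), of z] 5(1) by (simp add: rel' mpoch_swap)
    ultimately show ?thesis using nz'(2) by simp
  next
    case 6
    have "mpoch z [a, b] = 1 / mpoch (a' * z) [a', b]"
      using ia(1) .
    moreover have "mpoch z [b, a * b] = 1 / mpoch (c * z) [b, c]"
      using ic(2) .
    moreover have "mpoch (a * z) [a, a * b] = mpoch (c * z) [c, a']"
      using ia(1)[of "a * z" "a * b"] ic(2)[of z a'] by (simp add: rel' mpoch_swap)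
    moreover have "mpoch (c * z) [b, c] = mpoch (c * z) [c, a'] * mpoch (a' * z) [a', b]"
      using base[OF 6(2) less(3), of "c * z"] 6(3) by (simp add: rel' mpoch_swap)
    ultimately show ?thesis using nz'(3) by simp
  qed
qed

text \<open>Inverting parameters and shifting the argument only multiplies by elements of the group
  \<open>G\<close>, so every factor has the form 1 - z g with g in \<open>G\<close>, whichever
  parameters were inverted.\<close>

lemma mpoch_nonzero:
  assumes G: "1 \<in> G" "\<And>g h. g \<in> G \<Longrightarrow> h \<in> G \<Longrightarrow> g * h \<in> G" "\<And>g. g \<in> G \<Longrightarrow> inverse g \<in> G"
    and ps: "set ps \<subseteq> G" "\<And>p. p \<in> set ps \<Longrightarrow> norm p \<noteq> 1"
    and z: "\<And>g. g \<in> G \<Longrightarrow> z * g \<noteq> 1"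
  shows "mpoch z ps \<noteq> 0"
proof -
  let ?qs = "map (\<lambda>p. if norm p > 1 then inverse p else p) ps"
  have list: "prod_list gs \<in> G" if "set gs \<subseteq> G" for gs
    using that by (induction gs) (auto intro: G)
  have pow: "g ^ n \<in> G" if "g \<in> G" for g and n :: nat
    using that by (induction n) (auto intro: G)
  have qs: "set ?qs \<subseteq> G" using ps(1) G(3) by auto
  have "mpoch0 (z / prod_list (filter (\<lambda>p. norm p > 1) ps)) ?qs \<noteq> 0"
  proof (rule mpoch0_nonzero)
    show "norm q < 1" if "q \<in> set ?qs" for q
      using that ps(2) norm_inverse_less_1 by fastforce
    fix i :: "nat list" assume "length i = length ?qs"
    have "set (map2 (^) ?qs i) \<subseteq> G"
    proof
      fix g assume "g \<in> set (map2 (^) ?qs i)"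
      then obtain q k where "(q, k) \<in> set (zip ?qs i)" "g = q ^ k" by auto
      then show "g \<in> G" using qs pow set_zip_leftD[of q k ?qs i] by blast
    qed
    then have "inverse (prod_list (filter (\<lambda>p. norm p > 1) ps)) * prod_list (map2 (^) ?qs i) \<in> G"
      using ps(1) by (intro G list) auto
    from z[OF this]
    show "mpterm (z / prod_list (filter (\<lambda>p. norm p > 1) ps)) ?qs i \<noteq> 1"
      by (simp add: divide_inverse mult.assoc)
  qed
  then show ?thesis by (simp add: mpoch_def Let_def)
qed

text \<open>Since no parameter has modulus 1, the choice of parameters to invert is locally
  constant. The outer exponent is kept outside \<open>W\<close> because \<open>W\<close> may vanish,
  where a negative power would be a pole.\<close>

lemma mpoch_locally_holomorphic:
  assumes U: "open U" and Z: "holo_on Z U" and Ps: "\<And>P. P \<in> set Ps \<Longrightarrow> holo_on P U"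
    and nz: "\<And>P x. P \<in> set Ps \<Longrightarrow> x \<in> U \<Longrightarrow> P x \<noteq> 0 \<and> norm (P x) \<noteq> 1" and x0: "x0 \<in> U"
  shows "\<exists>V W (e :: int). open V \<and> x0 \<in> V \<and> V \<subseteq> U \<and> holo_on W V \<and> e \<noteq> 0 \<and>
    (\<forall>x\<in>V. mpoch (Z x) (map (\<lambda>P. P x) Ps) = W x powi e)"
proof -
  define big where "big P \<longleftrightarrow> norm (P x0) > 1" for P :: "point \<Rightarrow> complex"
  define B :: "(point \<Rightarrow> complex) \<Rightarrow> complex set" where "B P = (if big P then - cball 0 1 else ball 0 1)" for P
  define V where "V = U \<inter> (\<Inter>P\<in>set Ps. P -` B P \<inter> U)"
  define Bs where "Bs = filter big Ps"
  define W where "W x = mpoch0 (Z x / prod_list (map (\<lambda>P. P x) Bs))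
    (map (\<lambda>P. P x) (map (\<lambda>P x. if big P then inverse (P x) else P x) Ps))" for x
  have "open (P -` B P \<inter> U)" if "P \<in> set Ps" for P
  proof -
    have "open (B P)" by (simp add: B_def open_Compl)
    then show ?thesis
      using continuous_open_preimage[OF holo_on_imp_continuous_on[OF Ps[OF that]] U, of "B P"]
      by (simp add: Int_commute)
  qed
  then have V: "open V" unfolding V_def using U by (intro open_Int open_INT) auto
  have VU: "V \<subseteq> U" by (auto simp: V_def)
  have "x0 \<in> V"
    using x0 nz[OF _ x0] by (auto simp: V_def B_def big_def dist_norm linorder_not_less order_less_le)
  have norms: "norm (P x) \<noteq> 1" "P x \<noteq> 0" "norm (P x) > 1 \<longleftrightarrow> big P" if "P \<in> set Ps" "x \<in> V" for P x
  proof -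
    have "P x \<in> B P" using that unfolding V_def by blast
    then show "norm (P x) > 1 \<longleftrightarrow> big P" by (auto simp: B_def split: if_splits)
  qed (use nz[of P x] that VU in auto)
  have hol: "holo_on P V" if "P \<in> set Ps" for P
    using Ps[OF that] VU by (rule holo_on_subset)
  have "holo_on W V"
    unfolding W_def divide_inverse
  proof (intro holo_on_mpoch0[OF V] holo_on_mult holo_on_inverse holo_on_prod_list)
    show "holo_on Z V" using Z VU by (rule holo_on_subset)
    show "holo_on P V" if "P \<in> set Bs" for P using that by (intro hol) (auto simp: Bs_def)
    show "prod_list (map (\<lambda>P. P x) Bs) \<noteq> 0" if "x \<in> V" for x
      using norms(2)[OF _ that] by (auto simp: Bs_def prod_list_zero_iff)
  next
    fix P' assume "P' \<in> set (map (\<lambda>P x. if big P then inverse (P x) else P x) Ps)"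
    then obtain P where P: "P \<in> set Ps" "P' = (\<lambda>x. if big P then inverse (P x) else P x)" by auto
    show "holo_on P' V"
      using holo_on_inverse[OF hol[OF P(1)] norms(2)[OF P(1)]] hol[OF P(1)]
      unfolding P(2) by (cases "big P") simp_all
    show "norm (P' x) < 1" if "x \<in> V" for x
      using norms[OF P(1) that] norm_inverse_less_1[of "P x"] by (auto simp: P(2))
  qed
  have eq: "mpoch (Z x) (map (\<lambda>P. P x) Ps) = W x powi (- 1) ^ length Bs" if x: "x \<in> V" for x
  proof -
  have "filter (\<lambda>p. norm p > 1) (map (\<lambda>P. P x) Ps) = map (\<lambda>P. P x) Bs"
    unfolding Bs_def filter_map o_def using norms(3)[OF _ x] by (intro arg_cong[of _ _ "map _"] filter_cong) auto
  moreover have "map (\<lambda>p. if norm p > 1 then inverse p else p) (map (\<lambda>P. P x) Ps) =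
      map (\<lambda>P. P x) (map (\<lambda>P x. if big P then inverse (P x) else P x) Ps)"
    using norms(3)[OF _ x] by auto
  ultimately show ?thesis
    unfolding mpoch_def Let_def W_def by (simp only: length_map)
  qed
  show ?thesis
    using V \<open>x0 \<in> V\<close> VU \<open>holo_on W V\<close> eq
    by (intro exI[of _ V] exI[of _ W] exI[of _ "(- 1) ^ length Bs"]) simp
qed

text \<open>As \<open>e \<noteq> 0\<close> and the inverse of 0 is 0, zeros and poles alike have
  value 0. Hence removing the points of value 0 leaves exactly the region where the local formula
  \<open>W x powi e\<close> is safe.\<close>

lemma holo_on_mpoch:
  assumes U: "open U" and Z: "holo_on Z U" and Ps: "\<And>P. P \<in> set Ps \<Longrightarrow> holo_on P U"
    and nz: "\<And>P x. P \<in> set Ps \<Longrightarrow> x \<in> U \<Longrightarrow> P x \<noteq> 0 \<and> norm (P x) \<noteq> 1"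
  defines "N \<equiv> {x \<in> U. mpoch (Z x) (map (\<lambda>P. P x) Ps) \<noteq> 0}"
  shows "open N" "holo_on (\<lambda>x. mpoch (Z x) (map (\<lambda>P. P x) Ps)) N"
proof -
  have loc: "\<exists>V W e. open V \<and> x0 \<in> V \<and> V \<subseteq> N \<and> holo_on W V \<and> (\<forall>x\<in>V. W x \<noteq> 0) \<and>
      (\<forall>x\<in>V. mpoch (Z x) (map (\<lambda>P. P x) Ps) = W x powi e)" if x0: "x0 \<in> N" for x0
  proof -
    have "x0 \<in> U" using x0 by (simp add: N_def)
    obtain V W and e :: int where V: "open V" "x0 \<in> V" "V \<subseteq> U" "holo_on W V" "e \<noteq> 0"
      "\<And>x. x \<in> V \<Longrightarrow> mpoch (Z x) (map (\<lambda>P. P x) Ps) = W x powi e"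
      using mpoch_locally_holomorphic[of U Z Ps x0] U Z Ps nz \<open>x0 \<in> U\<close> by metis
    define V' where "V' = V \<inter> W -` (- {0})"
    have "open V'"
      unfolding V'_def using holo_on_imp_continuous_on[OF V(4)] V(1)
      by (rule continuous_open_preimage) auto
    moreover have "x0 \<in> V'" "V' \<subseteq> N" using V x0 by (auto simp: V'_def N_def)
    moreover have "holo_on W V'" by (rule holo_on_subset[OF V(4)]) (auto simp: V'_def)
    ultimately show ?thesis
      using V(6) by (intro exI[of _ V'] exI[of _ W] exI[of _ e]) (auto simp: V'_def)
  qed
  show "open N"
  proof (rule open_subopen[THEN iffD2], rule ballI)
    fix x0 assume "x0 \<in> N"
    from loc[OF this] show "\<exists>T. open T \<and> x0 \<in> T \<and> T \<subseteq> N" by metis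
  qed
  show "holo_on (\<lambda>x. mpoch (Z x) (map (\<lambda>P. P x) Ps)) N"
  proof (rule holo_on_local)
    fix x0 assume "x0 \<in> N"
    from loc[OF this] obtain V W e where V: "open V" "x0 \<in> V" "holo_on W V" "\<forall>x\<in>V. W x \<noteq> 0"
      "\<forall>x\<in>V. mpoch (Z x) (map (\<lambda>P. P x) Ps) = W x powi e" by blast
    then show "\<exists>V g. open V \<and> x0 \<in> V \<and> holo_on g V \<and>
        (\<forall>x\<in>V. mpoch (Z x) (map (\<lambda>P. P x) Ps) = g x)"
      by (intro exI[of _ V] exI[of _ "\<lambda>x. W x powi e"]) (auto intro!: holo_on_powi)
  qed
qed

section \<open>Generic points and regular functions\<close>

definition mon :: "int \<Rightarrow> int \<Rightarrow> int \<Rightarrow> point \<Rightarrow> complex" where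
  "mon k m n = (\<lambda>(Q, p, s). Q powi k * p powi m * s powi n)"

lemma mon_nonzero: "x \<in> torus \<Longrightarrow> mon k m n x \<noteq> 0"
  by (auto simp: mon_def torus_def)

lemma mon_mult: "x \<in> torus \<Longrightarrow> mon k m n x * mon k' m' n' x = mon (k + k') (m + m') (n + n') x"
  by (auto simp: mon_def torus_def power_int_add)

lemma mon_inverse: "x \<in> torus \<Longrightarrow> inverse (mon k m n x) = mon (- k) (- m) (- n) x"
  by (auto simp: mon_def torus_def power_int_minus)

lemma mon_0: "mon 0 0 0 x = 1"
  by (simp add: mon_def case_prod_unfold)

lemma mon_mono_map:
  "x \<in> torus \<Longrightarrow> mon k m n (mono_map a b c d x) = mon k (a * m + c * n) (b * m + d * n) x"
  by (auto simp: mon_def torus_def mono_map_def power_int_mult_distrib power_int_mult [symmetric]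
      power_int_add mult_ac)

lemma holo_on_fst: "holo_on (\<lambda>x. fst x) U"
  unfolding holo_on_def by (auto intro!: exI[of _ fst] derivative_eq_intros)

lemma holo_on_fst_snd: "holo_on (\<lambda>x. fst (snd x)) U"
  unfolding holo_on_def by (auto intro!: exI[of _ "\<lambda>x. fst (snd x)"] derivative_eq_intros)

lemma holo_on_snd_snd: "holo_on (\<lambda>x. snd (snd x)) U"
  unfolding holo_on_def by (auto intro!: exI[of _ "\<lambda>x. snd (snd x)"] derivative_eq_intros)

lemma holo_on_mon: "holo_on (mon k m n) torus"
  unfolding mon_def case_prod_unfold
  by (intro holo_on_mult holo_on_powi holo_on_fst holo_on_fst_snd holo_on_snd_snd)
    (auto simp: torus_def)

text \<open>Equivalently, the logarithms of |Q|, |p|, |s| are linearly independent over the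
  rationals.\<close>

definition generic :: "point set" where
  "generic = {x \<in> torus. \<forall>k m n. norm (mon k m n x) = 1 \<longrightarrow> k = 0 \<and> m = 0 \<and> n = 0}"

lemma generic_torus: "x \<in> generic \<Longrightarrow> x \<in> torus"
  by (simp add: generic_def)

lemma norm_mon_generic: "x \<in> generic \<Longrightarrow> (k, m, n) \<noteq> (0, 0, 0) \<Longrightarrow> norm (mon k m n x) \<noteq> 1"
  by (auto simp: generic_def)

lemma mono_map_generic:
  assumes "x \<in> generic" "a * d - b * c = 1"
  shows "mono_map a b c d x \<in> generic"
proof -
  have zero: "m = 0 \<and> n = 0" if "a * m + c * n = 0" "b * m + d * n = 0" for m n
  proof -
    \<comment> \<open>Cramer's rule with determinant 1: the substitution acts injectively on
      exponent vectors.\<close>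
    have "m = d * (a * m + c * n) - c * (b * m + d * n)" "n = a * (b * m + d * n) - b * (a * m + c * n)"
      using arg_cong[OF assms(2), of "\<lambda>t. t * m"] arg_cong[OF assms(2), of "\<lambda>t. t * n"]
      by (simp_all add: algebra_simps)
    then show ?thesis unfolding that by simp
  qed
  have "k = 0 \<and> m = 0 \<and> n = 0" if "norm (mon k m n (mono_map a b c d x)) = 1" for k m n
  proof -
    have "k = 0 \<and> a * m + c * n = 0 \<and> b * m + d * n = 0"
      using that assms(1) mon_mono_map[OF generic_torus[OF assms(1)]] by (simp add: generic_def)
    then show ?thesis using zero[of m n] by simp
  qed
  then show ?thesis
    using mono_map_torus[OF generic_torus[OF assms(1)]] by (simp add: generic_def)
qed

text \<open>For fixed \<open>m \<noteq> 0\<close> and \<open>d\<close> the equation has at most one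
  positive solution \<open>r\<close>, and there are only countably many pairs
  \<open>(m, d)\<close>.\<close>

lemma countable_bad_moduli:
  fixes D :: "real set"
  assumes "countable D"
  shows "countable {r. r > 0 \<and> (\<exists>m :: int. m \<noteq> 0 \<and> (\<exists>d\<in>D. r powi m * d = 1))}" (is "countable ?B")
proof -
  have "?B \<subseteq> (\<lambda>(m, d). (1 / d) powr (1 / real_of_int m)) ` (UNIV \<times> D)"
  proof
    fix r assume "r \<in> ?B"
    then obtain m d where md: "r > 0" "m \<noteq> 0" "d \<in> D" "r powi m * d = 1" by blast
    then have "d \<noteq> 0" by auto
    with md have "1 / d = r powr of_int m"
      by (simp add: powr_real_of_int' nonzero_divide_eq_eq)
    then have "(1 / d) powr (1 / real_of_int m) = r"
      using md by (simp add: powr_powr)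
    with md show "r \<in> (\<lambda>(m, d). (1 / d) powr (1 / real_of_int m)) ` (UNIV \<times> D)" by force
  qed
  moreover have "countable ((\<lambda>(m, d). (1 / d) powr (1 / real_of_int m)) ` (UNIV \<times> D))"
    using assms by (intro countable_image countable_SIGMA) auto
  ultimately show ?thesis by (rule countable_subset)
qed

text \<open>A small radial move inside \<open>A\<close> sweeps out a whole interval of moduli, which
  is uncountable.\<close>

lemma open_avoid_moduli:
  assumes A: "open A" "z \<in> A" "z \<noteq> 0" and N: "countable N"
  obtains w :: complex where "w \<in> A" "w \<noteq> 0" "norm w \<notin> N"
proof -
  obtain e where e: "e > 0" "ball z e \<subseteq> A" using A(1,2) by (rule openE)
  define \<delta> where "\<delta> = e / norm z"
  define f where "f t = norm z * (1 + t)" for t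
  have "inj_on f {0<..<\<delta>}" using A(3) by (auto simp: f_def inj_on_def)
  then have "uncountable (f ` {0<..<\<delta>})"
    using e(1) A(3) uncountable_open_interval[of 0 \<delta>] by (auto simp: \<delta>_def dest: countable_image_inj_on)
  then have "\<not> f ` {0<..<\<delta>} \<subseteq> N" using N countable_subset by blast
  then obtain t where t: "0 < t" "t < \<delta>" "f t \<notin> N" by (metis greaterThanLessThan_iff image_subsetI)
  define w where "w = z * of_real (1 + t)"
  have "dist z w = norm z * t"
    using t by (simp add: w_def dist_norm algebra_simps norm_mult)
  also have "\<dots> < e" using t A(3) by (simp add: \<delta>_def field_simps)
  finally have "w \<in> A" using e(2) by auto
  moreover have "norm w = f t"
    unfolding w_def f_def norm_mult norm_of_real using t by simp
  moreover have "of_real (1 + t) \<noteq> (0 :: complex)" using t unfolding of_real_eq_0_iff by linarith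
  then have "w \<noteq> 0" using A(3) by (simp add: w_def)
  ultimately show thesis using that t by metis
qed

text \<open>The coordinates are perturbed in the order s, p, Q. Each modulus must avoid the
  countably many values that would satisfy a relation with the moduli already chosen, so a relation
  is refuted by reading off k, then m, then n as zero.\<close>

lemma generic_dense: "torus \<subseteq> closure generic"
proof
  fix x :: point assume x: "x \<in> torus"
  obtain Q p s where xeq: "x = (Q, p, s)" by (cases x)
  have nz: "Q \<noteq> 0" "p \<noteq> 0" "s \<noteq> 0" using x by (auto simp: xeq torus_def)
  show "x \<in> closure generic"
    unfolding closure_iff_nhds_not_empty
  proof (intro allI impI)
    fix A S assume S: "S \<subseteq> A" "open S" "x \<in> S"
    then obtain U V where UV: "open U" "open V" "Q \<in> U" "(p, s) \<in> V" "U \<times> V \<subseteq> S"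
      by (auto simp: xeq elim: open_prod_elim)
    then obtain W T where WT: "open W" "open T" "p \<in> W" "s \<in> T" "W \<times> T \<subseteq> V"
      by (auto elim: open_prod_elim)
    define bad where "bad D = {r. r > 0 \<and> (\<exists>m :: int. m \<noteq> 0 \<and> (\<exists>d\<in>D. r powi m * d = 1))}"
      for D :: "real set"
    have bad: "countable D \<Longrightarrow> countable (bad D)" for D
      unfolding bad_def by (rule countable_bad_moduli)
    have avoid: "r powi m * d \<noteq> 1" if "r \<notin> bad D" "r > 0" "d \<in> D" "m \<noteq> 0" for r m d D
      using that by (auto simp: bad_def)
    obtain s' where s': "s' \<in> T" "s' \<noteq> 0" "norm s' \<notin> bad {1}"
      by (rule open_avoid_moduli[OF WT(2,4) nz(3) bad[of "{1}"]]) auto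
    define Ds where "Ds = range (\<lambda>n. norm s' powi n)"
    obtain p' where p': "p' \<in> W" "p' \<noteq> 0" "norm p' \<notin> bad Ds"
      by (rule open_avoid_moduli[OF WT(1,3) nz(2) bad[of Ds]]) (auto simp: Ds_def)
    define Dp where "Dp = range (\<lambda>(m, n). norm p' powi m * norm s' powi n)"
    obtain Q' where Q': "Q' \<in> U" "Q' \<noteq> 0" "norm Q' \<notin> bad Dp"
      by (rule open_avoid_moduli[OF UV(1,3) nz(1) bad[of Dp]]) (auto simp: Dp_def)
    have "(Q', p', s') \<in> generic"
    proof -
      have "k = 0 \<and> m = 0 \<and> n = 0"
        if eq: "norm Q' powi k * norm p' powi m * norm s' powi n = 1" for k m n
      proof -
        have "norm p' powi m * norm s' powi n \<in> Dp" by (auto simp: Dp_def)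
        with avoid[OF Q'(3), of "norm p' powi m * norm s' powi n" k] eq Q'(2)
        have k: "k = 0" by (auto simp: mult.assoc)
        with avoid[OF p'(3), of "norm s' powi n" m] eq p'(2)
        have m: "m = 0" by (auto simp: Ds_def)
        with k avoid[OF s'(3), of 1 n] eq s'(2) show ?thesis by auto
      qed
      then show ?thesis
        using s' p' Q' by (auto simp: generic_def torus_def mon_def norm_mult norm_power_int)
    qed
    moreover have "(Q', p', s') \<in> S" using s' p' Q' UV WT by blast
    ultimately show "generic \<inter> A \<noteq> {}" using S by blast
  qed
qed

text \<open>Membership of all generic points in one common domain makes sums, products and quotients of
  regular functions regular again; a regular function is determined by its generic values.\<close>

definition regular :: "(point \<Rightarrow> complex) \<Rightarrow> bool" where
  "regular f \<longleftrightarrow> (\<exists>U. open U \<and> generic \<subseteq> U \<and> U \<subseteq> torus \<and> holo_on f U)"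

lemma open_dense_generic: "open U \<Longrightarrow> generic \<subseteq> U \<Longrightarrow> U \<subseteq> torus \<Longrightarrow> open_dense U"
  using generic_dense closure_mono[of generic U] by (auto simp: open_dense_def)

lemma regularE:
  assumes "regular f"
  obtains U where "open U" "generic \<subseteq> U" "U \<subseteq> torus" "holo_on f U" "open_dense U"
    "hrel (U, f) (U, f)" "germ f = abs_hfun (U, f)"
  using assms open_dense_generic germ_eq hrel_refl_iff by (metis regular_def)

lemma regular_torus: "holo_on f torus \<Longrightarrow> regular f"
  unfolding regular_def using open_torus generic_torus by blast

lemma regular_const: "regular (\<lambda>_. c)"
  by (intro regular_torus holo_on_const)

lemma regular_binop:
  assumes "regular f" "regular g"
    and "\<And>U. holo_on f U \<Longrightarrow> holo_on g U \<Longrightarrow> holo_on (\<lambda>x. F (f x) (g x)) U"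
  shows "regular (\<lambda>x. F (f x) (g x))"
proof -
  obtain U V where "open U" "generic \<subseteq> U" "U \<subseteq> torus" "holo_on f U"
    "open V" "generic \<subseteq> V" "V \<subseteq> torus" "holo_on g V" using assms(1,2) by (auto simp: regular_def)
  then show ?thesis
    unfolding regular_def
    by (intro exI[of _ "U \<inter> V"]) (auto intro!: assms(3) intro: holo_on_subset)
qed

lemma regular_diff: "regular f \<Longrightarrow> regular g \<Longrightarrow> regular (\<lambda>x. f x - g x)"
  using regular_binop[where F = "(-)"] holo_on_diff by blast

lemma regular_mult: "regular f \<Longrightarrow> regular g \<Longrightarrow> regular (\<lambda>x. f x * g x)"
  using regular_binop[where F = "(*)"] holo_on_mult by blast

lemma regular_uminus: "regular f \<Longrightarrow> regular (\<lambda>x. - f x)"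
  using regular_diff[OF regular_const[of 0]] by simp

lemma regular_power: "regular f \<Longrightarrow> regular (\<lambda>x. f x ^ n)"
  by (induction n) (auto intro: regular_const regular_mult)

lemma regular_powi:
  assumes "regular f" "\<And>x. x \<in> generic \<Longrightarrow> f x \<noteq> 0"
  shows "regular (\<lambda>x. f x powi n)"
proof -
  obtain U where U: "open U" "generic \<subseteq> U" "U \<subseteq> torus" "holo_on f U"
    using assms(1) by (auto simp: regular_def)
  have "open (U \<inter> f -` (- {0}))"
    using holo_on_imp_continuous_on[OF U(4)] U(1) by (rule continuous_open_preimage) auto
  moreover have "holo_on (\<lambda>x. f x powi n) (U \<inter> f -` (- {0}))"
    by (rule holo_on_powi) (auto intro: holo_on_subset[OF U(4)])
  ultimately show ?thesis
    unfolding regular_def using U assms(2) by (intro exI[of _ "U \<inter> f -` (- {0})"]) auto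
qed

lemma regular_divide:
  assumes "regular f" "regular g" "\<And>x. x \<in> generic \<Longrightarrow> g x \<noteq> 0"
  shows "regular (\<lambda>x. f x / g x)"
  using regular_mult[OF assms(1) regular_powi[OF assms(2,3), of "-1"]]
  by (simp add: divide_inverse power_int_minus)

lemma regular_prod: "(\<And>i. i \<in> A \<Longrightarrow> regular (f i)) \<Longrightarrow> regular (\<lambda>x. \<Prod>i\<in>A. f i x)"
  by (induction A rule: infinite_finite_induct) (auto intro: regular_const regular_mult)

lemma regular_mono_map:
  assumes "regular f" "a * d - b * c = 1"
  shows "regular (\<lambda>x. f (mono_map a b c d x))"
proof -
  obtain U where U: "open U" "generic \<subseteq> U" "holo_on f U" "open_dense U"
    using assms(1) by (rule regularE)
  have "open (mono_map a b c d -` U \<inter> torus)"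
    using open_dense_mono_map[OF U(4) assms(2)] by (auto simp: open_dense_def)
  then show ?thesis
    unfolding regular_def using U(2) assms(2)
    by (intro exI[of _ "mono_map a b c d -` U \<inter> torus"])
      (auto intro: holo_on_mono_map U(3) mono_map_generic generic_torus)
qed

section \<open>Ring operations, equality and substitutions for classes of regular functions\<close>

lemma germ_add:
  assumes "regular f" "regular g"
  shows "germ f + germ g = germ (\<lambda>x. f x + g x)"
proof -
  obtain U where U: "open_dense U" "holo_on f U" "hrel (U, f) (U, f)" "germ f = abs_hfun (U, f)"
    using assms(1) by (rule regularE)
  obtain V where V: "open_dense V" "holo_on g V" "hrel (V, g) (V, g)" "germ g = abs_hfun (V, g)"
    using assms(2) by (rule regularE)
  show ?thesis
    unfolding U(4) V(4) plus_hfun.abs_eq[OF U(3) V(3)] prod.case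
    by (rule germ_eq[symmetric])
      (use U V in \<open>auto intro!: open_dense_Int holo_on_add intro: holo_on_subset\<close>)
qed

lemma germ_mult:
  assumes "regular f" "regular g"
  shows "germ f * germ g = germ (\<lambda>x. f x * g x)"
proof -
  obtain U where U: "open_dense U" "holo_on f U" "hrel (U, f) (U, f)" "germ f = abs_hfun (U, f)"
    using assms(1) by (rule regularE)
  obtain V where V: "open_dense V" "holo_on g V" "hrel (V, g) (V, g)" "germ g = abs_hfun (V, g)"
    using assms(2) by (rule regularE)
  show ?thesis
    unfolding U(4) V(4) times_hfun.abs_eq[OF U(3) V(3)] prod.case
    by (rule germ_eq[symmetric])
      (use U V in \<open>auto intro!: open_dense_Int holo_on_mult intro: holo_on_subset\<close>)
qed

lemma germ_const_1: "germ (\<lambda>_. 1) = 1"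
  unfolding one_hfun_def by (rule germ_eq[OF open_dense_torus holo_on_const])

text \<open>On a common open domain the set where the functions differ is open and misses the dense
  set \<open>generic\<close>, hence is empty.\<close>

lemma germ_cong:
  assumes "regular f" "regular g" and eq: "\<And>x. x \<in> generic \<Longrightarrow> f x = g x"
  shows "germ f = germ g"
proof -
  obtain U where U: "open U" "generic \<subseteq> U" "U \<subseteq> torus" "holo_on f U"
    using assms(1) by (auto simp: regular_def)
  obtain V where V: "open V" "generic \<subseteq> V" "V \<subseteq> torus" "holo_on g V"
    using assms(2) by (auto simp: regular_def)
  define W where "W = U \<inter> V"
  have W: "open W" "generic \<subseteq> W" "W \<subseteq> torus" "holo_on f W" "holo_on g W"
    using U V by (auto simp: W_def intro: holo_on_subset)
  define N where "N = W \<inter> (\<lambda>x. f x - g x) -` (- {0})"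
  have "open N"
    unfolding N_def using holo_on_imp_continuous_on[OF holo_on_diff[OF W(4,5)]] W(1)
    by (rule continuous_open_preimage) auto
  moreover have "N \<inter> generic = {}" using eq by (auto simp: N_def)
  ultimately have "N \<inter> closure generic = {}" by (simp add: open_Int_closure_eq_empty)
  then have "N = {}" using W(3) generic_dense by (auto simp: N_def)
  then have fg: "f x = g x" if "x \<in> W" for x using that by (auto simp: N_def)
  have dense: "open_dense W" using W by (intro open_dense_generic)
  have "hrel (W, f) (W, g)" using dense W fg by auto
  then show ?thesis
    using germ_eq[OF dense W(4)] germ_eq[OF dense W(5)] Quotient3_rel_abs[OF Quotient3_hfun] by metis
qed

lemma delta_hat_germ:
  assumes "regular f" "a * d - b * c = 1"
  shows "delta_hat a b c d (germ f) = germ (\<lambda>x. f (mono_map a b c d x))"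
proof -
  obtain U where U: "open_dense U" "holo_on f U" "hrel (U, f) (U, f)" "germ f = abs_hfun (U, f)"
    using assms(1) by (rule regularE)
  have "delta_hat a b c d (germ f) =
      abs_hfun (mono_map a b c d -` U \<inter> torus, \<lambda>x. f (mono_map a b c d x))"
    unfolding U(4) delta_hat.abs_eq[OF U(3)] using assms(2) by simp
  also have "\<dots> = germ (\<lambda>x. f (mono_map a b c d x))"
    using U assms(2) by (intro germ_eq[symmetric] open_dense_mono_map holo_on_mono_map)
  finally show ?thesis .
qed

lemma hfun_cases:
  obtains U f where "x = abs_hfun (U, f)" "open_dense U" "holo_on f U" "hrel (U, f) (U, f)"
  using Quotient_abs_rep[OF Quotient_hfun, of x] Quotient_rep_reflp[OF Quotient_hfun, of x]
    hrel_refl_iff by (metis surj_pair)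

text \<open>Pullback reverses composition: the resulting exponent matrix is the primed matrix times
  the unprimed one.\<close>

lemma delta_hat_comp:
  assumes "a * d - b * c = 1" "a' * d' - b' * c' = 1"
  shows "delta_hat a b c d (delta_hat a' b' c' d' x) =
    delta_hat (a' * a + b' * c) (a' * b + b' * d) (c' * a + d' * c) (c' * b + d' * d) x"
    (is "_ = delta_hat ?A ?B ?C ?D x")
proof -
  obtain U f where x: "x = abs_hfun (U, f)" "open_dense U" "holo_on f U" "hrel (U, f) (U, f)"
    by (rule hfun_cases)
  have det: "?A * ?D - ?B * ?C = 1"
  proof -
    have "?A * ?D - ?B * ?C = (a * d - b * c) * (a' * d' - b' * c')" by (simp add: algebra_simps)
    then show ?thesis using assms by simp
  qed
  define V where "V = mono_map a' b' c' d' -` U \<inter> torus"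
  define W where "W = mono_map a b c d -` V \<inter> torus"
  define W' where "W' = mono_map ?A ?B ?C ?D -` U \<inter> torus"
  have comp: "mono_map a' b' c' d' (mono_map a b c d y) = mono_map ?A ?B ?C ?D y" if "y \<in> torus" for y
    using mono_map_comp[OF that] by simp
  have V: "open_dense V" "holo_on (\<lambda>y. f (mono_map a' b' c' d' y)) V"
    using x assms(2) unfolding V_def by (auto intro: open_dense_mono_map holo_on_mono_map)
  have W: "open_dense W" "holo_on (\<lambda>y. f (mono_map a' b' c' d' (mono_map a b c d y))) W"
    using open_dense_mono_map[OF V(1) assms(1)] holo_on_mono_map[OF V(2)] by (auto simp: W_def)
  have W': "open_dense W'" "holo_on (\<lambda>y. f (mono_map ?A ?B ?C ?D y)) W'"
    using open_dense_mono_map[OF x(2) det] holo_on_mono_map[OF x(3)] unfolding W'_def by blast+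
  have "delta_hat a' b' c' d' x = abs_hfun (V, \<lambda>y. f (mono_map a' b' c' d' y))"
    unfolding x(1) delta_hat.abs_eq[OF x(4)] V_def using assms(2) by simp
  then have "delta_hat a b c d (delta_hat a' b' c' d' x) =
      abs_hfun (W, \<lambda>y. f (mono_map a' b' c' d' (mono_map a b c d y)))"
    using delta_hat.abs_eq[of "(V, \<lambda>y. f (mono_map a' b' c' d' y))" a b c d] V hrel_refl_iff assms(1)
    by (simp add: W_def del: hrel.simps)
  moreover have "delta_hat ?A ?B ?C ?D x = abs_hfun (W', \<lambda>y. f (mono_map ?A ?B ?C ?D y))"
    unfolding x(1) delta_hat.abs_eq[OF x(4)] W'_def using det by simp
  moreover have "hrel (W, \<lambda>y. f (mono_map a' b' c' d' (mono_map a b c d y)))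
      (W', \<lambda>y. f (mono_map ?A ?B ?C ?D y))"
    by (rule hrel_eqI[OF W(1) W'(1) W(2) W'(2)]) (auto simp: W_def comp)
  ultimately show ?thesis using Quotient3_rel_abs[OF Quotient3_hfun] by metis
qed

lemma delta_hat_id: "delta_hat 1 0 0 1 x = x"
proof -
  obtain U f where x: "x = abs_hfun (U, f)" "open_dense U" "holo_on f U" "hrel (U, f) (U, f)"
    by (rule hfun_cases)
  have "mono_map 1 0 0 1 -` U \<inter> torus = U"
    using x(2) by (auto simp: open_dense_def mono_map_id)
  then show ?thesis
    unfolding x(1) delta_hat.abs_eq[OF x(4)] by (simp add: mono_map_id)
qed

lemma delta_hat_uminus: "delta_hat a b c d (- x) = - delta_hat a b c d x"
proof -
  have 0: "delta_hat a b c d 0 = 0"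
    using delta_hat_ring_hom(1)[of a b c d 0 0] by simp
  have "delta_hat a b c d (- x) + delta_hat a b c d x = 0"
    using delta_hat_ring_hom(1)[of a b c d "- x" x, symmetric] 0 by simp
  then show ?thesis by (simp add: eq_neg_iff_add_eq_0)
qed

section \<open>Plethystic exponents at generic points\<close>

definition mpoch_at :: "int \<Rightarrow> int \<Rightarrow> int \<Rightarrow> (int \<times> int) list \<Rightarrow> point \<Rightarrow> complex" where
  "mpoch_at k m n ab x = mpoch (mon k m n x) (map (\<lambda>(a, b). mon 0 a b x) ab)"

text \<open>Here the exclusion of degree 0 in Q is used. The parameters generate monomials free of
  Q, so the number subtracted from 1 in any factor is a monomial of Q-degree
  \<open>k \<noteq> 0\<close>, whose modulus is not 1 at a generic point.\<close>

lemma mpoch_at_nonzero: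
  assumes x: "x \<in> generic" and "k \<noteq> 0" "(0, 0) \<notin> set ab"
  shows "mpoch_at k m n ab x \<noteq> 0"
  unfolding mpoch_at_def
proof (rule mpoch_nonzero)
  let ?G = "range (\<lambda>(a, b). mon 0 a b x)"
  have xt: "x \<in> torus" using x by (rule generic_torus)
  show "1 \<in> ?G" using mon_0[of x] by (metis (mono_tags, lifting) case_prod_conv rangeI)
  show "g * h \<in> ?G" if "g \<in> ?G" "h \<in> ?G" for g h
  proof -
    from that obtain a b a' b' where "g = mon 0 a b x" "h = mon 0 a' b' x" by auto
    then show ?thesis using mon_mult[OF xt, of 0 a b 0 a' b'] by (auto intro!: image_eqI[of _ _ "(a + a', b + b')"])
  qed
  show "inverse g \<in> ?G" if "g \<in> ?G" for g
  proof -
    from that obtain a b where "g = mon 0 a b x" by auto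
    then show ?thesis using mon_inverse[OF xt, of 0 a b] by (auto intro!: image_eqI[of _ _ "(- a, - b)"])
  qed
  show "set (map (\<lambda>(a, b). mon 0 a b x) ab) \<subseteq> ?G" by auto
  show "norm p \<noteq> 1" if "p \<in> set (map (\<lambda>(a, b). mon 0 a b x) ab)" for p
  proof -
    from that obtain a b where ab: "(a, b) \<in> set ab" "p = mon 0 a b x" by auto
    then have "(0, a, b) \<noteq> (0, 0, 0)" using assms(3) by auto
    then show ?thesis unfolding ab(2) by (rule norm_mon_generic[OF x])
  qed
  show "mon k m n x * g \<noteq> 1" if "g \<in> ?G" for g
  proof -
    from that obtain a b where "g = mon 0 a b x" by auto
    then have "norm (mon k m n x * g) \<noteq> 1"
      using mon_mult[OF xt, of k m n 0 a b] norm_mon_generic[OF x, of k] assms(2) by auto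
    then show ?thesis by auto
  qed
qed

lemma regular_mpoch_at:
  assumes "k \<noteq> 0" "(0, 0) \<notin> set ab"
  shows "regular (mpoch_at k m n ab)"
proof -
  define Ps where "Ps = map (\<lambda>(a, b). mon 0 a b) ab"
  have map: "map (\<lambda>P. P x) Ps = map (\<lambda>(a, b). mon 0 a b x) ab" for x
    by (auto simp: Ps_def)
  define U where "U = torus \<inter> (\<Inter>P\<in>set Ps. torus \<inter> P -` (- sphere 0 1))"
  have hol: "holo_on P torus" if "P \<in> set Ps" for P
    using that holo_on_mon by (auto simp: Ps_def)
  have U: "open U"
    unfolding U_def using hol
    by (intro open_Int open_torus open_INT ballI continuous_open_preimage holo_on_imp_continuous_on)
      (auto intro: open_Compl)
  have UT: "U \<subseteq> torus" by (auto simp: U_def)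
  have nz: "P x \<noteq> 0 \<and> norm (P x) \<noteq> 1" if "P \<in> set Ps" "x \<in> U" for P x
  proof
    from that obtain a b where "P = mon 0 a b" "x \<in> torus" using UT by (auto simp: Ps_def)
    then show "P x \<noteq> 0" by (simp add: mon_nonzero)
    have "P x \<in> - sphere 0 1" using that unfolding U_def by blast
    then show "norm (P x) \<noteq> 1" by simp
  qed
  have "holo_on (mon k m n) U" "\<And>P. P \<in> set Ps \<Longrightarrow> holo_on P U"
    using holo_on_mon hol UT holo_on_subset by blast+
  note N = holo_on_mpoch[of U "mon k m n" Ps, unfolded map, folded mpoch_at_def]
  have N: "open {x \<in> U. mpoch_at k m n ab x \<noteq> 0}" "holo_on (mpoch_at k m n ab) {x \<in> U. mpoch_at k m n ab x \<noteq> 0}"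
    by (rule N; fact)+
  have "norm (P x) \<noteq> 1" if "P \<in> set Ps" "x \<in> generic" for P x
  proof -
    from that obtain a b where ab: "(a, b) \<in> set ab" "P = mon 0 a b" by (auto simp: Ps_def)
    then have "(0, a, b) \<noteq> (0, 0, 0)" using assms(2) by auto
    then show ?thesis unfolding ab(2) by (rule norm_mon_generic[OF that(2)])
  qed
  then have "generic \<subseteq> U" using generic_torus by (auto simp: U_def)
  then have "generic \<subseteq> {x \<in> U. mpoch_at k m n ab x \<noteq> 0}" using mpoch_at_nonzero assms by blast
  then show ?thesis
    unfolding regular_def using N UT by (intro exI[of _ "{x \<in> U. mpoch_at k m n ab x \<noteq> 0}"]) auto
qed

lemma mpoch_at_mono_map:
  assumes "x \<in> torus"
  shows "mpoch_at k m n ab (mono_map a b c d x) =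
    mpoch_at k (a * m + c * n) (b * m + d * n) (map (\<lambda>(u, v). (a * u + c * v, b * u + d * v)) ab) x"
  unfolding mpoch_at_def mon_mono_map[OF assms] by (simp add: case_prod_unfold o_def mon_mono_map[OF assms])

context
  fixes x assumes x: "x \<in> generic"
begin

lemmas xt = generic_torus[OF x]

lemma norm_mon0: "(a, b) \<noteq> (0, 0) \<Longrightarrow> norm (mon 0 a b x) \<noteq> 1"
  using norm_mon_generic[OF x] by simp

lemma mpoch_at_uminus_Cons:
  assumes "(a, b) \<noteq> (0, 0)"
  shows "mpoch_at k m n ((- a, - b) # ab) x = 1 / mpoch_at k (m + a) (n + b) ((a, b) # ab) x"
  using mpoch_inverse_Cons[OF mon_nonzero[OF xt] norm_mon0[OF assms]]
  by (simp add: mpoch_at_def mon_inverse[OF xt, of 0, simplified] mon_mult[OF xt] add.commute)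

lemma mpoch_at_Cons:
  assumes "k \<noteq> 0" "(a, b) \<noteq> (0, 0)" "(0, 0) \<notin> set ab"
  shows "mpoch_at k m n ((a, b) # ab) x = mpoch_at k m n ab x * mpoch_at k (m + a) (n + b) ((a, b) # ab) x"
proof -
  have shift: "mon 0 a b x * mon k m n x = mon k (m + a) (n + b) x"
    using mon_mult[OF xt, of 0 a b k m n] by (simp add: add.commute)
  have "norm q \<noteq> 1" if "q \<in> set (map (\<lambda>(a, b). mon 0 a b x) ab)" for q
  proof -
    from that obtain u v where uv: "(u, v) \<in> set ab" "q = mon 0 u v x" by auto
    then have "(u, v) \<noteq> (0, 0)" using assms(3) by auto
    then show ?thesis unfolding uv(2) by (rule norm_mon0)
  qed
  with mpoch_at_nonzero[OF x, of k ab m n] mpoch_at_nonzero[OF x, of k "(a, b) # ab" "m + a" "n + b"] assms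
    mpoch_Cons[OF mon_nonzero[OF xt] norm_mon0[OF assms(2)],
      of "map (\<lambda>(a, b). mon 0 a b x) ab" "mon k m n x"]
  show ?thesis by (auto simp: mpoch_at_def shift)
qed

lemma mpoch_at_diagonal_split:
  assumes "k \<noteq> 0" "(a, b) \<noteq> (0, 0)" "(c, d) \<noteq> (0, 0)" "(a + c, b + d) \<noteq> (0, 0)"
  shows "mpoch_at k m n [(a, b), (c, d)] x =
    mpoch_at k m n [(c, d), (a + c, b + d)] x * mpoch_at k (m + a) (n + b) [(a, b), (a + c, b + d)] x"
proof -
  have shift: "mon 0 a b x * mon k m n x = mon k (m + a) (n + b) x"
    "mon 0 a b x * mon 0 c d x = mon 0 (a + c) (b + d) x"
    using mon_mult[OF xt, of 0 a b] by (simp_all add: add.commute)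
  have nonzero: "mpoch_at k m n [(a, b), (c, d)] x \<noteq> 0" "mpoch_at k m n [(c, d), (a + c, b + d)] x \<noteq> 0"
    "mpoch_at k (m + a) (n + b) [(a, b), (a + c, b + d)] x \<noteq> 0"
    by (rule mpoch_at_nonzero[OF x assms(1)]; use assms in auto)+
  show ?thesis
    using mpoch_diagonal_split[OF mon_nonzero[OF xt] mon_nonzero[OF xt] norm_mon0[OF assms(2)]
      norm_mon0[OF assms(3)], of "mon k m n x"] norm_mon0[OF assms(4)] nonzero
    by (simp add: mpoch_at_def shift)
qed

end

text \<open>The contribution of the monomial \<open>p\<^sup>m s\<^sup>n\<close> to a plethystic exponent whose numerator is a
  multiple of \<open>-(Q\<^sup>8 - Q\<^bsup>-8\<^esup>)\<close>.\<close>

definition mpoch_quot :: "int \<Rightarrow> int \<Rightarrow> (int \<times> int) list \<Rightarrow> point \<Rightarrow> complex" where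
  "mpoch_quot m n ab x = mpoch_at (- 8) m n ab x / mpoch_at 8 m n ab x"

text \<open>Multiplicative counterpart of the fraction p^m s^n / prod (1 - p^a s^b): each relation
  between these classes corresponds to an additive identity of such fractions.\<close>

definition kappa :: "int \<Rightarrow> int \<Rightarrow> (int \<times> int) list \<Rightarrow> hfun" where
  "kappa m n ab = germ (mpoch_quot m n ab)"

lemma regular_mpoch_quot: "(0, 0) \<notin> set ab \<Longrightarrow> regular (mpoch_quot m n ab)"
  unfolding mpoch_quot_def by (intro regular_divide regular_mpoch_at mpoch_at_nonzero) auto

lemma kappa_swap: "kappa m n [u, v] = kappa m n [v, u]"
  by (simp add: kappa_def mpoch_quot_def[abs_def] mpoch_at_def mpoch_swap)

lemma kappa_mult_eq_1I:
  assumes "(0, 0) \<notin> set ab" "(0, 0) \<notin> set ab'" "\<And>x. x \<in> generic \<Longrightarrow> mpoch_quot m n ab x * mpoch_quot m' n' ab' x = 1"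
  shows "kappa m n ab * kappa m' n' ab' = 1"
  unfolding kappa_def germ_mult[OF regular_mpoch_quot regular_mpoch_quot, OF assms(1,2)] germ_const_1[symmetric]
  by (intro germ_cong regular_mult regular_mpoch_quot regular_const assms)

lemma kappa_eq_multI:
  assumes "(0, 0) \<notin> set ab" "(0, 0) \<notin> set ab'" "(0, 0) \<notin> set ab''"
    and "\<And>x. x \<in> generic \<Longrightarrow> mpoch_quot m n ab x = mpoch_quot m' n' ab' x * mpoch_quot m'' n'' ab'' x"
  shows "kappa m n ab = kappa m' n' ab' * kappa m'' n'' ab''"
  unfolding kappa_def germ_mult[OF regular_mpoch_quot regular_mpoch_quot, OF assms(2,3)]
  by (intro germ_cong regular_mult regular_mpoch_quot assms)

text \<open>With t = p^a s^b the fraction identity is 1/(1 - 1/t) = -t/(1 - t).\<close>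

lemma kappa_uminus_Cons:
  assumes "(a, b) \<noteq> (0, 0)" "(0, 0) \<notin> set ab"
  shows "kappa m n ((- a, - b) # ab) * kappa (m + a) (n + b) ((a, b) # ab) = 1"
proof (rule kappa_mult_eq_1I)
  fix x assume x: "x \<in> generic"
  have "mpoch_at k (m + a) (n + b) ((a, b) # ab) x \<noteq> 0" if "k \<noteq> 0" for k
    using assms that by (intro mpoch_at_nonzero[OF x]) auto
  then show "mpoch_quot m n ((- a, - b) # ab) x * mpoch_quot (m + a) (n + b) ((a, b) # ab) x = 1"
    by (simp add: mpoch_quot_def mpoch_at_uminus_Cons[OF x assms(1)])
qed (use assms in auto)

lemma kappa_Cons:
  assumes "(a, b) \<noteq> (0, 0)" "(0, 0) \<notin> set ab"
  shows "kappa m n ((a, b) # ab) = kappa m n ab * kappa (m + a) (n + b) ((a, b) # ab)"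
proof (rule kappa_eq_multI)
  fix x assume x: "x \<in> generic"
  show "mpoch_quot m n ((a, b) # ab) x = mpoch_quot m n ab x * mpoch_quot (m + a) (n + b) ((a, b) # ab) x"
    unfolding mpoch_quot_def
    by (subst mpoch_at_Cons[OF x _ assms, of "- 8"], simp, subst mpoch_at_Cons[OF x _ assms, of 8], simp, simp)
qed (use assms in auto)

lemma kappa_diagonal_split:
  assumes "(a, b) \<noteq> (0, 0)" "(c, d) \<noteq> (0, 0)" "(a + c, b + d) \<noteq> (0, 0)"
  shows "kappa m n [(a, b), (c, d)] =
    kappa m n [(c, d), (a + c, b + d)] * kappa (m + a) (n + b) [(a, b), (a + c, b + d)]"
proof (rule kappa_eq_multI)
  fix x assume x: "x \<in> generic"
  show "mpoch_quot m n [(a, b), (c, d)] x =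
      mpoch_quot m n [(c, d), (a + c, b + d)] x * mpoch_quot (m + a) (n + b) [(a, b), (a + c, b + d)] x"
    unfolding mpoch_quot_def using assms by (simp add: mpoch_at_diagonal_split[OF x])
qed (use assms in auto)

lemma delta_hat_kappa:
  assumes "a * d - b * c = 1" "(0, 0) \<notin> set ab"
  shows "delta_hat a b c d (kappa m n ab) =
    kappa (a * m + c * n) (b * m + d * n) (map (\<lambda>(u, v). (a * u + c * v, b * u + d * v)) ab)"
    (is "_ = kappa ?m ?n ?ab")
proof -
  have zero: "(u, v) = (0, 0)" if "a * u + c * v = 0" "b * u + d * v = 0" for u v
  proof -
    have "u = d * (a * u + c * v) - c * (b * u + d * v)" "v = a * (b * u + d * v) - b * (a * u + c * v)"
      using arg_cong[OF assms(1), of "\<lambda>t. t * u"] arg_cong[OF assms(1), of "\<lambda>t. t * v"]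
      by (simp_all add: algebra_simps)
    then show ?thesis unfolding that by simp
  qed
  have nz: "(0, 0) \<notin> set ?ab"
  proof
    assume "(0, 0) \<in> set ?ab"
    then obtain u v where uv: "(u, v) \<in> set ab" "0 = a * u + c * v" "0 = b * u + d * v" by auto
    from zero[OF uv(2,3)[symmetric]] uv(1) assms(2) show False by simp
  qed
  show ?thesis
    unfolding kappa_def delta_hat_germ[OF regular_mpoch_quot[OF assms(2)] assms(1)]
    by (intro germ_cong regular_mono_map regular_mpoch_quot assms nz)
      (simp add: mpoch_quot_def mpoch_at_mono_map generic_torus)
qed

text \<open>Indices outside the support have exponent 0 and contribute 1. A convenient superset
  therefore replaces the exact support of an expanded numerator.\<close>

lemma pexp_eq_germ:
  assumes "finite S" "Poly_Mapping.keys \<mu> \<subseteq> S"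
  shows "pexp \<mu> ab = germ (\<lambda>x. \<Prod>(k, m, n)\<in>S. mpoch_at k m n ab x powi Poly_Mapping.lookup \<mu> (k, m, n))"
proof -
  have "pexp \<mu> ab = germ (\<lambda>x. \<Prod>(k, m, n)\<in>Poly_Mapping.keys \<mu>.
      mpoch_at k m n ab x powi Poly_Mapping.lookup \<mu> (k, m, n))"
    unfolding pexp_def by (intro arg_cong[of _ _ germ] ext) (simp add: case_prod_unfold mpoch_at_def mon_def)
  also have "\<dots> = germ (\<lambda>x. \<Prod>(k, m, n)\<in>S. mpoch_at k m n ab x powi Poly_Mapping.lookup \<mu> (k, m, n))"
    by (intro arg_cong[of _ _ germ] ext prod.mono_neutral_left assms)
      (auto simp: in_keys_iff)
  finally show ?thesis .
qed

lemma monom3_mult: "monom3 i j k * monom3 i' j' k' = monom3 (i + i') (j + j') (k + k')"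
  by (simp add: monom3_def mult_single)

lemma lookup_monom3: "Poly_Mapping.lookup (monom3 i j k) t = (if t = (i, j, k) then 1 else 0)"
  by (auto simp: monom3_def lookup_single when_def)

abbreviation "den \<equiv> [(0, 2), (2, - 2)] :: (int \<times> int) list"

text \<open>Each monomial of the second factor occurs once with Q^-8 and once, with opposite sign,
  with Q^8, and such a pair is one \<open>mpoch_quot\<close>. Distinctness keeps the coefficients 1,
  2, 1 from merging.\<close>

lemma pexp_three_terms:
  fixes m1 n1 m2 n2 m3 n3 :: int
  assumes \<mu>: "\<mu> = - (monom3 8 0 0 - monom3 (- 8) 0 0) * (monom3 0 m1 n1 + 2 * monom3 0 m2 n2 + monom3 0 m3 n3)"
    and "distinct [(m1, n1), (m2, n2), (m3, n3)]" and ab: "(0, 0) \<notin> set ab"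
  shows "pexp \<mu> ab = kappa m1 n1 ab * kappa m2 n2 ab ^ 2 * kappa m3 n3 ab"
proof -
  define S :: "(int \<times> int \<times> int) set" where "S = {(8, m1, n1), (8, m2, n2), (8, m3, n3), (- 8, m1, n1), (- 8, m2, n2), (- 8, m3, n3)}"
  have \<mu>': "\<mu> = - monom3 8 m1 n1 - monom3 8 m2 n2 - monom3 8 m2 n2 - monom3 8 m3 n3
      + monom3 (- 8) m1 n1 + monom3 (- 8) m2 n2 + monom3 (- 8) m2 n2 + monom3 (- 8) m3 n3"
    unfolding \<mu> mult_2 by (simp add: algebra_simps monom3_mult)
  define e where "e i j k t = (if t = (i, j, k) then 1 else 0 :: int)" for i j k :: int and t
  have lk: "Poly_Mapping.lookup \<mu> t = e (- 8) m1 n1 t + 2 * e (- 8) m2 n2 t + e (- 8) m3 n3 t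
      - e 8 m1 n1 t - 2 * e 8 m2 n2 t - e 8 m3 n3 t" for t
    unfolding \<mu>' lookup_add lookup_minus lookup_uminus lookup_monom3 e_def by simp
  have keys: "Poly_Mapping.keys \<mu> \<subseteq> S"
  proof (rule subsetI, rule ccontr)
    fix t assume "t \<in> Poly_Mapping.keys \<mu>" "t \<notin> S"
    then show False
      by (simp add: in_keys_iff lk S_def e_def)
  qed
  have "pexp \<mu> ab = germ (\<lambda>x. \<Prod>(k, m, n)\<in>S. mpoch_at k m n ab x powi Poly_Mapping.lookup \<mu> (k, m, n))"
    by (rule pexp_eq_germ[OF _ keys]) (simp add: S_def)
  also have "\<dots> = germ (\<lambda>x. mpoch_quot m1 n1 ab x * (mpoch_quot m2 n2 ab x * mpoch_quot m2 n2 ab x) * mpoch_quot m3 n3 ab x)"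
  proof (rule germ_cong)
    show "regular (\<lambda>x. \<Prod>(k, m, n)\<in>S. mpoch_at k m n ab x powi Poly_Mapping.lookup \<mu> (k, m, n))"
      unfolding case_prod_unfold
      by (intro regular_prod regular_powi regular_mpoch_at mpoch_at_nonzero ab) (auto simp: S_def)
    show "regular (\<lambda>x. mpoch_quot m1 n1 ab x * (mpoch_quot m2 n2 ab x * mpoch_quot m2 n2 ab x) * mpoch_quot m3 n3 ab x)"
      by (intro regular_mult regular_mpoch_quot ab)
    fix x assume x: "x \<in> generic"
    show "(\<Prod>(k, m, n)\<in>S. mpoch_at k m n ab x powi Poly_Mapping.lookup \<mu> (k, m, n)) =
        mpoch_quot m1 n1 ab x * (mpoch_quot m2 n2 ab x * mpoch_quot m2 n2 ab x) * mpoch_quot m3 n3 ab x"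
    proof -
      have vals: "Poly_Mapping.lookup \<mu> (8, m1, n1) = - 1" "Poly_Mapping.lookup \<mu> (8, m2, n2) = - 2"
        "Poly_Mapping.lookup \<mu> (8, m3, n3) = - 1" "Poly_Mapping.lookup \<mu> (- 8, m1, n1) = 1"
        "Poly_Mapping.lookup \<mu> (- 8, m2, n2) = 2" "Poly_Mapping.lookup \<mu> (- 8, m3, n3) = 1"
        using assms(2) by (auto simp: lk e_def)
      have "S = set [(8, m1, n1), (8, m2, n2), (8, m3, n3), (- 8, m1, n1), (- 8, m2, n2), (- 8, m3, n3)]"
        (is "_ = set ?xs") by (simp add: S_def)
      moreover have "distinct ?xs" using assms(2) by auto
      ultimately show ?thesis
        by (simp only: prod.distinct_set_conv_list list.map prod.case vals)
          (simp add: mpoch_quot_def power_int_minus divide_inverse power2_eq_square mult_ac)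
    qed
  qed
  also have "\<dots> = kappa m1 n1 ab * (kappa m2 n2 ab * kappa m2 n2 ab) * kappa m3 n3 ab"
    unfolding kappa_def by (simp add: germ_mult regular_mult regular_mpoch_quot ab)
  finally show ?thesis by (simp add: power2_eq_square)
qed

lemma monom3_three_terms:
  "monom3 i j k * (monom3 i1 j1 k1 + 2 * monom3 i2 j2 k2 + monom3 i3 j3 k3) =
    monom3 (i + i1) (j + j1) (k + k1) + 2 * monom3 (i + i2) (j + j2) (k + k2)
      + monom3 (i + i3) (j + j3) (k + k3)"
  by (simp only: mult_2 distrib_left monom3_mult)

lemma one_eq_monom3: "1 = monom3 0 0 0"
  by (simp add: monom3_def zero_prod_def[symmetric])

text \<open>The numerator expands to ps + 2p^2 + p^2/s; those of \<open>beta\<close> and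
  \<open>gamma\<close> to p + 2p^2 + p^2/s and ps + 2p^2 + p.\<close>

lemma alpha_eq: "alpha = kappa 1 1 den * kappa 2 0 den ^ 2 * kappa 2 (- 1) den"
  unfolding alpha_def mult.assoc[of _ "monom3 0 1 (- 1)"] monom3_three_terms
  by (rule pexp_three_terms) auto

lemma beta_eq: "beta = kappa 1 0 den * kappa 2 0 den ^ 2 * kappa 2 (- 1) den"
  unfolding beta_def mult.assoc[of _ "monom3 0 1 (- 1)"] monom3_three_terms
  by (rule pexp_three_terms) auto

lemma gamma_eq: "gamma = kappa 1 1 den * kappa 2 0 den ^ 2 * kappa 1 0 den"
  unfolding gamma_def mult.assoc[of _ "monom3 0 1 0"] one_eq_monom3 monom3_three_terms
  by (rule pexp_three_terms) auto

section \<open>The operators\<close>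

abbreviation "dA \<equiv> delta_hat 1 1 0 1"
abbreviation "dB \<equiv> delta_hat 1 0 (- 1) 1"
text \<open>The quarter turn (p, s) -> (s, 1/p), which is the substitution part of both ABA and
  BAB.\<close>

abbreviation "dT \<equiv> delta_hat 0 1 (- 1) 0"

section \<open>Scalar identities behind the braid relation and the square of ABA\<close>

lemma mult_cancel_unit:
  fixes x :: "'a :: comm_monoid_mult"
  assumes "x = a * b" "c * a = 1"
  shows "x * c = b"
proof -
  have "x * c = (c * a) * b" unfolding assms(1) by (simp only: mult_ac)
  then show ?thesis by (simp add: assms(2))
qed

text \<open>The diagonal splitting of \<open>den\<close> with s^2 as first parameter, its factor in
  (p^2/s^2, p^2) being inverted to the denominators (s^2/p^2, p^2). The next lemma exchanges the
  roles of the two parameters, so that the monomial on the right is not shifted.\<close>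

lemma kappa_den_I1:
  "kappa m n den * kappa (m - 2) (n + 2) [(- 2, 2), (2, 0)] = kappa m (n + 2) [(0, 2), (2, 0)]"
proof (rule mult_cancel_unit)
  show "kappa m n den = kappa m n [(2, - 2), (2, 0)] * kappa m (n + 2) [(0, 2), (2, 0)]"
    using kappa_diagonal_split[of 0 2 2 "- 2" m n] by simp
  show "kappa (m - 2) (n + 2) [(- 2, 2), (2, 0)] * kappa m n [(2, - 2), (2, 0)] = 1"
    using kappa_uminus_Cons[of 2 "- 2" "[(2, 0)]" "m - 2" "n + 2"] by simp
qed

lemma kappa_den_I2:
  "kappa m n den * kappa m n [(- 2, 2), (2, 0)] = kappa m n [(0, 2), (2, 0)]"
proof (rule mult_cancel_unit)
  show "kappa m n den = kappa (m + 2) (n - 2) [(2, - 2), (2, 0)] * kappa m n [(0, 2), (2, 0)]"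
    using kappa_diagonal_split[of 2 "- 2" 0 2 m n] kappa_swap[of m n "(0, 2)" "(2, - 2)"] by (simp add: mult.commute)
  show "kappa m n [(- 2, 2), (2, 0)] * kappa (m + 2) (n - 2) [(2, - 2), (2, 0)] = 1"
    using kappa_uminus_Cons[of 2 "- 2" "[(2, 0)]" m n] by simp
qed

lemma dA_alpha: "dA alpha = kappa 1 2 [(0, 2), (2, 0)] * kappa 2 2 [(0, 2), (2, 0)] ^ 2 * kappa 2 1 [(0, 2), (2, 0)]"
  by (simp add: alpha_eq power2_eq_square delta_hat_ring_hom(2) delta_hat_kappa)

lemma dA_beta: "dA beta = kappa 1 1 [(0, 2), (2, 0)] * kappa 2 2 [(0, 2), (2, 0)] ^ 2 * kappa 2 1 [(0, 2), (2, 0)]"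
  by (simp add: beta_eq power2_eq_square delta_hat_ring_hom(2) delta_hat_kappa)

lemma dA_gamma: "dA gamma = kappa 1 2 [(0, 2), (2, 0)] * kappa 2 2 [(0, 2), (2, 0)] ^ 2 * kappa 1 1 [(0, 2), (2, 0)]"
  by (simp add: gamma_eq power2_eq_square delta_hat_ring_hom(2) delta_hat_kappa)

lemma braid_scalars:
  "dA alpha = beta * delta_hat 0 1 (- 1) 1 gamma"
  "dA beta = alpha * delta_hat 0 1 (- 1) 1 beta"
  "dA gamma = gamma * delta_hat 0 1 (- 1) 1 alpha"
proof -
  let ?L'' = "[(- 2, 2), (2, 0)] :: (int \<times> int) list"
  have "delta_hat 0 1 (- 1) 1 alpha = kappa (- 1) 2 ?L'' * kappa 0 2 ?L'' ^ 2 * kappa 1 1 ?L''"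
    "delta_hat 0 1 (- 1) 1 beta = kappa 0 1 ?L'' * kappa 0 2 ?L'' ^ 2 * kappa 1 1 ?L''"
    "delta_hat 0 1 (- 1) 1 gamma = kappa (- 1) 2 ?L'' * kappa 0 2 ?L'' ^ 2 * kappa 0 1 ?L''"
    by (simp_all add: alpha_eq beta_eq gamma_eq power2_eq_square delta_hat_ring_hom(2) delta_hat_kappa)
  note dBA = this
  \<comment> \<open>Only the monomial ps takes the unshifted variant. With this choice the factors
    over \<open>den\<close> and those over the second list regroup exactly into the numerators of
    \<open>alpha\<close>, \<open>beta\<close>, \<open>gamma\<close>.\<close>
  have split: "kappa 1 2 [(0, 2), (2, 0)] = kappa 1 0 den * kappa (- 1) 2 ?L''"
    "kappa 2 2 [(0, 2), (2, 0)] = kappa 2 0 den * kappa 0 2 ?L''"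
    "kappa 2 1 [(0, 2), (2, 0)] = kappa 2 (- 1) den * kappa 0 1 ?L''"
    "kappa 1 1 [(0, 2), (2, 0)] = kappa 1 1 den * kappa 1 1 ?L''"
    using kappa_den_I1[of 1 0] kappa_den_I1[of 2 0] kappa_den_I1[of 2 "- 1"] kappa_den_I2[of 1 1] by simp_all
  show "dA alpha = beta * delta_hat 0 1 (- 1) 1 gamma"
    "dA beta = alpha * delta_hat 0 1 (- 1) 1 beta"
    "dA gamma = gamma * delta_hat 0 1 (- 1) 1 alpha"
    unfolding dBA dA_alpha dA_beta dA_gamma split unfolding alpha_eq beta_eq gamma_eq
    by (simp_all only: power2_eq_square mult_ac)
qed

text \<open>The scalars left over in the square of the half twist: the denominators in \<open>p\<close> telescope, so
  that \<open>edge n\<close> is the inverse of a single product in powers of \<open>s\<close>.\<close>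

definition edge :: "int \<Rightarrow> hfun" where
  "edge n = kappa 2 n [(0, 2), (2, 0)] * kappa (- 2) n [(- 2, 0), (0, 2)]"

text \<open>In fractions, p^2/(1-p^2) + p^-2/(1-p^-2) = -1, so the denominator in p disappears and
  -s^n/(1-s^2) is left.\<close>

lemma edge_kappa: "edge n * kappa 0 n [(0, 2)] = 1"
proof -
  have "kappa 0 n [(2, 0), (0, 2)] = kappa 0 n [(0, 2)] * kappa 2 n [(0, 2), (2, 0)]"
    using kappa_Cons[of 2 0 "[(0, 2)]" 0 n] kappa_swap[of 2 n "(0, 2)" "(2, 0)"] by simp
  moreover have "kappa (- 2) n [(- 2, 0), (0, 2)] * kappa 0 n [(2, 0), (0, 2)] = 1"
    using kappa_uminus_Cons[of 2 0 "[(0, 2)]" "- 2" n] by simp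
  ultimately have "kappa (- 2) n [(- 2, 0), (0, 2)] * (kappa 0 n [(0, 2)] * kappa 2 n [(0, 2), (2, 0)]) = 1"
    by simp
  then show ?thesis by (simp add: edge_def mult_ac)
qed

text \<open>Replacing s by 1/s in -s^n/(1-s^2) gives s^(2-n)/(1-s^2).\<close>

lemma edge_flip: "delta_hat (- 1) 0 0 (- 1) (edge n) = kappa 0 (2 - n) [(0, 2)]"
proof -
  have "delta_hat (- 1) 0 0 (- 1) (edge n * kappa 0 n [(0, 2)]) = 1"
    by (simp add: edge_kappa delta_hat_ring_hom(3))
  then have 1: "delta_hat (- 1) 0 0 (- 1) (edge n) * kappa 0 (- n) [(0, - 2)] = 1"
    by (simp add: delta_hat_ring_hom(2) delta_hat_kappa)
  have 2: "kappa 0 (- n) [(0, - 2)] * kappa 0 (2 - n) [(0, 2)] = 1"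
    using kappa_uminus_Cons[of 0 2 "[]" 0 "- n"] by (simp add: add.commute[of _ 2])
  have "delta_hat (- 1) 0 0 (- 1) (edge n) =
      delta_hat (- 1) 0 0 (- 1) (edge n) * (kappa 0 (- n) [(0, - 2)] * kappa 0 (2 - n) [(0, 2)])"
    by (simp add: 2)
  also have "\<dots> = kappa 0 (2 - n) [(0, 2)]"
    using 1 by (simp add: mult.assoc[symmetric])
  finally show ?thesis .
qed

lemma edge_1_flip: "edge 1 * delta_hat (- 1) 0 0 (- 1) (edge 1) = 1"
  by (simp add: edge_flip edge_kappa)

text \<open>The exponent 1 is fixed by n -> 2 - n and cancels completely, but 2 goes to 0, and (1 -
  s^2)/(1 - s^2) = 1 leaves the single term of exponent 0 without denominators.\<close>

lemma edge_2_flip: "edge 2 * delta_hat (- 1) 0 0 (- 1) (edge 2) = kappa 0 0 []"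
proof -
  have "kappa 0 0 [(0, 2)] = kappa 0 0 [] * kappa 0 2 [(0, 2)]"
    using kappa_Cons[of 0 2 "[]" 0 0] by simp
  then have "edge 2 * kappa 0 0 [(0, 2)] = kappa 0 0 [] * (edge 2 * kappa 0 2 [(0, 2)])"
    by (simp only: mult.left_commute)
  then show ?thesis by (simp add: edge_flip edge_kappa)
qed

text \<open>Terms odd in p cancel, as p/(1-p^2) + p^-1/(1-p^-2) = 0, and terms with p^2 and p^-2
  pair up to \<open>edge\<close>. In the last product both simple pairs are odd, hence no
  \<open>edge 1\<close>; this asymmetry disappears in the fourth power by
  \<open>edge_1_flip\<close>.\<close>

lemma square_scalars:
  "dA alpha * dT (dA alpha) = edge 2 ^ 2 * edge 1"
  "dA beta * dT (dA gamma) = edge 2 ^ 2 * edge 1"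
  "dA gamma * dT (dA beta) = edge 2 ^ 2"
proof -
  let ?L = "[(0, 2), (2, 0)] :: (int \<times> int) list" and ?M = "[(- 2, 0), (0, 2)] :: (int \<times> int) list"
  have "dT (dA alpha) = kappa (- 2) 1 ?M * kappa (- 2) 2 ?M ^ 2 * kappa (- 1) 2 ?M"
    "dT (dA beta) = kappa (- 1) 1 ?M * kappa (- 2) 2 ?M ^ 2 * kappa (- 1) 2 ?M"
    "dT (dA gamma) = kappa (- 2) 1 ?M * kappa (- 2) 2 ?M ^ 2 * kappa (- 1) 1 ?M"
    by (simp_all add: dA_alpha dA_beta dA_gamma power2_eq_square delta_hat_ring_hom(2) delta_hat_kappa)
  note dT = this
  have inv: "kappa 1 n ?L * kappa (- 1) n ?M = 1" for n
    using kappa_uminus_Cons[of 2 0 "[(0, 2)]" "- 1" n] kappa_swap[of 1 n "(0, 2)" "(2, 0)"]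
    by (simp add: mult.commute)
  note dA = dA_alpha dA_beta dA_gamma
  have "dA alpha * dT (dA alpha) = edge 2 ^ 2 * edge 1 * (kappa 1 2 ?L * kappa (- 1) 2 ?M)"
    unfolding dT unfolding dA edge_def power2_eq_square by (simp only: mult_ac)
  then show "dA alpha * dT (dA alpha) = edge 2 ^ 2 * edge 1" by (simp add: inv)
  have "dA beta * dT (dA gamma) = edge 2 ^ 2 * edge 1 * (kappa 1 1 ?L * kappa (- 1) 1 ?M)"
    unfolding dT unfolding dA edge_def power2_eq_square by (simp only: mult_ac)
  then show "dA beta * dT (dA gamma) = edge 2 ^ 2 * edge 1" by (simp add: inv)
  have "dA gamma * dT (dA beta) = edge 2 ^ 2 * (kappa 1 1 ?L * kappa (- 1) 1 ?M) * (kappa 1 2 ?L * kappa (- 1) 2 ?M)"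
    unfolding dT unfolding dA edge_def power2_eq_square by (simp only: mult_ac)
  then show "dA gamma * dT (dA beta) = edge 2 ^ 2" by (simp add: inv)
qed

section \<open>Functions of Q alone and the coefficients of the matrices\<close>

lemma generic_Q:
  assumes "x \<in> generic" "n > 0"
  shows "fst x \<noteq> 0" "fst x ^ n \<noteq> 1"
proof -
  show "fst x \<noteq> 0" using generic_torus[OF assms(1)] by (auto simp: torus_def)
  have "norm (mon (int n) 0 0 x) \<noteq> 1" using norm_mon_generic[OF assms(1)] assms(2) by simp
  then have "mon (int n) 0 0 x \<noteq> 1" by auto
  then show "fst x ^ n \<noteq> 1" by (simp add: mon_def case_prod_unfold)
qed

lemma regular_Q: "regular (\<lambda>x. fst x)"
  by (intro regular_torus holo_on_fst)

definition regular_Q_fun :: "(complex \<Rightarrow> complex) \<Rightarrow> bool" where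
  "regular_Q_fun g \<longleftrightarrow> regular (\<lambda>x. g (fst x))"

lemma fun_of_Q_eq: "fun_of_Q g = germ (\<lambda>x. g (fst x))"
  by (simp add: fun_of_Q_def case_prod_unfold)

lemma delta_hat_fun_of_Q:
  assumes "regular_Q_fun g" "a * d - b * c = 1"
  shows "delta_hat a b c d (fun_of_Q g) = fun_of_Q g"
  using delta_hat_germ[OF assms(1)[unfolded regular_Q_fun_def] assms(2)]
  by (simp add: fun_of_Q_eq mono_map_def case_prod_unfold)

text \<open>At a generic point Q is neither 0 nor a root of unity, so denominators such as 1 - Q^4
  may be cleared when checking the product.\<close>

lemma fun_of_Q_mult:
  assumes "regular_Q_fun f" "regular_Q_fun g" "regular_Q_fun h"
    and "\<And>Q. Q \<noteq> 0 \<Longrightarrow> (\<And>n. n > 0 \<Longrightarrow> Q ^ n \<noteq> 1) \<Longrightarrow> f Q * g Q = h Q"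
  shows "fun_of_Q f * fun_of_Q g = fun_of_Q h"
  unfolding fun_of_Q_eq germ_mult[OF assms(1,2)[unfolded regular_Q_fun_def]]
proof (rule germ_cong)
  fix x assume "x \<in> generic"
  then show "f (fst x) * g (fst x) = h (fst x)"
    using generic_Q[of x] by (intro assms(4)) (auto simp: generic_Q(1)[of _ 1])
qed (use assms(1-3) in \<open>auto simp: regular_Q_fun_def intro: regular_mult\<close>)

lemma fun_of_Q_1: "fun_of_Q (\<lambda>_. 1) = 1"
  by (simp add: fun_of_Q_eq germ_const_1)

lemma depends_on_Q_only_fun_of_Q: "regular_Q_fun g \<Longrightarrow> depends_on_Q_only (fun_of_Q g)"
  unfolding regular_Q_fun_def depends_on_Q_only_def fun_of_Q_eq case_prod_unfold
  by (erule regularE) blast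

lemma fun_of_Q_unit:
  assumes "regular_Q_fun g" "\<And>Q. Q \<noteq> 0 \<Longrightarrow> g Q \<noteq> 0"
  shows "fun_of_Q g dvd 1"
proof -
  have "regular_Q_fun (\<lambda>Q. 1 / g Q)"
    using assms generic_Q(1)[of _ 1] unfolding regular_Q_fun_def
    by (intro regular_divide regular_const) auto
  then have "fun_of_Q g * fun_of_Q (\<lambda>Q. 1 / g Q) = fun_of_Q (\<lambda>_. 1)"
    using assms by (intro fun_of_Q_mult) (auto simp: regular_Q_fun_def regular_const)
  then show ?thesis unfolding fun_of_Q_1 by (metis dvdI)
qed


lemma fun_of_Q_add:
  assumes "regular_Q_fun f" "regular_Q_fun g"
  shows "fun_of_Q f + fun_of_Q g = fun_of_Q (\<lambda>Q. f Q + g Q)"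
  unfolding fun_of_Q_eq by (rule germ_add) (use assms in \<open>simp_all add: regular_Q_fun_def\<close>)

lemma fun_of_Q_0: "fun_of_Q (\<lambda>_. 0) = 0"
  unfolding fun_of_Q_eq zero_hfun_def by (rule germ_eq[OF open_dense_torus holo_on_const])

lemma regular_Q_fun_const: "regular_Q_fun (\<lambda>_. c)"
  by (simp add: regular_Q_fun_def regular_const)

lemma regular_Q_fun_uminus: "regular_Q_fun g \<Longrightarrow> regular_Q_fun (\<lambda>Q. - g Q)"
  by (simp add: regular_Q_fun_def regular_uminus)

lemma regular_Q_fun_mult:
  "regular_Q_fun f \<Longrightarrow> regular_Q_fun g \<Longrightarrow> regular_Q_fun (\<lambda>Q. f Q * g Q)"
  by (simp add: regular_Q_fun_def regular_mult)

lemma fun_of_Q_uminus: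
  assumes "regular_Q_fun g"
  shows "- fun_of_Q g = fun_of_Q (\<lambda>Q. - g Q)"
proof -
  have "fun_of_Q g + fun_of_Q (\<lambda>Q. - g Q) = 0"
    unfolding fun_of_Q_add[OF assms regular_Q_fun_uminus[OF assms]] by (simp add: fun_of_Q_0)
  then show ?thesis by (rule minus_unique)
qed

lemma fun_of_Q_numeral: "fun_of_Q (\<lambda>_. numeral k) = numeral k"
proof (induction k)
  case One show ?case by (simp add: fun_of_Q_1)
next
  case (Bit0 k) then show ?case unfolding numeral_Bit0 fun_of_Q_add[OF regular_Q_fun_const regular_Q_fun_const, symmetric] by (simp only:)
next
  case (Bit1 k) then show ?case unfolding numeral_Bit1 fun_of_Q_add[OF regular_Q_fun_const regular_Q_fun_const, symmetric] fun_of_Q_1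
    by (simp only:)
qed

text \<open>The coefficients occurring in \<^const>\<open>D_A\<close> and \<^const>\<open>D_B\<close>, and the factor \<open>ck\<close> of the braid relation.\<close>

definition cq :: hfun where "cq = fun_of_Q (\<lambda>Q. - \<i> * Q)"
definition cu :: hfun where "cu = fun_of_Q (\<lambda>Q. 2 * Q / (1 - Q ^ 4))"
definition cw :: hfun where "cw = fun_of_Q (\<lambda>Q. 2 * Q ^ 4 / (1 - Q ^ 4)\<^sup>2)"
definition cn :: hfun where "cn = fun_of_Q (\<lambda>Q. - ((1 - Q ^ 4) / Q ^ 3))"
definition cy :: hfun where "cy = fun_of_Q (\<lambda>Q. (1 - Q ^ 4)\<^sup>2 / (2 * Q ^ 4))"
definition ck :: hfun where "ck = fun_of_Q (\<lambda>Q. - \<i> * Q / 2)"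

lemma regular_Q_coefficients:
  "regular_Q_fun (\<lambda>Q. - \<i> * Q)" "regular_Q_fun (\<lambda>Q. 2 * Q / (1 - Q ^ 4))"
  "regular_Q_fun (\<lambda>Q. 2 * Q ^ 4 / (1 - Q ^ 4)\<^sup>2)" "regular_Q_fun (\<lambda>Q. - ((1 - Q ^ 4) / Q ^ 3))"
  "regular_Q_fun (\<lambda>Q. (1 - Q ^ 4)\<^sup>2 / (2 * Q ^ 4))" "regular_Q_fun (\<lambda>Q. - \<i> * Q / 2)"
  "regular_Q_fun (\<lambda>Q. - (1 / Q ^ 8))" "regular_Q_fun (\<lambda>Q. 16 * (1 / Q ^ 16))"
  unfolding regular_Q_fun_def
  by (intro regular_divide regular_mult regular_uminus regular_diff regular_power regular_Q regular_const;
      use generic_Q(2)[of _ 4] generic_Q(1)[of _ 4] in auto)+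

text \<open>These five relations carry all that the matrix products need to know about Q; what
  follows for the matrices is algebra in a commutative ring.\<close>

lemma coefficient_relations:
  "cw * cy = 1" "cw * cn = - cu" "cy * cu = - cn" "ck * (cq * (cu * cn)) = 1" "2 * ck = cq"
proof -
  note reg = regular_Q_coefficients regular_Q_fun_const regular_Q_fun_mult regular_Q_fun_uminus
  show "cw * cy = 1"
    unfolding cw_def cy_def fun_of_Q_1[symmetric]
  proof (intro fun_of_Q_mult reg)
    fix Q :: complex assume "Q \<noteq> 0" "\<And>n. n > 0 \<Longrightarrow> Q ^ n \<noteq> 1"
    then have "Q \<noteq> 0" "1 - Q ^ 4 \<noteq> 0" by simp_all
    then show "2 * Q ^ 4 / (1 - Q ^ 4)\<^sup>2 * ((1 - Q ^ 4)\<^sup>2 / (2 * Q ^ 4)) = 1" by simp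
  qed
  show "cw * cn = - cu"
    unfolding cw_def cn_def cu_def fun_of_Q_uminus[OF reg(2)]
  proof (intro fun_of_Q_mult reg)
    fix Q :: complex assume "Q \<noteq> 0" "\<And>n. n > 0 \<Longrightarrow> Q ^ n \<noteq> 1"
    then have "Q \<noteq> 0" "1 - Q ^ 4 \<noteq> 0" by simp_all
    then show "2 * Q ^ 4 / (1 - Q ^ 4)\<^sup>2 * - ((1 - Q ^ 4) / Q ^ 3) = - (2 * Q / (1 - Q ^ 4))"
      by (simp add: divide_simps) algebra
  qed
  show "cy * cu = - cn"
    unfolding cy_def cn_def cu_def fun_of_Q_uminus[OF reg(4)]
  proof (intro fun_of_Q_mult reg)
    fix Q :: complex assume "Q \<noteq> 0" "\<And>n. n > 0 \<Longrightarrow> Q ^ n \<noteq> 1"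
    then have "Q \<noteq> 0" "1 - Q ^ 4 \<noteq> 0" by simp_all
    then show "(1 - Q ^ 4)\<^sup>2 / (2 * Q ^ 4) * (2 * Q / (1 - Q ^ 4)) = - (- ((1 - Q ^ 4) / Q ^ 3))"
      by (simp add: divide_simps) algebra
  qed
  have Q2: "regular_Q_fun (\<lambda>Q. - 2 / Q\<^sup>2)"
    unfolding regular_Q_fun_def
    by (intro regular_divide regular_power regular_Q regular_const) (use generic_Q(1)[of _ 4] in auto)
  have un: "cu * cn = fun_of_Q (\<lambda>Q. - 2 / Q\<^sup>2)"
    unfolding cn_def cu_def
  proof (intro fun_of_Q_mult reg Q2)
    fix Q :: complex assume "Q \<noteq> 0" "\<And>n. n > 0 \<Longrightarrow> Q ^ n \<noteq> 1"
    then have "Q \<noteq> 0" "1 - Q ^ 4 \<noteq> 0" by simp_all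
    then show "2 * Q / (1 - Q ^ 4) * - ((1 - Q ^ 4) / Q ^ 3) = - 2 / Q\<^sup>2"
      by (simp add: divide_simps power2_eq_square power3_eq_cube)
  qed
  \<comment> \<open>This product simplifies to 2i/Q, which determines \<open>ck\<close> as its
    inverse -iQ/2.\<close>
  have "cq * (cu * cn) = fun_of_Q (\<lambda>Q. - \<i> * Q * (- 2 / Q\<^sup>2))"
    unfolding un cq_def by (intro fun_of_Q_mult reg Q2) simp
  then show "ck * (cq * (cu * cn)) = 1"
    unfolding ck_def fun_of_Q_1[symmetric]
    by (simp only:, intro fun_of_Q_mult reg Q2) (simp add: divide_simps power2_eq_square)
  show "2 * ck = cq"
    unfolding fun_of_Q_numeral[symmetric] ck_def cq_def
    by (intro fun_of_Q_mult reg) simp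
qed

lemma coefficient_relations':
  "ck * (cq * (cu * cu)) = - cw" "ck * (cq * (cn * cn)) = - cy"
  "cq * (cq * (cu * cn)) = 2" "cq * (cq * (cu * cu)) = - 2 * cw" "cq * (cq * (cn * cn)) = - 2 * cy"
proof -
  note rel = coefficient_relations
  have "cu * cu = - (cu * cn * cw)"
    using arg_cong[OF rel(2), of "\<lambda>t. - (cu * t)"] by (simp add: mult_ac)
  then have "ck * (cq * (cu * cu)) = - (ck * (cq * (cu * cn)) * cw)" by (simp add: mult.assoc)
  then show 1: "ck * (cq * (cu * cu)) = - cw" by (simp add: rel(4))
  have "cn * cn = - (cu * cn * cy)"
    using arg_cong[OF rel(3), of "\<lambda>t. - (cn * t)"] by (simp add: mult_ac)
  then have "ck * (cq * (cn * cn)) = - (ck * (cq * (cu * cn)) * cy)" by (simp add: mult.assoc)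
  then show 2: "ck * (cq * (cn * cn)) = - cy" by (simp add: rel(4))
  have double: "cq * (cq * x) = 2 * (ck * (cq * x))" for x
    using arg_cong[OF rel(5), of "\<lambda>t. t * (cq * x)"] by (simp add: mult.assoc)
  show "cq * (cq * (cu * cn)) = 2" "cq * (cq * (cu * cu)) = - 2 * cw"
    "cq * (cq * (cn * cn)) = - 2 * cy"
    unfolding double 1 2 rel(4) by simp_all
qed

section \<open>The matrix products and the two relations\<close>

lemma D_A_hat_nth:
  "D_A_hat v $ 1 = dA (v $ 1)" "D_A_hat v $ 2 = cq * dA (v $ 2)" "D_A_hat v $ 3 = - dA (v $ 3)"
  by (simp_all add: D_A_hat_def D_A_def matrix_vector_mult_def sum_3 vector_3 cq_def)

lemma D_B_hat_nth:
  "D_B_hat v $ 1 = alpha * dB (v $ 1) + cu * beta * dB (v $ 2) + cw * alpha * dB (v $ 3)"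
  "D_B_hat v $ 2 = cn * gamma * dB (v $ 1) + cu * gamma * dB (v $ 3)"
  "D_B_hat v $ 3 = cy * alpha * dB (v $ 1) + cn * beta * dB (v $ 2) + alpha * dB (v $ 3)"
  unfolding cu_def cw_def cn_def cy_def
  by (simp_all add: D_B_hat_def D_B_def matrix_vector_mult_def sum_3 vector_3)

lemma delta_hat_coefficients:
  assumes "a * d - b * c = 1"
  shows "delta_hat a b c d cq = cq" "delta_hat a b c d cu = cu" "delta_hat a b c d cw = cw"
    "delta_hat a b c d cn = cn" "delta_hat a b c d cy = cy"
  unfolding cq_def cu_def cw_def cn_def cy_def
  by (intro delta_hat_fun_of_Q regular_Q_coefficients assms)+

lemma delta_hat_diff: "delta_hat a b c d (x - y) = delta_hat a b c d x - delta_hat a b c d y"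
  using delta_hat_ring_hom(1)[of a b c d x "- y"] by (simp add: delta_hat_uminus)

lemma delta_hat_numeral: "delta_hat a b c d (numeral k) = numeral k"
proof (induction k)
  case One show ?case by (simp add: delta_hat_ring_hom)
next
  case (Bit0 k) then show ?case unfolding numeral_Bit0 delta_hat_ring_hom by (simp only:)
next
  case (Bit1 k) then show ?case unfolding numeral_Bit1 delta_hat_ring_hom by (simp only:)
qed

lemmas delta_hat_simps = delta_hat_ring_hom(1,2) delta_hat_uminus delta_hat_diff delta_hat_comp
  delta_hat_coefficients delta_hat_numeral

abbreviation "ABA \<equiv> D_A_hat \<circ> D_B_hat \<circ> D_A_hat"
abbreviation "BAB \<equiv> D_B_hat \<circ> D_A_hat \<circ> D_B_hat"
abbreviation "dBA \<equiv> delta_hat 0 1 (- 1) 1"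
abbreviation "dTT \<equiv> delta_hat (- 1) 0 0 (- 1)"

lemma ABA_nth:
  "ABA v $ 1 = dA alpha * dT (v $ 1) + cq * cu * dA beta * dT (v $ 2) - cw * dA alpha * dT (v $ 3)"
  "ABA v $ 2 = cq * cn * dA gamma * dT (v $ 1) - cq * cu * dA gamma * dT (v $ 3)"
  "ABA v $ 3 = - cy * dA alpha * dT (v $ 1) - cq * cn * dA beta * dT (v $ 2) + dA alpha * dT (v $ 3)"
  by (simp_all add: D_A_hat_nth D_B_hat_nth delta_hat_simps) (simp_all add: algebra_simps)

text \<open>Collecting by products of scalars, the coefficient 1 - cw cy of
  \<open>alpha * dBA alpha\<close> vanishes and cu - cw cn doubles to 2 cu. Each nonzero entry is
  left with one product, of exactly the kind that \<open>braid_scalars\<close> identifies with an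
  entry of ABA.\<close>

lemma BAB_nth:
  "BAB v $ 1 = cq * cu * cn * beta * dBA gamma * dT (v $ 1) + 2 * cu * alpha * dBA beta * dT (v $ 2)
    + cq * cu * cu * beta * dBA gamma * dT (v $ 3)"
  "BAB v $ 2 = 2 * cn * gamma * dBA alpha * dT (v $ 1) - 2 * cu * gamma * dBA alpha * dT (v $ 3)"
  "BAB v $ 3 = cq * cn * cn * beta * dBA gamma * dT (v $ 1) - 2 * cn * alpha * dBA beta * dT (v $ 2)
    + cq * cn * cu * beta * dBA gamma * dT (v $ 3)"
proof -
  have "BAB v $ 1 = cq * cu * cn * beta * dBA gamma * dT (v $ 1)
    + (1 - cw * cy) * (alpha * dBA alpha * dT (v $ 1))
    + (cu - cw * cn) * (alpha * dBA beta * dT (v $ 2)) + cq * cu * cu * beta * dBA gamma * dT (v $ 3)"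
    by (simp add: D_A_hat_nth D_B_hat_nth delta_hat_simps) (simp add: algebra_simps)
  then show "BAB v $ 1 = cq * cu * cn * beta * dBA gamma * dT (v $ 1)
    + 2 * cu * alpha * dBA beta * dT (v $ 2) + cq * cu * cu * beta * dBA gamma * dT (v $ 3)"
    by (simp add: coefficient_relations)
  have "BAB v $ 2 = (cn - cy * cu) * (gamma * dBA alpha * dT (v $ 1))
    + (cw * cn - cu) * (gamma * dBA alpha * dT (v $ 3))"
    by (simp add: D_A_hat_nth D_B_hat_nth delta_hat_simps algebra_simps)
  then show "BAB v $ 2 = 2 * cn * gamma * dBA alpha * dT (v $ 1) - 2 * cu * gamma * dBA alpha * dT (v $ 3)"
    by (simp add: coefficient_relations)
  have "BAB v $ 3 = cq * cn * cn * beta * dBA gamma * dT (v $ 1)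
    + (cy * cu - cn) * (alpha * dBA beta * dT (v $ 2)) + cq * cn * cu * beta * dBA gamma * dT (v $ 3)
    + (cw * cy - 1) * (alpha * dBA alpha * dT (v $ 3))"
    by (simp add: D_A_hat_nth D_B_hat_nth delta_hat_simps) (simp add: algebra_simps)
  then show "BAB v $ 3 = cq * cn * cn * beta * dBA gamma * dT (v $ 1)
    - 2 * cn * alpha * dBA beta * dT (v $ 2) + cq * cn * cu * beta * dBA gamma * dT (v $ 3)"
    by (simp add: coefficient_relations)
qed

lemma braid: "ABA v = ck *s BAB v"
proof -
  have "ck * BAB v $ 1 = (ck * (cq * (cu * cn))) * (beta * dBA gamma * dT (v $ 1))
      + (2 * ck) * (cu * alpha * dBA beta * dT (v $ 2))
      + (ck * (cq * (cu * cu))) * (beta * dBA gamma * dT (v $ 3))"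
    unfolding BAB_nth by (simp add: algebra_simps)
  moreover have "ck * BAB v $ 2 = (2 * ck) * (cn * gamma * dBA alpha * dT (v $ 1))
      - (2 * ck) * (cu * gamma * dBA alpha * dT (v $ 3))"
    unfolding BAB_nth by (simp add: algebra_simps)
  moreover have "ck * BAB v $ 3 = (ck * (cq * (cn * cn))) * (beta * dBA gamma * dT (v $ 1))
      - (2 * ck) * (cn * alpha * dBA beta * dT (v $ 2))
      + (ck * (cq * (cu * cn))) * (beta * dBA gamma * dT (v $ 3))"
    unfolding BAB_nth by (simp add: algebra_simps)
  ultimately show ?thesis
    unfolding vec_eq_iff forall_3 vector_smult_component ABA_nth braid_scalars
      coefficient_relations coefficient_relations' by (simp add: algebra_simps)
qed

text \<open>Entries linking the second coordinate to the others vanish through cu + cw cn = 0 and cn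
  + cy cu = 0. Those linking the first and third vanish because the first two products in
  \<open>square_scalars\<close> agree. On the diagonal the coefficient is (1 + 1) + 2 or 2 *
  2.\<close>

lemma ABA_square_nth:
  "ABA (ABA v) $ 1 = 4 * (edge 2 ^ 2 * edge 1) * dTT (v $ 1)"
  "ABA (ABA v) $ 2 = 4 * edge 2 ^ 2 * dTT (v $ 2)"
  "ABA (ABA v) $ 3 = 4 * (edge 2 ^ 2 * edge 1) * dTT (v $ 3)"
proof -
  let ?a = "dA alpha" and ?b = "dA beta" and ?g = "dA gamma"
  have "ABA (ABA v) $ 1 = (1 + cw * cy) * (?a * dT ?a) * dTT (v $ 1)
      + (cq * (cq * (cu * cn))) * (?b * dT ?g) * dTT (v $ 1)
      + (cu + cw * cn) * cq * ?a * dT ?b * dTT (v $ 2)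
      - 2 * cw * (?a * dT ?a) * dTT (v $ 3) - (cq * (cq * (cu * cu))) * (?b * dT ?g) * dTT (v $ 3)"
    unfolding ABA_nth[of "ABA v"] unfolding ABA_nth[of v]
    by (simp add: delta_hat_simps) (simp add: algebra_simps)
  then show "ABA (ABA v) $ 1 = 4 * (edge 2 ^ 2 * edge 1) * dTT (v $ 1)"
    unfolding square_scalars coefficient_relations coefficient_relations' by (simp add: algebra_simps)
  have "ABA (ABA v) $ 2 = (cn + cy * cu) * cq * ?g * dT ?a * dTT (v $ 1)
      + 2 * (cq * (cq * (cu * cn))) * (?g * dT ?b) * dTT (v $ 2)
      - (cw * cn + cu) * cq * ?g * dT ?a * dTT (v $ 3)"
    unfolding ABA_nth[of "ABA v"] unfolding ABA_nth[of v]
    by (simp add: delta_hat_simps) (simp add: algebra_simps)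
  then show "ABA (ABA v) $ 2 = 4 * edge 2 ^ 2 * dTT (v $ 2)"
    unfolding square_scalars coefficient_relations coefficient_relations' by (simp add: algebra_simps)
  have "ABA (ABA v) $ 3 = - 2 * cy * (?a * dT ?a) * dTT (v $ 1)
      - (cq * (cq * (cn * cn))) * (?b * dT ?g) * dTT (v $ 1)
      - (cy * cu + cn) * cq * ?a * dT ?b * dTT (v $ 2)
      + (1 + cw * cy) * (?a * dT ?a) * dTT (v $ 3)
      + (cq * (cq * (cu * cn))) * (?b * dT ?g) * dTT (v $ 3)"
    unfolding ABA_nth[of "ABA v"] unfolding ABA_nth[of v]
    by (simp add: delta_hat_simps) (simp add: algebra_simps)
  then show "ABA (ABA v) $ 3 = 4 * (edge 2 ^ 2 * edge 1) * dTT (v $ 3)"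
    unfolding square_scalars coefficient_relations coefficient_relations' by (simp add: algebra_simps)
qed

text \<open>Without parameters the symbol is 1 - z; at z = Q^-8 and z = Q^8 the quotient is (1 -
  Q^-8)/(1 - Q^8) = -Q^-8.\<close>

lemma kappa_Nil_square: "16 * (kappa 0 0 [] * kappa 0 0 []) = fun_of_Q (\<lambda>Q. 16 * (1 / Q ^ 16))"
proof -
  have "kappa 0 0 [] = fun_of_Q (\<lambda>Q. - (1 / Q ^ 8))"
    unfolding kappa_def fun_of_Q_eq
  proof (rule germ_cong)
    fix x assume x: "x \<in> generic"
    have "mpoch_quot 0 0 [] x = (1 - 1 / fst x ^ 8) / (1 - fst x ^ 8)"
      by (simp add: mpoch_quot_def mpoch_at_def mpoch_Nil mon_def case_prod_unfold power_int_minus divide_inverse)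
    also have "\<dots> = - (1 / fst x ^ 8)"
      using generic_Q[OF x, of 8] by (simp add: divide_simps)
    finally show "mpoch_quot 0 0 [] x = - (1 / fst x ^ 8)" .
  qed (use regular_mpoch_quot[of "[]"] regular_Q_coefficients(7) in \<open>simp_all add: regular_Q_fun_def\<close>)
  then have "kappa 0 0 [] * kappa 0 0 [] = fun_of_Q (\<lambda>Q. - (1 / Q ^ 8) * - (1 / Q ^ 8))"
    by (simp only:) (intro fun_of_Q_mult regular_Q_coefficients regular_Q_fun_mult, simp)
  then show ?thesis
    unfolding fun_of_Q_numeral[symmetric]
    by (simp only:)
      (intro fun_of_Q_mult regular_Q_coefficients regular_Q_fun_mult regular_Q_fun_const,
        simp add: power_add[symmetric] divide_simps)
qed

text \<open>The square is diagonal followed by \<open>dTT\<close>, an involution, so each entry of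
  the fourth power is 16 times \<open>G * dTT G\<close>. The two different diagonal scalars
  \<open>G\<close> give the same value, since \<open>edge 1\<close> cancels against its
  flip.\<close>

lemma ABA_power_4: "(ABA ^^ 4) v = fun_of_Q (\<lambda>Q. 16 * (1 / Q ^ 16)) *s v"
proof -
  define E where "E = edge 2 ^ 2 * edge 1"
  have E: "E * dTT E = (edge 2 * dTT (edge 2)) * (edge 2 * dTT (edge 2)) * (edge 1 * dTT (edge 1))"
    and F: "edge 2 ^ 2 * dTT (edge 2 ^ 2) = (edge 2 * dTT (edge 2)) * (edge 2 * dTT (edge 2))"
    unfolding E_def power2_eq_square delta_hat_ring_hom by (simp_all only: mult_ac)
  have *: "4 * G * dTT (4 * G * dTT x) = fun_of_Q (\<lambda>Q. 16 * (1 / Q ^ 16)) * x"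
    if "G * dTT G = kappa 0 0 [] * kappa 0 0 []" for G x
  proof -
    have "4 * G * dTT (4 * G * dTT x) = 16 * (G * dTT G) * x"
      by (simp add: delta_hat_simps delta_hat_id) 
    then show ?thesis using that kappa_Nil_square by simp
  qed
  have "(ABA ^^ 4) v = ABA (ABA (ABA (ABA v)))"
    by (simp add: numeral_eq_Suc)
  also have "\<dots> = fun_of_Q (\<lambda>Q. 16 * (1 / Q ^ 16)) *s v"
    unfolding vec_eq_iff forall_3 vector_smult_component ABA_square_nth E_def[symmetric]
    by (intro conjI *) (simp_all only: E F edge_1_flip edge_2_flip mult_1_right)
  finally show ?thesis .
qed

theorem theorem26:
  shows "D_A_hat \<circ> D_B_hat \<circ> D_A_hat \<propto> D_B_hat \<circ> D_A_hat \<circ> D_B_hat \<and>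
    (D_A_hat \<circ> D_B_hat \<circ> D_A_hat) ^^ 4 \<propto> id"
proof
  show "ABA \<propto> BAB"
    unfolding proportional_def
  proof (intro exI[of _ ck] conjI allI braid)
    show "ck dvd 1" "depends_on_Q_only ck"
      unfolding ck_def
      by (intro fun_of_Q_unit depends_on_Q_only_fun_of_Q regular_Q_coefficients; simp)+
  qed
  show "ABA ^^ 4 \<propto> id"
    unfolding proportional_def
  proof (intro exI conjI allI)
    show "fun_of_Q (\<lambda>Q. 16 * (1 / Q ^ 16)) dvd 1" "depends_on_Q_only (fun_of_Q (\<lambda>Q. 16 * (1 / Q ^ 16)))"
      by (intro fun_of_Q_unit depends_on_Q_only_fun_of_Q regular_Q_coefficients; simp)+
    show "(ABA ^^ 4) v = fun_of_Q (\<lambda>Q. 16 * (1 / Q ^ 16)) *s id v" for v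
      by (simp only: ABA_power_4 id_apply)
  qed
qed

end
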